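(* Fix an o-minimal structure on the real field. Let $f:\mathbb{R}^n \rightarrow \mathbb{R}$ be a locally Lipschitz coercive function that is tame in this structure, and let $\mathcal{M}$ be an iterative method with constant step size that is approximated by subgradient trajectories of $f$. For any bounded set $X_0 \subset \mathbb{R}^n$ and $\epsilon>0$, there exists $\bar{\alpha}>0$ such that for all $\alpha\in(0,\bar{\alpha}]$ and all $(x_k)_{k \in \mathbb{N}} \in \mathcal{M}(f,\alpha,X_0,0)$, there exist a connected component $C$ of the set of critical points of $f$ and $k_0 \in \mathbb{N}$ such that $d(x_k,C) \leqslant \epsilon$ for all $k \geqslant k_0$.
   Context: Notation: $\mathbb{N}=\{0,1,2,\ldots\}$; $\langle\cdot,\cdot\rangle$ is an inner product on $\mathbb{R}^n$ with induced norm $\|\cdot\|$; $B(a,r)$ is the closed ball of center $a$ and radius $r>0$; $d(x,S):=\inf\{\|x-y\|:y\in S\}$ for $S\subset\mathbb{R}^n$; $\lfloor\cdot\rfloor$ is the floor function. A function $f:\mathbb{R}^n\to\mathbb{R}$ is locally Lipschitz if for all $a\in\mathbb{R}^n$ there exist $r>0$ and $L>0$ such that $|f(x)-f(y)|\leqslant L\|x-y\|$ for all $x,y\in B(a,r)$. It is coercive if $\lim_{\|x\|\to\infty} f(x)=\infty$. Clarke subdifferential: for $f$ locally Lipschitz, $\partial f(x) := \{ s \in \mathbb{R}^n : f^\circ(x,d) \geqslant \langle s , d \rangle\ \forall d\in \mathbb{R}^n \}$, where $f^\circ(x,d) := \limsup_{y\to x,\, t\searrow 0} \frac{f(y+td)-f(y)}{t}$.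 A point $x$ is critical if $0\in\partial f(x)$. O-minimal structure on the real field: a sequence $S=(S_k)_{k\in\mathbb{N}}$ such that for all $k\in\mathbb{N}$: (1) $S_k$ is a boolean algebra of subsets of $\mathbb{R}^k$ with $\mathbb{R}^k\in S_k$; (2) $S_k$ contains the diagonal $\{(x_1,\ldots,x_k)\in\mathbb{R}^k: x_i=x_j\}$ for $1\leqslant i<j\leqslant k$; (3) if $A\in S_k$ then $A\times\mathbb{R}$ and $\mathbb{R}\times A$ belong to $S_{k+1}$; (4) if $A\in S_{k+1}$ and $\pi:\mathbb{R}^{k+1}\to\mathbb{R}^k$ is the projection onto the first $k$ coordinates, then $\pi(A)\in S_k$; (5) $S_3$ contains the graphs of addition and multiplication; (6) $S_1$ consists exactly of the finite unions of open intervals and singletons. A set $C\subset\mathbb{R}^n$ is tame if $C\cap B(x,r)\in S_n$ for all $x\in\mathbb{R}^n$ and $r>0$; a function $f:\mathbb{R}^n\to\mathbb{R}$ is tame if its graph $\{(x,t)\in\mathbb{R}^{n+1}: f(x)=t\}$ is tame. Iterative method with constant step size: a set-valued mapping $\mathcal{M}$ which, to an objective function $f:\mathbb{R}^n\to\mathbb{R}$, a constant step size $\alpha\in(0,\infty)$, a set $X_0\subset\mathbb{R}^n$ and a natural number $\bar{k}$, associates a set $\mathcal{M}(f,\alpha,X_0,\bar{k})$ of sequences in $\mathbb{R}^n$ whose $\bar{k}$th term is contained in $X_0$. A function $x:[a,b]\to\mathbb{R}^n$ is absolutely continuous if for all $\epsilon>0$ there exists $\delta>0$ such that, for any finite collection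 of disjoint subintervals $[a_1,b_1],\ldots,[a_m,b_m]$ of $[a,b]$ with $\sum_{i=1}^m (b_i-a_i)\leqslant\delta$, we have $\sum_{i=1}^m\|x(b_i)-x(a_i)\|\leqslant\epsilon$. An iterative method $\mathcal{M}$ is approximated by subgradient trajectories of a locally Lipschitz function $f:\mathbb{R}^n\to\mathbb{R}$ (up to a positive multiplicative constant) if there exists $c>0$ such that for any compact sets $X_0,X_1\subset\mathbb{R}^n$, there exists $T>0$ such that for all $\epsilon>0$, there exists $\bar{\alpha}>0$ such that for all $\alpha\in(0,\bar{\alpha}]$, $\bar{k}\in\mathbb{N}$, and $(x_k)_{k\in\mathbb{N}}\in\mathcal{M}(f,\alpha,X_0,\bar{k})$ for which $x_0,\ldots,x_{\bar{k}}\in X_1$, there exists an absolutely continuous function $x:[0,T]\to\mathbb{R}^n$ such that $x'(t)\in -c\,\partial f(x(t))$ for almost every $t\in[0,T]$, $x(0)\in X_0$, and $\|x_k-x((k-\bar{k})\alpha)\|\leqslant\epsilon$ for $k=\bar{k},\ldots,\bar{k}+\lfloor T/\alpha\rfloor$.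
   Formalization: The iterative method is also assumed consistent: for each f and α there is one fixed set of sequences, and M(f,α,X_0,k) consists of those whose k-th term lies in X_0; without such a link between different X_0 and k the claim fails. Also n ≥ 1. *)

theory Defs
  imports "HOL-Analysis.Analysis"
begin

(* R^n with an arbitrary inner product (not necessarily the dot product) is rendered as a
   Euclidean space 'a together with an ordered linear basis bs, which need not be orthonormal:
   inner, norm, cball and infdist refer to the inner product, while the identification of 'a
   with n-tuples of reals, n = DIM('a) = length bs, is the linear isomorphism coords bs. *)

definition ordered_basis :: "'a::euclidean_space list \<Rightarrow> bool" where
  "ordered_basis bs \<longleftrightarrow> distinct bs \<and> independent (set bs) \<and> span (set bs) = UNIV"

definition coords :: "'a::euclidean_space list \<Rightarrow> 'a \<Rightarrow> real list" where
  "coords bs x = map (representation (set bs) x) bs"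


subsection \<open>O-minimal structures on the real field\<close>

(* k-tuples are the real lists of length k. The open intervals are all open convex subsets of
   the line, so unbounded ones are included. *)

definition tuples :: "nat \<Rightarrow> real list set" where
  "tuples k = {xs. length xs = k}"

definition o_minimal :: "(nat \<Rightarrow> real list set set) \<Rightarrow> bool" where
  "o_minimal S \<longleftrightarrow>
     (\<forall>k. algebra (tuples k) (S k)) \<and>
     (\<forall>k i j. i < j \<and> j < k \<longrightarrow> {xs \<in> tuples k. xs ! i = xs ! j} \<in> S k) \<and>
     (\<forall>k. \<forall>A \<in> S k. {xs @ [t] | xs t. xs \<in> A} \<in> S (Suc k) \<and>
                    {t # xs | xs t. xs \<in> A} \<in> S (Suc k)) \<and>
     (\<forall>k. \<forall>A \<in> S (Suc k). butlast ` A \<in> S k) \<and>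
     {[x, y, x + y] | x y. True} \<in> S 3 \<and>
     {[x, y, x * y] | x y. True} \<in> S 3 \<and>
     S 1 = {(\<lambda>t. [t]) ` (\<Union>F) | F. finite F \<and>
              (\<forall>I \<in> F. (open I \<and> is_interval I) \<or> (\<exists>a. I = {a}))}"

(* The map c identifies 'b with the space of DIM('b)-tuples. *)

definition tame_set ::
  "(nat \<Rightarrow> real list set set) \<Rightarrow> ('b::euclidean_space \<Rightarrow> real list) \<Rightarrow> 'b set \<Rightarrow> bool" where
  "tame_set S c C \<longleftrightarrow> (\<forall>x. \<forall>r>0. c ` (C \<inter> cball x r) \<in> S DIM('b))"

(* The balls of R^(n+1) are taken with respect to the product inner product on 'a * real. *)

definition tame_function ::
  "(nat \<Rightarrow> real list set set) \<Rightarrow> 'a::euclidean_space list \<Rightarrow> ('a \<Rightarrow> real) \<Rightarrow> bool" where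
  "tame_function S bs f \<longleftrightarrow>
     tame_set S (\<lambda>(x, t). coords bs x @ [t]) {(x, t). f x = t}"


subsection \<open>Nonsmooth functions\<close>

definition locally_lipschitz :: "('a::euclidean_space \<Rightarrow> real) \<Rightarrow> bool" where
  "locally_lipschitz f \<longleftrightarrow> (\<forall>a. \<exists>r>0. \<exists>L>0. L-lipschitz_on (cball a r) f)"

definition coercive :: "('a::euclidean_space \<Rightarrow> real) \<Rightarrow> bool" where
  "coercive f \<longleftrightarrow> filterlim f at_top at_infinity"

(* The base point y ranges over full neighbourhoods of x, y = x included. *)

definition clarke_dir_deriv :: "('a::euclidean_space \<Rightarrow> real) \<Rightarrow> 'a \<Rightarrow> 'a \<Rightarrow> ereal" where
  "clarke_dir_deriv f x d =
     Limsup (nhds x \<times>\<^sub>F at_right 0) (\<lambda>(y, t). ereal ((f (y + t *\<^sub>R d) - f y) / t))"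

definition clarke_subdiff :: "('a::euclidean_space \<Rightarrow> real) \<Rightarrow> 'a \<Rightarrow> 'a set" where
  "clarke_subdiff f x = {s. \<forall>d. clarke_dir_deriv f x d \<ge> ereal (s \<bullet> d)}"

definition critical_points :: "('a::euclidean_space \<Rightarrow> real) \<Rightarrow> 'a set" where
  "critical_points f = {x. 0 \<in> clarke_subdiff f x}"

definition absolutely_continuous_on ::
  "real \<Rightarrow> real \<Rightarrow> (real \<Rightarrow> 'a::euclidean_space) \<Rightarrow> bool" where
  "absolutely_continuous_on a b x \<longleftrightarrow>
     (\<forall>\<epsilon>>0. \<exists>\<delta>>0. \<forall>(m::nat) l u.
        (\<forall>i<m. a \<le> l i \<and> l i \<le> u i \<and> u i \<le> b) \<and>
        disjoint_family_on (\<lambda>i. {l i..u i}) {..<m} \<and>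
        (\<Sum>i<m. u i - l i) \<le> \<delta>
        \<longrightarrow> (\<Sum>i<m. norm (x (u i) - x (l i))) \<le> \<epsilon>)"


subsection \<open>Iterative methods\<close>

type_synonym 'a iter_method =
  "('a \<Rightarrow> real) \<Rightarrow> real \<Rightarrow> 'a set \<Rightarrow> nat \<Rightarrow> (nat \<Rightarrow> 'a) set"

(* For an objective f and a step size, the method generates a set G f alpha of sequences;
   M f alpha X0 k consists of those whose k-th term lies in X0. In particular every element
   of M f alpha X0 k has its k-th term in X0. That the sets for different X0 and k select from
   the same generated sequences is essential: otherwise the behaviour of M f alpha X0 0
   would not be constrained by an approximation property stated for other X0 and k. *)

definition iterative_method :: "'a::euclidean_space iter_method \<Rightarrow> bool" where
  "iterative_method M \<longleftrightarrow>
     (\<exists>G. \<forall>f. \<forall>\<alpha>>0. \<forall>X\<^sub>0 k. M f \<alpha> X\<^sub>0 k = {x \<in> G f \<alpha>. x k \<in> X\<^sub>0})"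

definition approximated_by_subgradient_trajectories ::
  "'a::euclidean_space iter_method \<Rightarrow> ('a \<Rightarrow> real) \<Rightarrow> bool" where
  "approximated_by_subgradient_trajectories M f \<longleftrightarrow>
     (\<exists>c>0. \<forall>X\<^sub>0 X\<^sub>1. compact X\<^sub>0 \<and> compact X\<^sub>1 \<longrightarrow>
       (\<exists>T>0. \<forall>\<epsilon>>0. \<exists>\<alpha>\<^sub>m>0. \<forall>\<alpha> \<in> {0<..\<alpha>\<^sub>m}. \<forall>k\<^sub>m. \<forall>x \<in> M f \<alpha> X\<^sub>0 k\<^sub>m.
         (\<forall>k \<le> k\<^sub>m. x k \<in> X\<^sub>1) \<longrightarrow>
         (\<exists>y. absolutely_continuous_on 0 T y \<and>
              (AE t in lebesgue. t \<in> {0..T} \<longrightarrow>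
                 (\<exists>s \<in> clarke_subdiff f (y t).
                    (y has_vector_derivative - c *\<^sub>R s) (at t within {0..T}))) \<and>
              y 0 \<in> X\<^sub>0 \<and>
              (\<forall>k \<in> {k\<^sub>m..k\<^sub>m + nat \<lfloor>T / \<alpha>\<rfloor>}.
                 norm (x k - y ((real k - real k\<^sub>m) * \<alpha>)) \<le> \<epsilon>))))"

end

theory Submission
  imports Defs
begin

text \<open>
  Let s range over the Clarke subdifferential of f. The proof needs only two facts about a tame
  function, and both follow from one-variable o-minimality and definable choice. First, f is
  semismooth from above: f(y) - f(x) \<le> s \<bullet> (y - x) + o(|y - x|) for s in the subdifferential at y.
  Otherwise definable choice gives a curve x + r u(r) along which this fails; since u is bounded
  and definable, |u(r) - u(r')| is small compared with |r - r'| / min r r', so that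
  (f(x + r u(r)) - f(x)) / r grows at least like - ln r as r tends to 0, against the Lipschitz
  bound. Second, the critical values in a ball are finite in number: otherwise there is a definable
  curve of critical points with f(\<gamma>(t)) = t, and it violates the first fact with s = 0.

  Along a trajectory y' = - c s, integrating the first fact in the form
  f(y(\<tau>)) - f(y(t)) \<le> - (y(\<tau>) - y(t)) \<bullet> y'(\<tau>) / c + o(\<tau> - t) shows that f decreases, at a
  positive rate away from the critical set. Iterates therefore descend up to small errors, and
  leaving a neighbourhood of a set of critical points of value v costs a fixed decrease of f that
  the errors cannot make up for. Hence the critical values visited by the iterates are eventually
  constant, and from then on the iterates stay near one relatively clopen piece of the critical
  set. By the Sura-Bura theorem such pieces may be chosen within \<epsilon> / 2 of a single component.
\<close>

subsection \<open>Definability in an o-minimal structure\<close>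

text \<open>Differentiability is never established, neither for definable functions nor for f along
  a trajectory. On the line two facts replace it: a definable condition holds throughout or fails
  throughout some interval to the right of a point, and a continuous function that can reach a later
  point without loss from every point is not smaller at the right end. Along a trajectory only the
  mean of f over short intervals is estimated, because semismoothness compares f(y(\<tau>)) with the
  fixed value f(y(t)). The last part has to avoid a circle among constants. The rate of decrease
  depends on the distance kept from the critical points, while f is tied to a critical value only
  close to them. Hence two radii: the rate at distance of order \<epsilon> prices an escape and so
  fixes a tolerance \<delta> on values; the smaller radius \<rho> that realises \<delta> has a rate
  of its own, which only forces visits and keeps f from rising between them. Errors must not add up
  over long runs, so each time window pays for its own error out of its decrease.\<close>

locale o_min =
  fixes S :: "nat \<Rightarrow> real list set set"
  assumes o_minimal: "o_minimal S"
begin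

text \<open>A set of tuples is handled through its membership predicate, so that definability can be
  proved along the shape of a formula.\<close>

definition list_def :: "nat \<Rightarrow> (real list \<Rightarrow> bool) \<Rightarrow> bool" where
  "list_def k P \<longleftrightarrow> {xs \<in> tuples k. P xs} \<in> S k"

definition list_fun :: "nat \<Rightarrow> (real list \<Rightarrow> real) \<Rightarrow> bool" where
  "list_fun k g \<longleftrightarrow> list_def (Suc k) (\<lambda>w. w ! k = g (take k w))"

lemma algebra_S: "algebra (tuples k) (S k)"
  using o_minimal by (simp add: o_minimal_def)

lemma Cons_S:
  assumes "A \<in> S k"
  shows "{t # xs | xs t. xs \<in> A} \<in> S (Suc k)"
proof -
  have "\<forall>k. \<forall>A \<in> S k. {xs @ [t] | xs t. xs \<in> A} \<in> S (Suc k) \<and>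
                    {t # xs | xs t. xs \<in> A} \<in> S (Suc k)"
    using o_minimal unfolding o_minimal_def by (elim conjE)
  with assms show ?thesis by (metis (no_types, lifting))
qed

lemma butlast_S:
  assumes "A \<in> S (Suc k)"
  shows "butlast ` A \<in> S k"
proof -
  have "\<forall>k. \<forall>A \<in> S (Suc k). butlast ` A \<in> S k"
    using o_minimal unfolding o_minimal_def by (elim conjE)
  with assms show ?thesis by blast
qed

lemma list_def_cong:
  assumes "\<And>xs. length xs = k \<Longrightarrow> P xs \<longleftrightarrow> Q xs"
  shows "list_def k P \<longleftrightarrow> list_def k Q"
proof -
  have "{xs \<in> tuples k. P xs} = {xs \<in> tuples k. Q xs}"
    using assms by (auto simp: tuples_def)
  then show ?thesis by (simp add: list_def_def)
qed

lemma list_def_conj: "list_def k P \<Longrightarrow> list_def k Q \<Longrightarrow> list_def k (\<lambda>xs. P xs \<and> Q xs)"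
  unfolding list_def_def
  using semiring_of_sets.sets_Collect_conj algebra_S[of k]
  unfolding algebra_def ring_of_sets_def by blast

lemma list_def_not: "list_def k P \<Longrightarrow> list_def k (\<lambda>xs. \<not> P xs)"
  unfolding list_def_def using algebra.sets_Collect_neg[OF algebra_S[of k]] by blast

lemma list_def_True: "list_def k (\<lambda>xs. True)"
  unfolding list_def_def using algebra.top[OF algebra_S[of k]] by simp

lemma list_def_all_less:
  "(\<And>j. j < (m::nat) \<Longrightarrow> list_def k (P j)) \<Longrightarrow> list_def k (\<lambda>xs. \<forall>j<m. P j xs)"
proof (induction m)
  case 0
  then show ?case by (simp add: list_def_True)
next
  case (Suc m)
  then have "list_def k (\<lambda>xs. (\<forall>j<m. P j xs) \<and> P m xs)"
    by (intro list_def_conj) auto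
  then show ?case by (simp add: All_less_Suc conj_commute)
qed

lemma list_def_eq:
  assumes "i < k" "j < k"
  shows "list_def k (\<lambda>xs. xs ! i = xs ! j)"
proof -
  have *: "list_def k (\<lambda>xs. xs ! i = xs ! j)" if "i < j" "j < k" for i j
    using o_minimal that by (auto simp: list_def_def o_minimal_def)
  consider "i < j" | "i = j" | "j < i" by linarith
  then show ?thesis
  proof cases
    case 3
    have "(\<lambda>xs. xs ! i = xs ! j) = (\<lambda>xs::real list. xs ! j = xs ! i)" by auto
    then show ?thesis using *[OF 3 assms(1)] by (simp only:)
  qed (use * assms list_def_True in auto)
qed

text \<open>Each dummy coordinate in front is one use of the cylinder axiom.\<close>

lemma list_def_drop:
  assumes "list_def k P"
  shows "list_def (m + k) (\<lambda>w. P (drop m w))"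
proof (induction m)
  case 0
  then show ?case using assms by simp
next
  case (Suc m)
  let ?A = "{xs \<in> tuples (m + k). P (drop m xs)}"
  have "{t # xs | xs t. xs \<in> ?A} \<in> S (Suc (m + k))"
    using Cons_S[of ?A] Suc by (simp only: list_def_def)
  moreover have "{t # xs | xs t. xs \<in> ?A} = {xs \<in> tuples (Suc (m + k)). P (drop (Suc m) xs)}"
    (is "?L = ?R")
  proof (intro equalityI subsetI)
    fix w assume "w \<in> ?R"
    then have "w = hd w # tl w" "tl w \<in> ?A"
      by (cases w; auto simp: tuples_def)+
    then show "w \<in> ?L" by blast
  qed (auto simp: tuples_def)
  ultimately show ?case by (simp add: list_def_def)
qed

text \<open>The projection axiom forgets one last coordinate at a time; quantifying over a list
  \<open>ys\<close> of length \<open>m\<close> amounts to \<open>m\<close> projections.\<close>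

lemma list_def_ex_append:
  assumes "list_def (k + m) P"
  shows "list_def k (\<lambda>xs. \<exists>ys. length ys = m \<and> P (xs @ ys))"
  using assms
proof (induction m arbitrary: P)
  case 0
  then show ?case by simp
next
  case (Suc m)
  have "butlast ` {xs \<in> tuples (Suc (k + m)). P xs} \<in> S (k + m)"
    using Suc.prems by (simp add: list_def_def butlast_S)
  moreover have "butlast ` {xs \<in> tuples (Suc (k + m)). P xs} =
      {xs \<in> tuples (k + m). \<exists>t. P (xs @ [t])}" (is "?L = ?R")
  proof (intro equalityI subsetI)
    fix w assume "w \<in> ?L"
    then obtain v where v: "length v = Suc (k + m)" "P v" "w = butlast v"
      by (auto simp: tuples_def)
    then have "v = w @ [last v]" by (metis append_butlast_last_id length_0_conv nat.distinct(1))
    then show "w \<in> ?R" using v by (auto simp: tuples_def intro: exI[of _ "last v"])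
  next
    fix w assume "w \<in> ?R"
    then obtain t where "length w = k + m" "P (w @ [t])" by (auto simp: tuples_def)
    then show "w \<in> ?L" by (intro image_eqI[of _ _ "w @ [t]"]) (auto simp: tuples_def)
  qed
  ultimately have "list_def (k + m) (\<lambda>xs. \<exists>t. P (xs @ [t]))" by (simp add: list_def_def)
  from Suc.IH[OF this]
  have "list_def k (\<lambda>xs. \<exists>ys. length ys = m \<and> (\<exists>t. P ((xs @ ys) @ [t])))" .
  moreover have "(\<exists>ys. length ys = m \<and> (\<exists>t. P ((xs @ ys) @ [t]))) \<longleftrightarrow>
      (\<exists>ys. length ys = Suc m \<and> P (xs @ ys))" for xs
  proof
    assume "\<exists>ys. length ys = Suc m \<and> P (xs @ ys)"
    then obtain ys where "length ys = Suc m" "P (xs @ ys)" by auto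
    then show "\<exists>ys. length ys = m \<and> (\<exists>t. P ((xs @ ys) @ [t]))"
      by (intro exI[of _ "butlast ys"] conjI exI[of _ "last ys"])
        (auto simp: append_butlast_last_id simp flip: length_0_conv)
  next
    assume "\<exists>ys. length ys = m \<and> (\<exists>t. P ((xs @ ys) @ [t]))"
    then obtain ys t where "length ys = m" "P ((xs @ ys) @ [t])" by auto
    then show "\<exists>ys. length ys = Suc m \<and> P (xs @ ys)"
      by (intro exI[of _ "ys @ [t]"]) auto
  qed
  ultimately show ?case by simp
qed

text \<open>The axioms offer cylinders, diagonals and projections, but no permutation of
  coordinates. A copy \<open>ys\<close> of the selected coordinates is appended, tied to the
  originals by diagonals, subjected to \<open>P\<close> and projected away. Variables can then be
  permuted, repeated and ignored.\<close>

lemma list_def_subst_var: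
  assumes "list_def m P" "length is = m" "\<And>i. i \<in> set is \<Longrightarrow> i < k"
  shows "list_def k (\<lambda>xs. P (map ((!) xs) is))"
proof -
  have "list_def (k + m) (\<lambda>w. P (drop k w) \<and> (\<forall>j<m. w ! (k + j) = w ! (is ! j)))"
    by (intro list_def_conj list_def_drop list_def_all_less list_def_eq assms(1))
      (use assms in \<open>auto simp: trans_less_add1\<close>)
  from list_def_ex_append[OF this]
  show ?thesis
  proof (rule iffD1[OF list_def_cong, rotated])
    fix xs :: "real list" assume xs: "length xs = k"
    have *: "(\<forall>j<m. (xs @ ys) ! (k + j) = (xs @ ys) ! (is ! j)) \<longleftrightarrow> ys = map ((!) xs) is"
      if "length ys = m" for ys
      using that xs assms by (auto simp: list_eq_iff_nth_eq nth_append)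
    show "(\<exists>ys. length ys = m \<and> P (drop k (xs @ ys)) \<and>
           (\<forall>j<m. (xs @ ys) ! (k + j) = (xs @ ys) ! (is ! j))) \<longleftrightarrow> P (map ((!) xs) is)"
    proof
      assume "P (map ((!) xs) is)"
      then show "\<exists>ys. length ys = m \<and> P (drop k (xs @ ys)) \<and>
           (\<forall>j<m. (xs @ ys) ! (k + j) = (xs @ ys) ! (is ! j))"
        using * xs assms(2) by (intro exI[of _ "map ((!) xs) is"]) auto
    next
      assume "\<exists>ys. length ys = m \<and> P (drop k (xs @ ys)) \<and>
           (\<forall>j<m. (xs @ ys) ! (k + j) = (xs @ ys) ! (is ! j))"
      then obtain ys where "length ys = m" "P (drop k (xs @ ys))"
        "\<forall>j<m. (xs @ ys) ! (k + j) = (xs @ ys) ! (is ! j)" by blast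
      then show "P (map ((!) xs) is)" using * xs by auto
    qed
  qed
qed

text \<open>\<open>list_fun\<close> puts the value right after the arguments; reindexing by
  \<open>[0..<k] @ [l]\<close> frees its position, which may even be that of an argument.\<close>

lemma list_fun_graph:
  assumes "list_fun k g" "k \<le> N" "l < N"
  shows "list_def N (\<lambda>w. w ! l = g (take k w))"
proof -
  let ?m = "\<lambda>w::real list. map ((!) w) ([0..<k] @ [l])"
  have "list_def N (\<lambda>w. ?m w ! k = g (take k (?m w)))"
    by (rule list_def_subst_var[OF assms(1)[unfolded list_fun_def]]) (use assms in auto)
  moreover have "w ! l = g (take k w) \<longleftrightarrow> ?m w ! k = g (take k (?m w))" if "length w = N" for w
  proof -
    have "map ((!) w) [0..<k] = take k w" using that assms by (auto simp: list_eq_iff_nth_eq)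
    then have m: "?m w = take k w @ [w ! l]" by simp
    have "length (take k w) = k" using that assms by simp
    then have "?m w ! k = w ! l" unfolding m by (metis nth_append_length)
    moreover have "take k (?m w) = take k w" unfolding m using that assms by simp
    ultimately show ?thesis by (simp only:)
  qed
  ultimately show ?thesis
    using list_def_cong[of N "\<lambda>w. w ! l = g (take k w)" "\<lambda>w. ?m w ! k = g (take k (?m w))"] by blast
qed

text \<open>The appended coordinates are now tied by graphs instead of diagonals, which gives
  composition with definable functions.\<close>

lemma list_def_subst:
  assumes "list_def m P" "length gs = m" "\<And>g. g \<in> set gs \<Longrightarrow> list_fun k g"
  shows "list_def k (\<lambda>xs. P (map (\<lambda>g. g xs) gs))"
proof -
  have "list_def (k + m) (\<lambda>w. P (drop k w) \<and> (\<forall>j<m. w ! (k + j) = (gs ! j) (take k w)))"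
    by (intro list_def_conj list_def_drop list_def_all_less list_fun_graph assms(1))
      (use assms in \<open>auto\<close>)
  from list_def_ex_append[OF this]
  show ?thesis
  proof (rule iffD1[OF list_def_cong, rotated])
    fix xs :: "real list" assume xs: "length xs = k"
    have *: "(\<forall>j<m. (xs @ ys) ! (k + j) = (gs ! j) (take k (xs @ ys))) \<longleftrightarrow> ys = map (\<lambda>g. g xs) gs"
      if "length ys = m" for ys
      using that xs assms by (auto simp: list_eq_iff_nth_eq nth_append)
    show "(\<exists>ys. length ys = m \<and> P (drop k (xs @ ys)) \<and>
           (\<forall>j<m. (xs @ ys) ! (k + j) = (gs ! j) (take k (xs @ ys)))) \<longleftrightarrow> P (map (\<lambda>g. g xs) gs)"
    proof
      assume "P (map (\<lambda>g. g xs) gs)"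
      then show "\<exists>ys. length ys = m \<and> P (drop k (xs @ ys)) \<and>
           (\<forall>j<m. (xs @ ys) ! (k + j) = (gs ! j) (take k (xs @ ys)))"
        using * xs assms(2) by (intro exI[of _ "map (\<lambda>g. g xs) gs"]) auto
    next
      assume "\<exists>ys. length ys = m \<and> P (drop k (xs @ ys)) \<and>
           (\<forall>j<m. (xs @ ys) ! (k + j) = (gs ! j) (take k (xs @ ys)))"
      then obtain ys where "length ys = m" "P (drop k (xs @ ys))"
        "\<forall>j<m. (xs @ ys) ! (k + j) = (gs ! j) (take k (xs @ ys))" by blast
      then show "P (map (\<lambda>g. g xs) gs)" using * xs by auto
    qed
  qed
qed

lemma list_fun_var: "i < k \<Longrightarrow> list_fun k (\<lambda>xs. xs ! i)"
  unfolding list_fun_def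
  by (rule iffD1[OF list_def_cong list_def_eq[of k _ i]]) auto

lemma S_1: "A \<in> S 1 \<longleftrightarrow> (\<exists>F. finite F \<and>
    (\<forall>I \<in> F. (open I \<and> is_interval I) \<or> (\<exists>a. I = {a})) \<and> A = (\<lambda>t. [t]) ` (\<Union>F))"
proof -
  have "S 1 = {(\<lambda>t. [t]) ` (\<Union>F) | F. finite F \<and>
              (\<forall>I \<in> F. (open I \<and> is_interval I) \<or> (\<exists>a. I = {a}))}"
    using o_minimal unfolding o_minimal_def by (elim conjE)
  then show ?thesis by (simp only: mem_Collect_eq) metis
qed

lemma list_def_singleton: "list_def 1 (\<lambda>xs. xs = [a])"
proof -
  have "{[a]} \<in> S 1" unfolding S_1 by (intro exI[of _ "{{a}}"]) auto
  moreover have "{xs \<in> tuples 1. xs = [a]} = {[a]}" by (auto simp: tuples_def)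
  ultimately show ?thesis by (simp add: list_def_def)
qed

lemma list_fun_const: "list_fun k (\<lambda>xs. a)"
  unfolding list_fun_def
  by (rule iffD1[OF list_def_cong list_def_subst_var[OF list_def_singleton[of a], of "[k]"]]) auto

lemma list_fun_weaken:
  assumes "list_fun k g" "k \<le> N"
  shows "list_fun N (\<lambda>xs. g (take k xs))"
proof -
  have "list_def (Suc N) (\<lambda>w. w ! N = g (take k w))"
    using assms by (intro list_fun_graph) auto
  then show ?thesis unfolding list_fun_def using assms(2) by (simp add: min_absorb1)
qed

text \<open>Meant for the axioms that supply \<open>+\<close> and \<open>*\<close> as ternary
  relations: it turns them into closure of \<open>list_fun\<close> under the operation.\<close>

lemma list_fun_ternary:
  assumes "list_def 3 P" "\<And>x y z. P [x, y, z] \<longleftrightarrow> z = u x y" "list_fun k g" "list_fun k h"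
  shows "list_fun k (\<lambda>xs. u (g xs) (h xs))"
  unfolding list_fun_def
proof (rule iffD1[OF list_def_cong])
  show "list_def (Suc k) (\<lambda>w. P (map (\<lambda>g. g w)
      [\<lambda>w. g (take k w), \<lambda>w. h (take k w), \<lambda>w. w ! k]))"
    by (rule list_def_subst[OF assms(1)]) (use assms in \<open>auto intro: list_fun_weaken list_fun_var\<close>)
qed (use assms in auto)

lemma list_fun_add:
  assumes "list_fun k g" "list_fun k h"
  shows "list_fun k (\<lambda>xs. g xs + h xs)"
proof (rule list_fun_ternary[where u = "(+)" and P = "\<lambda>xs. xs ! 2 = xs ! 0 + xs ! 1"])
  have "{xs \<in> tuples 3. xs ! 2 = xs ! 0 + xs ! 1} = {[x, y, x + y] | x y. True}"
    by (auto simp: tuples_def numeral_3_eq_3 numeral_2_eq_2 length_Suc_conv)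
  then show "list_def 3 (\<lambda>xs. xs ! 2 = xs ! 0 + xs ! 1)"
    using o_minimal by (simp add: list_def_def o_minimal_def)
qed (use assms in auto)

lemma list_def_mult: "list_def 3 (\<lambda>xs. xs ! 2 = xs ! 0 * xs ! 1)"
proof -
  have "{xs \<in> tuples 3. xs ! 2 = xs ! 0 * xs ! 1} = {[x, y, x * y] | x y. True}"
    by (auto simp: tuples_def numeral_3_eq_3 numeral_2_eq_2 length_Suc_conv)
  then show ?thesis
    using o_minimal by (simp add: list_def_def o_minimal_def)
qed

lemma list_fun_mult:
  assumes "list_fun k g" "list_fun k h"
  shows "list_fun k (\<lambda>xs. g xs * h xs)"
  by (rule list_fun_ternary[OF list_def_mult, where u = "(*)"]) (use assms in auto)

lemma list_fun_sum:
  "(\<And>i. i < (m::nat) \<Longrightarrow> list_fun k (g i)) \<Longrightarrow> list_fun k (\<lambda>xs. \<Sum>i<m. g i xs)"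
  by (induction m) (auto intro: list_fun_const list_fun_add)

end

(* The axioms of an o-minimal structure speak of lists of reals. Definability on a Euclidean space
   is transported along a linear chart and does not depend on the chart. *)

definition chart :: "('b::euclidean_space \<Rightarrow> real list) \<Rightarrow> bool" where
  "chart \<phi> \<longleftrightarrow> bij_betw \<phi> UNIV (tuples DIM('b)) \<and> (\<forall>i<DIM('b). linear (\<lambda>x. \<phi> x ! i))"

lemma chart_length: "chart (\<phi> :: 'b::euclidean_space \<Rightarrow> real list) \<Longrightarrow> length (\<phi> x) = DIM('b)"
  unfolding chart_def bij_betw_def tuples_def by auto

lemma chart_inj: "chart \<phi> \<Longrightarrow> inj \<phi>"
  unfolding chart_def bij_betw_def by auto

lemma chart_surj:
  "chart (\<phi> :: 'b::euclidean_space \<Rightarrow> real list) \<Longrightarrow> length xs = DIM('b) \<Longrightarrow> \<exists>x. \<phi> x = xs"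
  unfolding chart_def bij_betw_def tuples_def by (metis (mono_tags) image_iff mem_Collect_eq)

lemma chartI:
  fixes \<phi> :: "'b::euclidean_space \<Rightarrow> real list"
  assumes "inj \<phi>" "\<And>x. length (\<phi> x) = DIM('b)"
    "\<And>xs. length xs = DIM('b) \<Longrightarrow> \<exists>x. \<phi> x = xs"
    "\<And>i. i < DIM('b) \<Longrightarrow> linear (\<lambda>x. \<phi> x ! i)"
  shows "chart \<phi>"
  unfolding chart_def bij_betw_def tuples_def using assms by force

lemma ex_chart: "\<exists>\<phi> :: 'b::euclidean_space \<Rightarrow> real list. chart \<phi>"
proof -
  obtain bl :: "'b list" where bl: "distinct bl" "set bl = Basis"
    using finite_distinct_list[OF finite_Basis] by blast
  have len: "length bl = DIM('b)" using bl distinct_card by metis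
  have "chart (\<lambda>x. map ((\<bullet>) x) bl)"
  proof (rule chartI)
    show "inj (\<lambda>x. map ((\<bullet>) x) bl)"
    proof (rule injI)
      fix x y assume "map ((\<bullet>) x) bl = map ((\<bullet>) y) bl"
      then have "\<forall>b\<in>set bl. x \<bullet> b = y \<bullet> b" by simp
      then show "x = y" using bl by (simp add: euclidean_eq_iff[of x y])
    qed
    show "\<exists>x. map ((\<bullet>) x) bl = xs" if "length xs = DIM('b)" for xs
    proof -
      have "(\<Sum>i<length bl. xs ! i *\<^sub>R bl ! i) \<bullet> (bl ! j) = xs ! j" if "j < length bl" for j
      proof -
        have "(\<Sum>i<length bl. xs ! i *\<^sub>R bl ! i) \<bullet> (bl ! j)
            = (\<Sum>i<length bl. xs ! i * (bl ! i \<bullet> bl ! j))"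
          by (simp add: inner_sum_left)
        also have "\<dots> = (\<Sum>i<length bl. if i = j then xs ! i else 0)"
        proof (rule sum.cong)
          fix i assume i: "i \<in> {..<length bl}"
          then have "bl ! i \<in> Basis" "bl ! j \<in> Basis" using bl that by (metis lessThan_iff nth_mem)+
          moreover have "bl ! i = bl ! j \<longleftrightarrow> i = j" using bl i that by (simp add: nth_eq_iff_index_eq)
          ultimately show "xs ! i * (bl ! i \<bullet> bl ! j) = (if i = j then xs ! i else 0)"
            by (auto simp: inner_Basis)
        qed simp
        finally show ?thesis using that by simp
      qed
      then show ?thesis using that len
        by (intro exI[of _ "\<Sum>i<length bl. xs ! i *\<^sub>R bl ! i"]) (auto intro!: nth_equalityI)
    qed
    show "linear (\<lambda>x. map ((\<bullet>) x) bl ! i)" if "i < DIM('b)" for i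
      using that len by (auto intro!: linearI simp: inner_left_distrib)
  qed (simp add: len)
  then show ?thesis by blast
qed

text \<open>Tameness is stated in the coordinates of \<open>bs\<close>, which need not be
  orthonormal; that they form a chart carries it over to the chart-free notion of
  definability.\<close>

lemma chart_coords:
  fixes bs :: "'b::euclidean_space list"
  assumes "ordered_basis bs"
  shows "chart (coords bs)"
proof -
  have bs: "distinct bs" "independent (set bs)" "span (set bs) = UNIV"
    using assms by (auto simp: ordered_basis_def)
  have len: "length bs = DIM('b)"
    using bs by (metis distinct_card dim_eq_card dim_UNIV span_UNIV)
  show ?thesis
  proof (rule chartI)
    show "inj (coords bs)"
    proof (rule injI)
      fix x y assume "coords bs x = coords bs y"
      then have "\<forall>b\<in>set bs. representation (set bs) x b = representation (set bs) y b"
        by (simp add: coords_def)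
      moreover have "(\<Sum>b\<in>set bs. representation (set bs) z b *\<^sub>R b) = z" for z
        using bs by (intro real_vector.sum_representation_eq) auto
      ultimately show "x = y" by (metis (no_types, lifting) sum.cong)
    qed
    show "\<exists>x. coords bs x = xs" if xs: "length xs = DIM('b)" for xs
    proof -
      define c where "c b = (if b \<in> set bs then xs ! (THE i. i < length bs \<and> bs ! i = b) else 0)" for b
      have c: "c (bs ! i) = xs ! i" if "i < length bs" for i
      proof -
        have "(THE j. j < length bs \<and> bs ! j = bs ! i) = i"
          using that bs(1) by (auto simp: nth_eq_iff_index_eq)
        then show ?thesis using that by (simp add: c_def)
      qed
      have "representation (set bs) (\<Sum>b\<in>set bs. c b *\<^sub>R b) = c"
      proof (rule real_vector.representation_eqI[OF bs(2)])
        show "(\<Sum>b | c b \<noteq> 0. c b *\<^sub>R b) = (\<Sum>b\<in>set bs. c b *\<^sub>R b)"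
          by (rule sum.mono_neutral_left) (auto simp: c_def)
        have "{b. c b \<noteq> 0} \<subseteq> set bs" by (auto simp: c_def)
        then show "finite {b. c b \<noteq> 0}" by (rule finite_subset) simp
      qed (auto simp: bs c_def split: if_splits)
      then show ?thesis using c xs len
        by (intro exI[of _ "\<Sum>b\<in>set bs. c b *\<^sub>R b"]) (auto simp: coords_def intro!: nth_equalityI)
    qed
    show "linear (\<lambda>x. coords bs x ! i)" if "i < DIM('b)" for i
      using that len bs
      by (auto intro!: linearI simp: coords_def real_vector.representation_add real_vector.representation_scale)
  qed (simp add: coords_def len)
qed

lemma chart_Pair:
  fixes \<phi> :: "'b::euclidean_space \<Rightarrow> real list" and \<psi> :: "'c::euclidean_space \<Rightarrow> real list"
  assumes "chart \<phi>" "chart \<psi>"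
  shows "chart (\<lambda>(x, y). \<phi> x @ \<psi> y)"
proof (rule chartI)
  note len = chart_length[OF assms(1)] chart_length[OF assms(2)]
  show "inj (\<lambda>(x, y). \<phi> x @ \<psi> y)"
    using assms[THEN chart_inj] len by (auto simp: inj_def)
  show "\<exists>x. (case x of (x, y) \<Rightarrow> \<phi> x @ \<psi> y) = xs" if "length xs = DIM('b \<times> 'c)" for xs
  proof -
    have "length (take DIM('b) xs) = DIM('b)" "length (drop DIM('b) xs) = DIM('c)"
      using that by simp_all
    then obtain x y where "\<phi> x = take DIM('b) xs" "\<psi> y = drop DIM('b) xs"
      using chart_surj[OF assms(1)] chart_surj[OF assms(2)] by metis
    then show ?thesis by (intro exI[of _ "(x, y)"]) simp
  qed
  show "linear (\<lambda>x. (case x of (x, y) \<Rightarrow> \<phi> x @ \<psi> y) ! i)" if "i < DIM('b \<times> 'c)" for i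
  proof (cases "i < DIM('b)")
    case True
    then have "(\<lambda>x. (case x of (x, y) \<Rightarrow> \<phi> x @ \<psi> y) ! i) = (\<lambda>x. \<phi> x ! i) \<circ> fst"
      using len by (auto simp: nth_append)
    moreover have "linear (\<lambda>x. \<phi> x ! i)" using assms(1) True by (simp add: chart_def)
    ultimately show ?thesis using linear_compose[OF linear_fst] by metis
  next
    case False
    then have "(\<lambda>x. (case x of (x, y) \<Rightarrow> \<phi> x @ \<psi> y) ! i) = (\<lambda>x. \<psi> x ! (i - DIM('b))) \<circ> snd"
      using len by (auto simp: nth_append)
    moreover have "linear (\<lambda>x. \<psi> x ! (i - DIM('b)))" using assms(2) False that by (simp add: chart_def)
    ultimately show ?thesis using linear_compose[OF linear_snd] by metis
  qed
qed (auto simp: chart_length[OF assms(1)] chart_length[OF assms(2)])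

lemma chart_real: "chart (\<lambda>t::real. [t])"
  by (rule chartI) (auto simp: inj_def length_Suc_conv intro!: linearI)

section \<open>Definable predicates and functions on Euclidean spaces\<close>

context o_min
begin

text \<open>Quantifying over all charts makes the notion free of choices;
  \<open>chart_vimage\<close> with the identity map shows that one chart is enough.\<close>

definition definable :: "('b::euclidean_space \<Rightarrow> bool) \<Rightarrow> bool" where
  "definable P \<longleftrightarrow> (\<forall>\<phi>. chart \<phi> \<longrightarrow> \<phi> ` {x. P x} \<in> S DIM('b))"

definition definable_fun :: "('b::euclidean_space \<Rightarrow> 'c::euclidean_space) \<Rightarrow> bool" where
  "definable_fun g \<longleftrightarrow> definable (\<lambda>z. snd z = g (fst z))"

lemma list_def_congI:
  "list_def k P \<Longrightarrow> (\<And>xs. length xs = k \<Longrightarrow> P xs \<longleftrightarrow> Q xs) \<Longrightarrow> list_def k Q"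
  using list_def_cong by blast

lemma chart_image_eq:
  fixes \<phi> :: "'b::euclidean_space \<Rightarrow> real list"
  assumes "chart \<phi>"
  shows "\<phi> ` {x. P x} \<in> S DIM('b) \<longleftrightarrow> list_def DIM('b) (\<lambda>xs. P (inv \<phi> xs))"
proof -
  have "\<phi> ` {x. P x} = {xs \<in> tuples DIM('b). P (inv \<phi> xs)}"
    using chart_inj[OF assms] chart_length[OF assms] chart_surj[OF assms]
    by (auto simp: tuples_def image_iff) (metis inv_f_f)
  then show ?thesis by (simp add: list_def_def)
qed

text \<open>In coordinates a linear map is a matrix, and \<open>list_def_subst\<close> accepts sums
  of coordinates times constants. Besides linear preimages, this yields independence of the chart
  when \<open>L\<close> is the identity.\<close>

lemma chart_vimage:
  fixes \<phi> :: "'b::euclidean_space \<Rightarrow> real list" and \<psi> :: "'c::euclidean_space \<Rightarrow> real list"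
  assumes \<phi>: "chart \<phi>" and \<psi>: "chart \<psi>" and L: "linear L" and P: "\<psi> ` {x. P x} \<in> S DIM('c)"
  shows "\<phi> ` {x. P (L x)} \<in> S DIM('b)"
proof -
  define n where "n = DIM('b)"
  define m where "m = DIM('c)"
  \<comment> \<open>\<open>e i\<close> has the i-th unit tuple as coordinates; its images under
    \<open>L\<close> are the columns of the matrix.\<close>
  define e where "e i = inv \<phi> ((replicate n 0)[i := 1])" for i
  have e: "\<phi> (e i) = (replicate n 0)[i := 1]" for i
    unfolding e_def by (metis \<phi> chart_surj f_inv_into_f length_list_update length_replicate n_def rangeI)
  have inv: "inv \<phi> xs = (\<Sum>i<n. xs ! i *\<^sub>R e i)" if xs: "length xs = n" for xs
  proof -
    have "\<phi> (\<Sum>i<n. xs ! i *\<^sub>R e i) = xs"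
    proof (rule nth_equalityI)
      show "length (\<phi> (\<Sum>i<n. xs ! i *\<^sub>R e i)) = length xs"
        using chart_length[OF \<phi>] xs n_def by simp
      fix j assume "j < length (\<phi> (\<Sum>i<n. xs ! i *\<^sub>R e i))"
      then have j: "j < n" using chart_length[OF \<phi>] n_def by simp
      then have lin: "linear (\<lambda>x. \<phi> x ! j)" using \<phi> by (simp add: chart_def n_def)
      have "\<phi> (\<Sum>i<n. xs ! i *\<^sub>R e i) ! j = (\<Sum>i<n. xs ! i * (\<phi> (e i) ! j))"
        by (simp add: linear_sum[OF lin] linear_cmul[OF lin])
      also have "\<dots> = (\<Sum>i<n. if i = j then xs ! i else 0)"
        by (rule sum.cong) (use j in \<open>auto simp: e nth_list_update\<close>)
      finally show "\<phi> (\<Sum>i<n. xs ! i *\<^sub>R e i) ! j = xs ! j" using j by simp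
    qed
    then show ?thesis using chart_inj[OF \<phi>] by (metis inv_f_f)
  qed
  have "list_def m (\<lambda>ys. P (inv \<psi> ys))" using P chart_image_eq[OF \<psi>] m_def by blast
  then have "list_def n (\<lambda>xs. P (inv \<psi> (map (\<lambda>g. g xs)
      (map (\<lambda>j xs. \<Sum>i<n. xs ! i * (\<psi> (L (e i)) ! j)) [0..<m]))))"
    by (rule list_def_subst) (auto intro!: list_fun_sum list_fun_mult list_fun_var list_fun_const)
  moreover have "map (\<lambda>g. g xs) (map (\<lambda>j xs. \<Sum>i<n. xs ! i * (\<psi> (L (e i)) ! j)) [0..<m])
      = \<psi> (L (inv \<phi> xs))" if xs: "length xs = n" for xs
  proof (rule nth_equalityI)
    fix j assume "j < length (map (\<lambda>g. g xs) (map (\<lambda>j xs. \<Sum>i<n. xs ! i * (\<psi> (L (e i)) ! j)) [0..<m]))"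
    then have j: "j < m" by simp
    then have lin: "linear (\<lambda>x. \<psi> x ! j)" using \<psi> by (simp add: chart_def m_def)
    show "map (\<lambda>g. g xs) (map (\<lambda>j xs. \<Sum>i<n. xs ! i * (\<psi> (L (e i)) ! j)) [0..<m]) ! j
        = \<psi> (L (inv \<phi> xs)) ! j"
      using j by (simp add: inv[OF xs] linear_sum[OF lin] linear_cmul[OF lin] linear_sum[OF L] linear_cmul[OF L])
  qed (simp add: chart_length[OF \<psi>] m_def)
  ultimately have "list_def n (\<lambda>xs. P (L (inv \<phi> xs)))"
    using chart_inj[OF \<psi>] by (subst list_def_cong) (auto simp: inv_f_f)
  then show ?thesis using chart_image_eq[OF \<phi>] n_def by blast
qed

lemma definable_linear:
  assumes "definable P" "linear L"
  shows "definable (\<lambda>x. P (L x))"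
  unfolding definable_def using chart_vimage assms ex_chart unfolding definable_def by blast

lemma definableI_chart:
  fixes \<phi> :: "'b::euclidean_space \<Rightarrow> real list"
  assumes "chart \<phi>" "\<phi> ` {x. P x} \<in> S DIM('b)"
  shows "definable P"
  unfolding definable_def using chart_vimage[OF _ assms(1) linear_id assms(2)] by simp

lemma definableI:
  fixes \<phi> :: "'b::euclidean_space \<Rightarrow> real list"
  assumes "chart \<phi>" "list_def DIM('b) (\<lambda>xs. P (inv \<phi> xs))"
  shows "definable P"
  using definableI_chart chart_image_eq assms by blast

lemma definableD:
  fixes \<phi> :: "'b::euclidean_space \<Rightarrow> real list"
  shows "definable P \<Longrightarrow> chart \<phi> \<Longrightarrow> list_def DIM('b) (\<lambda>xs. P (inv \<phi> xs))"
  using chart_image_eq unfolding definable_def by blast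

lemma definable_conj:
  fixes P Q :: "'b::euclidean_space \<Rightarrow> bool"
  assumes "definable P" "definable Q"
  shows "definable (\<lambda>x. P x \<and> Q x)"
proof -
  obtain \<phi> :: "'b \<Rightarrow> real list" where \<phi>: "chart \<phi>" using ex_chart by blast
  show ?thesis 
    by (rule definableI[OF \<phi> list_def_conj[OF definableD[OF assms(1) \<phi>] definableD[OF assms(2) \<phi>]]])
qed

lemma definable_not:
  fixes P :: "'b::euclidean_space \<Rightarrow> bool"
  assumes "definable P"
  shows "definable (\<lambda>x. \<not> P x)"
proof -
  obtain \<phi> :: "'b \<Rightarrow> real list" where \<phi>: "chart \<phi>" using ex_chart by blast
  show ?thesis by (rule definableI[OF \<phi> list_def_not[OF definableD[OF assms \<phi>]]])
qed

lemma definable_disj: "definable P \<Longrightarrow> definable Q \<Longrightarrow> definable (\<lambda>x. P x \<or> Q x)"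
  using definable_not[OF definable_conj[OF definable_not definable_not]] by simp

lemma definable_imp: "definable P \<Longrightarrow> definable Q \<Longrightarrow> definable (\<lambda>x. P x \<longrightarrow> Q x)"
  unfolding imp_conv_disj by (rule definable_disj[OF definable_not])

lemma definable_const: "definable (\<lambda>x::'b::euclidean_space. b)"
proof -
  obtain \<phi> :: "'b \<Rightarrow> real list" where \<phi>: "chart \<phi>" using ex_chart by blast
  have "definable (\<lambda>x::'b. True)" by (rule definableI[OF \<phi> list_def_True])
  then show ?thesis using definable_not[OF \<open>definable (\<lambda>x::'b. True)\<close>] by (cases b) simp_all
qed

text \<open>The concatenated chart of a product lists the coordinates of \<open>y\<close> last, and
  these are the ones that projection removes.\<close>

lemma definable_ex:
  fixes P :: "'b::euclidean_space \<Rightarrow> 'c::euclidean_space \<Rightarrow> bool"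
  assumes "definable (\<lambda>z. P (fst z) (snd z))"
  shows "definable (\<lambda>x. \<exists>y. P x y)"
proof -
  obtain \<phi> :: "'b \<Rightarrow> real list" where \<phi>: "chart \<phi>" using ex_chart by blast
  obtain \<psi> :: "'c \<Rightarrow> real list" where \<psi>: "chart \<psi>" using ex_chart by blast
  let ?c = "\<lambda>(x, y). \<phi> x @ \<psi> y"
  have c: "chart ?c" by (rule chart_Pair[OF \<phi> \<psi>])
  have "list_def (DIM('b) + DIM('c)) (\<lambda>w. P (fst (inv ?c w)) (snd (inv ?c w)))"
    using definableD[OF assms c] by simp
  from list_def_ex_append[OF this]
  have "list_def DIM('b) (\<lambda>xs. \<exists>ys. length ys = DIM('c) \<and>
      P (fst (inv ?c (xs @ ys))) (snd (inv ?c (xs @ ys))))" .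
  moreover have "(\<exists>ys. length ys = DIM('c) \<and>
      P (fst (inv ?c (xs @ ys))) (snd (inv ?c (xs @ ys)))) \<longleftrightarrow> (\<exists>y. P (inv \<phi> xs) y)"
    if xs: "length xs = DIM('b)" for xs
  proof -
    have "inv ?c (xs @ \<psi> y) = (inv \<phi> xs, y)" for y
    proof -
      have "\<phi> (inv \<phi> xs) = xs" using chart_surj[OF \<phi> xs] by (metis f_inv_into_f rangeI)
      then have "?c (inv \<phi> xs, y) = xs @ \<psi> y" by simp
      then show ?thesis using inv_f_f[OF chart_inj[OF c], of "(inv \<phi> xs, y)"] by simp
    qed
    then show ?thesis using chart_surj[OF \<psi>] chart_length[OF \<psi>] by (metis fst_conv snd_conv)
  qed
  ultimately have "list_def DIM('b) (\<lambda>xs. \<exists>y. P (inv \<phi> xs) y)"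
    using list_def_cong[of "DIM('b)" "\<lambda>xs. \<exists>ys. length ys = DIM('c) \<and>
      P (fst (inv ?c (xs @ ys))) (snd (inv ?c (xs @ ys)))" "\<lambda>xs. \<exists>y. P (inv \<phi> xs) y"] by blast
  then show ?thesis by (rule definableI[OF \<phi>])
qed

lemma definable_all:
  assumes "definable (\<lambda>z. P (fst z) (snd z))"
  shows "definable (\<lambda>x. \<forall>y. P x y)"
proof -
  have "definable (\<lambda>x. \<not> (\<exists>y. \<not> P x y))"
    by (intro definable_not definable_ex assms)
  then show ?thesis by simp
qed

lemma definable_ball_finite:
  assumes "finite B" "\<And>b. b \<in> B \<Longrightarrow> definable (P b)"
  shows "definable (\<lambda>x. \<forall>b\<in>B. P b x)"
  using assms
proof (induction B rule: finite_induct)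
  case (insert b B)
  then show ?case by (simp add: definable_conj)
qed (simp add: definable_const)

lemma definable_singleton: "definable (\<lambda>x. x = a)"
proof -
  obtain \<phi> :: "'a \<Rightarrow> real list" where \<phi>: "chart \<phi>" using ex_chart by blast
  have "list_def DIM('a) (\<lambda>xs. \<forall>j<DIM('a). (map (\<lambda>g. g xs) [\<lambda>xs. xs ! j]) = [\<phi> a ! j])"
    by (intro list_def_all_less list_def_subst[OF list_def_singleton]) (auto intro: list_fun_var)
  moreover have "(\<forall>j<DIM('a). (map (\<lambda>g. g xs) [\<lambda>xs. xs ! j]) = [\<phi> a ! j]) \<longleftrightarrow> inv \<phi> xs = a"
    if "length xs = DIM('a)" for xs
  proof -
    have "inv \<phi> xs = a \<longleftrightarrow> xs = \<phi> a"
      using chart_surj[OF \<phi> that] chart_inj[OF \<phi>] by (metis inv_f_f)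
    then show ?thesis using that chart_length[OF \<phi>] by (auto simp: list_eq_iff_nth_eq)
  qed
  ultimately have "list_def DIM('a) (\<lambda>xs. inv \<phi> xs = a)"
    by (rule list_def_congI)
  then show ?thesis by (rule definableI[OF \<phi>])
qed

lemma definable_fun_linear:
  assumes "linear L"
  shows "definable_fun L"
proof -
  have "linear (\<lambda>z. snd z - L (fst z))"
    by (auto intro!: linearI simp: linear_add[OF assms] linear_cmul[OF assms] scaleR_diff_right)
  from definable_linear[OF definable_singleton[of 0] this]
  show ?thesis unfolding definable_fun_def by simp
qed

lemma definable_fun_const: "definable_fun (\<lambda>x. c)"
  unfolding definable_fun_def
  by (rule definable_linear[OF definable_singleton]) (rule linear_snd)

lemma definable_subst:
  assumes P: "definable P" and g: "definable_fun g"
  shows "definable (\<lambda>x. P (g x))"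
proof -
  have "definable (\<lambda>x. \<exists>y. y = g x \<and> P y)"
    by (intro definable_ex definable_conj g[unfolded definable_fun_def]
        definable_linear[OF P] linear_snd)
  then show ?thesis by simp
qed

lemma definable_fun_comp:
  assumes g: "definable_fun g" and h: "definable_fun h"
  shows "definable_fun (\<lambda>x. g (h x))"
proof -
  have lin2: "linear (\<lambda>w. (snd w, snd (fst w)))" by (auto intro!: linearI)
  have lin1: "linear (\<lambda>w. (fst (fst w), snd w))" by (auto intro!: linearI)
  have "definable (\<lambda>w. snd w = h (fst (fst w)))"
    using definable_linear[OF h[unfolded definable_fun_def] lin1] by simp
  moreover have "definable (\<lambda>w. snd (fst w) = g (snd w))"
    using definable_linear[OF g[unfolded definable_fun_def] lin2] by simp
  ultimately have "definable (\<lambda>z. \<exists>y. y = h (fst z) \<and> snd z = g y)"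
    by (intro definable_ex definable_conj)
  then show ?thesis unfolding definable_fun_def by simp
qed

lemma definable_fun_Pair:
  assumes g: "definable_fun g" and h: "definable_fun h"
  shows "definable_fun (\<lambda>x. (g x, h x))"
proof -
  have lin4: "linear (\<lambda>w. (fst w, snd (snd w)))" by (auto intro!: linearI)
  have lin3: "linear (\<lambda>w. (fst w, fst (snd w)))" by (auto intro!: linearI)
  have "definable (\<lambda>w. fst (snd w) = g (fst w))"
    using definable_linear[OF g[unfolded definable_fun_def] lin3] by simp
  moreover have "definable (\<lambda>w. snd (snd w) = h (fst w))"
    using definable_linear[OF h[unfolded definable_fun_def] lin4] by simp
  ultimately have "definable (\<lambda>w. fst (snd w) = g (fst w) \<and> snd (snd w) = h (fst w))"
    by (rule definable_conj)
  then show ?thesis unfolding definable_fun_def by (simp add: prod_eq_iff)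
qed

lemma definable_fun_id: "definable_fun (\<lambda>x. x)"
  by (rule definable_fun_linear) (rule linear_ident)

lemma definable_fun_lin: "linear L \<Longrightarrow> definable_fun h \<Longrightarrow> definable_fun (\<lambda>x. L (h x))"
  by (rule definable_fun_comp[OF definable_fun_linear])

lemma definable_fun_fst: "definable_fun h \<Longrightarrow> definable_fun (\<lambda>x. fst (h x))"
  by (rule definable_fun_lin[OF linear_fst])

lemma definable_fun_snd: "definable_fun h \<Longrightarrow> definable_fun (\<lambda>x. snd (h x))"
  by (rule definable_fun_lin[OF linear_snd])

lemma definable_fun_minus: "definable_fun h \<Longrightarrow> definable_fun (\<lambda>x. - h x)"
  by (rule definable_fun_lin[of uminus]) (auto intro: linearI)

lemma definable_fun_add:
  fixes g h :: "'b::euclidean_space \<Rightarrow> 'c::euclidean_space"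
  assumes "definable_fun g" "definable_fun h"
  shows "definable_fun (\<lambda>x. g x + h x)"
proof -
  have "linear (\<lambda>z::'c \<times> 'c. fst z + snd z)" by (auto intro!: linearI simp: scaleR_add_right)
  from definable_fun_lin[OF this definable_fun_Pair[OF assms]] show ?thesis by simp
qed

lemma definable_fun_diff:
  assumes "definable_fun g" "definable_fun h"
  shows "definable_fun (\<lambda>x. g x - h x)"
  using definable_fun_add[OF assms(1) definable_fun_minus[OF assms(2)]] by simp

lemma definable_fun_mult:
  fixes g h :: "'b::euclidean_space \<Rightarrow> real"
  assumes g: "definable_fun g" and h: "definable_fun h"
  shows "definable_fun (\<lambda>x. g x * h x)"
proof -
  \<comment> \<open>In this chart of three nested real factors the relation becomes literally the
    set named in the axiom for multiplication.\<close>
  let ?c = "\<lambda>(x::real, y). (\<lambda>t. [t]) x @ (\<lambda>(x::real, y::real). (\<lambda>t. [t]) x @ (\<lambda>t. [t]) y) y"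
  have c: "chart ?c" by (intro chart_Pair chart_real)
  have "?c ` {z. snd (snd z) = fst z * fst (snd z)} = {[x, y, x * y] | x y. True}"
    by (force simp: image_iff)
  then have "definable (\<lambda>z::real \<times> real \<times> real. snd (snd z) = fst z * fst (snd z))"
    using o_minimal by (intro definableI_chart[OF c])
      (simp add: o_minimal_def eval_nat_numeral)
  from definable_subst[OF this, of "\<lambda>z. (g (fst z), h (fst z), snd z)"]
  have "definable_fun (\<lambda>z::'b \<times> real. (g (fst z), h (fst z), snd z)) \<Longrightarrow>
      definable (\<lambda>z. snd z = g (fst z) * h (fst z))" by simp
  then show ?thesis unfolding definable_fun_def[of "\<lambda>x. g x * h x"]
    by (simp add: definable_fun_Pair definable_fun_comp[OF g] definable_fun_comp[OF h]
        definable_fun_fst definable_fun_snd definable_fun_id)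
qed

lemma definable_fun_power: "definable_fun (g :: _ \<Rightarrow> real) \<Longrightarrow> definable_fun (\<lambda>x. g x ^ n)"
  by (induction n) (auto intro: definable_fun_const definable_fun_mult)

lemma definable_eq:
  assumes "definable_fun g" "definable_fun h"
  shows "definable (\<lambda>x. g x = h x)"
  using definable_subst[OF definable_singleton[of 0] definable_fun_diff[OF assms]] by simp

lemma definable_less:
  fixes g h :: "'b::euclidean_space \<Rightarrow> real"
  assumes "definable_fun g" "definable_fun h"
  shows "definable (\<lambda>x. g x < h x)"
proof -
  have "(\<lambda>t. [t]) ` {t::real. 0 < t} \<in> S 1"
    unfolding S_1 by (intro exI[of _ "{{0<..}}"]) (auto simp: is_interval_convex_1 greaterThan_def[symmetric])
  then have "definable (\<lambda>t::real. 0 < t)"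
    by (intro definableI_chart[OF chart_real]) simp
  from definable_subst[OF this definable_fun_diff[OF assms(2,1)]] show ?thesis by simp
qed

lemma definable_le:
  fixes g h :: "'b::euclidean_space \<Rightarrow> real"
  assumes "definable_fun g" "definable_fun h"
  shows "definable (\<lambda>x. g x \<le> h x)"
  using definable_not[OF definable_less[OF assms(2,1)]] by (simp add: not_less)

lemma definable_fun_componentwise:
  assumes "\<And>b. b \<in> Basis \<Longrightarrow> definable_fun (\<lambda>x. g x \<bullet> b)"
  shows "definable_fun g"
proof -
  have "definable (\<lambda>z. \<forall>b\<in>Basis. snd z \<bullet> b = g (fst z) \<bullet> b)"
    by (intro definable_ball_finite definable_eq definable_fun_comp[OF assms]
        definable_fun_lin[of "\<lambda>x. x \<bullet> _"] definable_fun_fst definable_fun_snd definable_fun_id)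
      (auto intro!: linearI simp: inner_left_distrib)
  then show ?thesis unfolding definable_fun_def by (simp add: euclidean_eq_iff[symmetric])
qed

lemma definable_fun_inner_const: "definable_fun h \<Longrightarrow> definable_fun (\<lambda>x. h x \<bullet> b)"
  by (rule definable_fun_lin[of "\<lambda>x. x \<bullet> b"]) (auto intro!: linearI simp: inner_left_distrib)

lemma definable_fun_scaleR:
  assumes "definable_fun g" "definable_fun h"
  shows "definable_fun (\<lambda>x. g x *\<^sub>R h x)"
  by (rule definable_fun_componentwise)
    (auto intro!: definable_fun_mult definable_fun_inner_const assms)

lemma definable_fun_sum:
  "(\<And>b. b \<in> B \<Longrightarrow> definable_fun (g b)) \<Longrightarrow> definable_fun (\<lambda>x. \<Sum>b\<in>B. g b x)"
  by (induction B rule: infinite_finite_induct) (auto intro: definable_fun_const definable_fun_add)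

lemma definable_fun_inner:
  assumes "definable_fun g" "definable_fun h"
  shows "definable_fun (\<lambda>x. g x \<bullet> h x)"
  unfolding euclidean_inner[of "g _" "h _"]
  by (intro definable_fun_sum definable_fun_mult definable_fun_inner_const assms)

lemma definable_fun_norm:
  assumes "definable_fun g"
  shows "definable_fun (\<lambda>x. norm (g x))"
proof -
  have "definable (\<lambda>z. 0 \<le> snd z \<and> snd z ^ 2 = g (fst z) \<bullet> g (fst z))"
    by (intro definable_conj definable_le definable_eq definable_fun_power definable_fun_inner
        definable_fun_comp[OF assms] definable_fun_const definable_fun_fst definable_fun_snd definable_fun_id)
  moreover have "(0 \<le> t \<and> t ^ 2 = x \<bullet> x) \<longleftrightarrow> t = norm x" for t and x :: 'b
    by (auto simp: power2_norm_eq_inner[symmetric])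
  ultimately show ?thesis unfolding definable_fun_def by simp
qed

text \<open>Read backwards, these rules decompose a first-order formula, so its shape alone decides
  a definability goal. Absolute values and quotients are not covered and are rewritten
  beforehand.\<close>

lemmas definable_intros = definable_conj definable_disj definable_not definable_imp definable_const
  definable_ex definable_all definable_less definable_le definable_eq
  definable_fun_id definable_fun_const definable_fun_fst definable_fun_snd definable_fun_Pair
  definable_fun_add definable_fun_diff definable_fun_minus definable_fun_mult definable_fun_power
  definable_fun_scaleR definable_fun_inner definable_fun_norm

end

subsection \<open>One-variable definable functions and definable choice\<close>

text \<open>The points where \<phi> is at least \<open>\<phi> a\<close> form a compact set, and by
  \<open>step\<close> its maximum can only be \<open>b\<close>. This integrates a one-sided local
  growth condition without derivatives.\<close>

lemma creeping:
  fixes \<phi> :: "real \<Rightarrow> real"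
  assumes "a \<le> b" and cont: "continuous_on {a..b} \<phi>"
    and step: "\<And>t. a \<le> t \<Longrightarrow> t < b \<Longrightarrow> \<exists>t'. t < t' \<and> t' \<le> b \<and> \<phi> t \<le> \<phi> t'"
  shows "\<phi> a \<le> \<phi> b"
proof -
  let ?K = "{t \<in> {a..b}. \<phi> a \<le> \<phi> t}"
  have "closed ?K"
    using cont by (intro continuous_closed_preimage_constant continuous_on_closed_Collect_le continuous_on_const) auto
  then have "compact ?K" by (metis (no_types, lifting) bounded_closed_interval bounded_subset
      compact_eq_bounded_closed mem_Collect_eq subsetI)
  moreover have "a \<in> ?K" using \<open>a \<le> b\<close> by simp
  ultimately obtain m where m: "m \<in> ?K" "\<forall>t\<in>?K. t \<le> m"
    using compact_attains_sup[of ?K] by blast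
  have "m = b"
  proof (rule ccontr)
    assume "m \<noteq> b"
    then obtain t' where "m < t'" "t' \<le> b" "\<phi> m \<le> \<phi> t'" using step[of m] m by auto
    then have "t' \<in> ?K" using m by auto
    then show False using m \<open>m < t'\<close> by auto
  qed
  then show ?thesis using m by simp
qed

lemma eventually_at_right_notin_finite:
  fixes p :: real
  assumes "finite F"
  shows "\<forall>\<^sub>F x in at_right p. x \<notin> F"
proof -
  have "\<forall>\<^sub>F x in at p. x \<notin> F"
    using islimpt_finite[OF assms] islimpt_iff_eventually by blast
  then show ?thesis by (simp add: eventually_at_split)
qed

text \<open>Only upward jumps are recorded; downward ones are upward jumps of
  \<open>- \<phi>\<close>.\<close>

definition right_jumps :: "(real \<Rightarrow> real) \<Rightarrow> real set" where
  "right_jumps \<phi> = {p. \<exists>q. \<phi> p < q \<and> (\<forall>\<^sub>F x in at_right p. q < \<phi> x)}"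

text \<open>Two rationals identify a jump: \<open>q\<close> separates the value at \<open>p\<close>
  from the values after it, and \<open>q'\<close> bounds the interval where this holds. If two
  points shared the same pair, the value at the later one would be above \<open>q\<close> because of
  the earlier and below \<open>q\<close> by its own condition.\<close>

lemma countable_right_jumps: "countable (right_jumps \<phi>)"
proof -
  define A where "A q q' = {p. \<phi> p < q \<and> p < q' \<and> (\<forall>x. p < x \<and> x < q' \<longrightarrow> q < \<phi> x)}" for q q'
  have "countable (A q q')" for q q'
  proof (rule countable_subset)
    show "A q q' \<subseteq> {THE p. p \<in> A q q'}"
    proof
      fix p assume p: "p \<in> A q q'"
      have "p' = p" if p': "p' \<in> A q q'" for p'
        by (rule linorder_cases[of p p']) (use p p' in \<open>fastforce simp: A_def\<close>)+
      then show "p \<in> {THE p. p \<in> A q q'}" using p by (metis singleton_iff the_equality)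
    qed
  qed simp
  then have "countable (\<Union>q\<in>\<rat>. \<Union>q'\<in>\<rat>. A q q')"
    by (intro countable_UN countable_rat) auto
  moreover have "right_jumps \<phi> \<subseteq> (\<Union>q\<in>\<rat>. \<Union>q'\<in>\<rat>. A q q')"
  proof
    fix p assume "p \<in> right_jumps \<phi>"
    then obtain r c where r: "\<phi> p < r" "p < c" "\<And>x. p < x \<Longrightarrow> x < c \<Longrightarrow> r < \<phi> x"
      unfolding right_jumps_def eventually_at_right_field by blast
    obtain q where q: "q \<in> \<rat>" "\<phi> p < q" "q < r" using Rats_dense_in_real[OF r(1)] by blast
    obtain q' where q': "q' \<in> \<rat>" "p < q'" "q' < c" using Rats_dense_in_real[OF r(2)] by blast
    have "p \<in> A q q'" unfolding A_def using q q' r(3) by force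
    then show "p \<in> (\<Union>q\<in>\<rat>. \<Union>q'\<in>\<rat>. A q q')" using q q' by blast
  qed
  ultimately show ?thesis by (rule countable_subset[rotated])
qed

context o_min
begin

lemma definable_subst2:
  assumes "definable (\<lambda>z. R (fst z) (snd z))" "definable_fun g" "definable_fun h"
  shows "definable (\<lambda>x. R (g x) (h x))"
  using definable_subst[OF assms(1) definable_fun_Pair[OF assms(2,3)]] by simp

text \<open>Here the axiom that \<open>S 1\<close> contains nothing but finite unions is used,
  carried over from one-element lists to reals.\<close>

lemma definable_real_union:
  fixes P :: "real \<Rightarrow> bool"
  assumes "definable P"
  obtains F where "finite F" "\<And>I. I \<in> F \<Longrightarrow> is_interval I" "\<And>I. I \<in> F \<Longrightarrow> open I \<or> (\<exists>a. I = {a})"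
    "{t. P t} = \<Union>F"
proof -
  have "(\<lambda>t. [t]) ` {t. P t} \<in> S 1"
    using assms chart_real unfolding definable_def by fastforce
  then obtain F where F: "finite F" "\<forall>I \<in> F. (open I \<and> is_interval I) \<or> (\<exists>a. I = {a})"
    "(\<lambda>t. [t]) ` {t. P t} = (\<lambda>t. [t]) ` (\<Union>F)"
    unfolding S_1 by blast
  have "inj (\<lambda>t::real. [t])" by (simp add: inj_def)
  then have "{t. P t} = \<Union>F" using F(3) inj_image_eq_iff by blast
  moreover have "is_interval I" "open I \<or> (\<exists>a. I = {a})" if "I \<in> F" for I
    using bspec[OF F(2) that] by (auto simp: is_interval_1)
  ultimately show ?thesis using that F(1) by blast
qed

text \<open>An interval that meets every right neighbourhood of \<open>p\<close> contains one of
  them by convexity; finite unions inherit the alternative. Its use is to upgrade "not eventually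
  true" to "eventually false".\<close>

lemma definable_germ:
  fixes P :: "real \<Rightarrow> bool"
  assumes "definable P"
  shows "(\<forall>\<^sub>F x in at_right p. P x) \<or> (\<forall>\<^sub>F x in at_right p. \<not> P x)"
proof -
  obtain F where F: "finite F" "\<And>I. I \<in> F \<Longrightarrow> is_interval I" "{t. P t} = \<Union>F"
    using definable_real_union[OF assms] by metis
  have one: "(\<forall>\<^sub>F x in at_right p. x \<in> I) \<or> (\<forall>\<^sub>F x in at_right p. x \<notin> I)" if "is_interval I" for I
  proof (cases "\<forall>\<^sub>F x in at_right p. x \<notin> I")
    case False
    have *: "\<exists>x\<in>I. p < x \<and> x < b" if "p < b" for b
      using False that unfolding eventually_at_right_field by blast
    obtain x0 where x0: "x0 \<in> I" "p < x0" using *[of "p + 1"] by auto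
    have "x \<in> I" if x: "p < x" "x < x0" for x
    proof -
      obtain x1 where "x1 \<in> I" "x1 < x" using *[of x] x by auto
      then show ?thesis using x0 x \<open>is_interval I\<close> unfolding is_interval_1 by (meson less_imp_le)
    qed
    then show ?thesis using x0 unfolding eventually_at_right_field by blast
  qed simp
  have "(\<forall>\<^sub>F x in at_right p. x \<in> \<Union>G) \<or> (\<forall>\<^sub>F x in at_right p. x \<notin> \<Union>G)"
    if "finite G" "G \<subseteq> F" for G
    using that
  proof (induction G rule: finite_induct)
    case (insert I G)
    then have "(\<forall>\<^sub>F x in at_right p. x \<in> I) \<or> (\<forall>\<^sub>F x in at_right p. x \<notin> I)"
      using one F(2) by blast
    moreover have "(\<forall>\<^sub>F x in at_right p. x \<in> \<Union>G) \<or> (\<forall>\<^sub>F x in at_right p. x \<notin> \<Union>G)"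
      using insert by blast
    ultimately consider "\<forall>\<^sub>F x in at_right p. x \<in> I" | "\<forall>\<^sub>F x in at_right p. x \<in> \<Union>G"
      | "\<forall>\<^sub>F x in at_right p. x \<notin> I" "\<forall>\<^sub>F x in at_right p. x \<notin> \<Union>G" by blast
    then show ?case
    proof cases
      case 1
      then have "\<forall>\<^sub>F x in at_right p. x \<in> \<Union>(insert I G)" by eventually_elim simp
      then show ?thesis ..
    next
      case 2
      then have "\<forall>\<^sub>F x in at_right p. x \<in> \<Union>(insert I G)" by eventually_elim simp
      then show ?thesis ..
    next
      case 3
      then have "\<forall>\<^sub>F x in at_right p. x \<notin> \<Union>(insert I G)" by eventually_elim simp
      then show ?thesis ..
    qed
  qed simp
  from this[OF F(1) subset_refl] have "(\<forall>\<^sub>F x in at_right p. x \<in> {t. P t}) \<or> (\<forall>\<^sub>F x in at_right p. x \<notin> {t. P t})"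
    unfolding F(3) .
  then show ?thesis by simp
qed

text \<open>One piece of the finite union must be infinite, so it is open and not a
  singleton.\<close>

lemma definable_infinite_interval:
  fixes P :: "real \<Rightarrow> bool"
  assumes "definable P" "infinite {t. P t}"
  obtains a b where "a < b" "\<And>t. a < t \<Longrightarrow> t < b \<Longrightarrow> P t"
proof -
  obtain F where F: "finite F" "\<And>I. I \<in> F \<Longrightarrow> open I \<or> (\<exists>a. I = {a})" "{t. P t} = \<Union>F"
    using definable_real_union[OF assms(1)] by metis
  have "\<exists>I\<in>F. infinite I" using assms(2) F(1,3) by auto
  then obtain I where I: "I \<in> F" "infinite I" by blast
  then have "open I" using F(2)[of I] by auto
  moreover obtain x where "x \<in> I" using I(2) by fastforce
  ultimately obtain e where e: "0 < e" "ball x e \<subseteq> I" by (meson open_contains_ball)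
  have "I \<subseteq> {t. P t}" using F(3) I(1) by blast
  have "P t" if "x < t" "t < x + e" for t
  proof -
    have "t \<in> ball x e" using that by (simp add: dist_real_def)
    then show ?thesis using \<open>I \<subseteq> {t. P t}\<close> e(2) by blast
  qed
  then show ?thesis using e(1) that[of x "x + e"] by simp
qed

(* A definable function can only be discontinuous from the right by a jump. The jumps of any
   function are countable in number, and a countable definable set is finite. *)

lemma finite_not_right_continuous:
  fixes \<phi> :: "real \<Rightarrow> real"
  assumes \<phi>: "definable_fun \<phi>"
  shows "finite {p. \<not> (\<phi> \<longlongrightarrow> \<phi> p) (at_right p)}"
proof (rule ccontr)
  \<comment> \<open>Right continuity in \<epsilon>-\<delta> form, the absolute value split into two
    inequalities so that \<open>definable_intros\<close> applies.\<close>
  let ?C = "\<lambda>p. \<forall>e. 0 < e \<longrightarrow> (\<exists>d. 0 < d \<and> (\<forall>x. p < x \<and> x < p + d \<longrightarrow> - e < \<phi> x - \<phi> p \<and> \<phi> x - \<phi> p < e))"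
  have C: "(\<phi> \<longlongrightarrow> \<phi> p) (at_right p) \<longleftrightarrow> ?C p" for p
  proof
    assume "(\<phi> \<longlongrightarrow> \<phi> p) (at_right p)"
    then have *: "\<forall>e>0. \<exists>b>p. \<forall>y>p. y < b \<longrightarrow> \<bar>\<phi> y - \<phi> p\<bar> < e"
      by (simp add: tendsto_iff eventually_at_right_field dist_real_def)
    show "?C p"
    proof (intro allI impI)
      fix e :: real assume "0 < e"
      then obtain b where "p < b" "\<forall>y>p. y < b \<longrightarrow> \<bar>\<phi> y - \<phi> p\<bar> < e" using * by blast
      then show "\<exists>d. 0 < d \<and> (\<forall>x. p < x \<and> x < p + d \<longrightarrow> - e < \<phi> x - \<phi> p \<and> \<phi> x - \<phi> p < e)"
        by (intro exI[of _ "b - p"]) auto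
    qed
  next
    assume C: "?C p"
    show "(\<phi> \<longlongrightarrow> \<phi> p) (at_right p)"
      unfolding tendsto_iff eventually_at_right_field dist_real_def
    proof (intro allI impI)
      fix e :: real assume "0 < e"
      then obtain d where "0 < d" "\<forall>x. p < x \<and> x < p + d \<longrightarrow> - e < \<phi> x - \<phi> p \<and> \<phi> x - \<phi> p < e" using C by blast
      then show "\<exists>b>p. \<forall>y>p. y < b \<longrightarrow> \<bar>\<phi> y - \<phi> p\<bar> < e"
        by (intro exI[of _ "p + d"]) auto
    qed
  qed
  have "definable (\<lambda>p. \<not> (\<phi> \<longlongrightarrow> \<phi> p) (at_right p))"
    unfolding C by (intro definable_intros definable_fun_comp[OF \<phi>])
  moreover assume "infinite {p. \<not> (\<phi> \<longlongrightarrow> \<phi> p) (at_right p)}"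
  ultimately obtain a b where ab: "a < b" "\<And>t. a < t \<Longrightarrow> t < b \<Longrightarrow> \<not> (\<phi> \<longlongrightarrow> \<phi> t) (at_right t)"
    by (rule definable_infinite_interval) blast
  \<comment> \<open>Every point of the interval is a discontinuity and hence, by the germ
    alternative, a jump up or down; countably many jumps cannot fill an interval.\<close>
  have "{a<..<b} \<subseteq> right_jumps \<phi> \<union> right_jumps (\<lambda>x. - \<phi> x)"
  proof
    fix p assume "p \<in> {a<..<b}"
    then have "\<not> (\<phi> \<longlongrightarrow> \<phi> p) (at_right p)" using ab by simp
    then obtain e where e: "0 < e" "\<not> (\<forall>\<^sub>F x in at_right p. \<bar>\<phi> x - \<phi> p\<bar> < e)"
      unfolding tendsto_iff dist_real_def by blast
    have "(\<forall>\<^sub>F x in at_right p. \<phi> x < \<phi> p + e) \<or> (\<forall>\<^sub>F x in at_right p. \<not> \<phi> x < \<phi> p + e)"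
      by (rule definable_germ) (intro definable_intros \<phi>)
    moreover have "(\<forall>\<^sub>F x in at_right p. \<phi> p - e < \<phi> x) \<or> (\<forall>\<^sub>F x in at_right p. \<not> \<phi> p - e < \<phi> x)"
      by (rule definable_germ) (intro definable_intros \<phi>)
    moreover have "\<not> ((\<forall>\<^sub>F x in at_right p. \<phi> x < \<phi> p + e) \<and> (\<forall>\<^sub>F x in at_right p. \<phi> p - e < \<phi> x))"
    proof
      assume *: "(\<forall>\<^sub>F x in at_right p. \<phi> x < \<phi> p + e) \<and> (\<forall>\<^sub>F x in at_right p. \<phi> p - e < \<phi> x)"
      from *[THEN conjunct1] *[THEN conjunct2]
      have "\<forall>\<^sub>F x in at_right p. \<bar>\<phi> x - \<phi> p\<bar> < e"
        by eventually_elim linarith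
      then show False using e by blast
    qed
    ultimately consider "\<forall>\<^sub>F x in at_right p. \<not> \<phi> x < \<phi> p + e" | "\<forall>\<^sub>F x in at_right p. \<not> \<phi> p - e < \<phi> x"
      by blast
    then show "p \<in> right_jumps \<phi> \<union> right_jumps (\<lambda>x. - \<phi> x)"
    proof cases
      case 1
      then have "\<forall>\<^sub>F x in at_right p. \<phi> p + e / 2 < \<phi> x" by eventually_elim (use e in simp)
      then show ?thesis using e unfolding right_jumps_def by (auto intro!: exI[of _ "\<phi> p + e / 2"])
    next
      case 2
      then have "\<forall>\<^sub>F x in at_right p. - \<phi> p + e / 2 < - \<phi> x" by eventually_elim (use e in simp)
      then show ?thesis using e unfolding right_jumps_def by (auto intro!: exI[of _ "- \<phi> p + e / 2"])
    qed
  qed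
  then have "countable {a<..<b}" using countable_right_jumps countable_subset countable_Un by metis
  then show False using ab(1) uncountable_open_interval by blast
qed

text \<open>Reflecting the line at 0 turns left limits into right limits.\<close>

lemma finite_not_continuous:
  fixes \<phi> :: "real \<Rightarrow> real"
  assumes \<phi>: "definable_fun \<phi>"
  shows "finite {p. \<not> isCont \<phi> p}"
proof -
  have "definable_fun (\<lambda>x. \<phi> (- x))"
    by (rule definable_fun_comp[OF \<phi>]) (intro definable_intros)
  from finite_not_right_continuous[OF this]
  have "finite (uminus ` {p. \<not> ((\<lambda>x. \<phi> (- x)) \<longlongrightarrow> \<phi> (- p)) (at_right p)})" by simp
  moreover have "{p. \<not> (\<phi> \<longlongrightarrow> \<phi> p) (at_left p)} \<subseteq>
      uminus ` {p. \<not> ((\<lambda>x. \<phi> (- x)) \<longlongrightarrow> \<phi> (- p)) (at_right p)}"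
  proof
    fix p assume "p \<in> {p. \<not> (\<phi> \<longlongrightarrow> \<phi> p) (at_left p)}"
    then have "\<not> ((\<lambda>x. \<phi> (- x)) \<longlongrightarrow> \<phi> p) (at_right (- p))"
      by (simp add: at_left_minus[of p] filterlim_filtermap)
    then show "p \<in> uminus ` {p. \<not> ((\<lambda>x. \<phi> (- x)) \<longlongrightarrow> \<phi> (- p)) (at_right p)}"
      by (intro image_eqI[of _ _ "- p"]) auto
  qed
  ultimately have "finite {p. \<not> (\<phi> \<longlongrightarrow> \<phi> p) (at_left p)}" by (rule finite_subset[rotated])
  moreover have "{p. \<not> isCont \<phi> p} = {p. \<not> (\<phi> \<longlongrightarrow> \<phi> p) (at_left p)} \<union> {p. \<not> (\<phi> \<longlongrightarrow> \<phi> p) (at_right p)}"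
    by (auto simp: isCont_def filterlim_at_split)
  ultimately show ?thesis using finite_not_right_continuous[OF \<phi>] by simp
qed

text \<open>By the germ alternative the right growth rate at \<open>r\<close> exceeds
  \<open>\<epsilon> / r\<close> either at all small \<open>r\<close> or at none. The first makes
  \<open>\<phi> - \<epsilon> ln\<close> nondecreasing, so \<phi> would be unbounded at 0. In the
  second the rate at \<open>t \<ge> s\<close> is at most \<open>\<epsilon> / s\<close> along
  arbitrarily small steps, and creeping adds these up.\<close>

lemma slope_bound_near_0:
  fixes \<phi> :: "real \<Rightarrow> real"
  assumes \<phi>: "definable_fun \<phi>" and bound: "\<forall>\<^sub>F r in at_right 0. \<bar>\<phi> r\<bar> \<le> B" and "0 < \<epsilon>"
  shows "\<exists>r1>0. \<forall>s r. 0 < s \<and> s \<le> r \<and> r < r1 \<longrightarrow> \<phi> r - \<phi> s \<le> \<epsilon> * (r - s) / s"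
proof -
  let ?Q = "\<lambda>r h. \<epsilon> * h < r * (\<phi> (r + h) - \<phi> r)"
  let ?P = "\<lambda>r. \<exists>d. 0 < d \<and> (\<forall>h. 0 < h \<and> h < d \<longrightarrow> ?Q r h)"
  have "\<forall>\<^sub>F r in at_right 0. \<bar>\<phi> r\<bar> \<le> B \<and> isCont \<phi> r"
    using bound eventually_at_right_notin_finite[OF finite_not_continuous[OF \<phi>], of 0]
    by eventually_elim simp
  then obtain r2 where r2: "0 < r2" "\<And>r. 0 < r \<Longrightarrow> r < r2 \<Longrightarrow> \<bar>\<phi> r\<bar> \<le> B"
    "\<And>r. 0 < r \<Longrightarrow> r < r2 \<Longrightarrow> isCont \<phi> r"
    unfolding eventually_at_right_field by metis
  have cont: "continuous_on {a..b} \<phi>" if "0 < a" "b < r2" for a b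
    using that by (intro continuous_at_imp_continuous_on) (auto intro!: r2)
  have "(\<forall>\<^sub>F r in at_right 0. ?P r) \<or> (\<forall>\<^sub>F r in at_right 0. \<not> ?P r)"
    by (rule definable_germ) (intro definable_intros definable_fun_comp[OF \<phi>])
  then show ?thesis
  proof
    assume "\<forall>\<^sub>F r in at_right 0. ?P r"
    then obtain r3 where r3: "0 < r3" "\<And>r. 0 < r \<Longrightarrow> r < r3 \<Longrightarrow> ?P r"
      unfolding eventually_at_right_field by metis
    define b where "b = min r2 r3 / 2"
    \<comment> \<open>Between \<open>a\<close> and \<open>b\<close> the term
      \<open>\<epsilon> ln\<close> gains \<open>2 * B + 1\<close>, more than the oscillation
      \<open>2 * B\<close> that the bound allows.\<close>
    define a where "a = b * exp (- (2 * B + 1) / \<epsilon>)"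
    have b: "0 < b" "b < r2" "b < r3" using r2(1) r3(1) by (auto simp: b_def)
    have "0 \<le> B" using r2(2)[of b] b by linarith
    have "- (2 * B + 1) / \<epsilon> \<le> 0" using \<open>0 \<le> B\<close> \<open>0 < \<epsilon>\<close> by (intro divide_nonpos_pos) auto
    then have a: "0 < a" "a \<le> b" using b by (auto simp: a_def)
    have "\<phi> a - \<epsilon> * ln a \<le> \<phi> b - \<epsilon> * ln b"
    proof (rule creeping[OF a(2)])
      show "continuous_on {a..b} (\<lambda>t. \<phi> t - \<epsilon> * ln t)"
        using a b by (intro continuous_intros cont) auto
    next
      fix t assume t: "a \<le> t" "t < b"
      obtain d where d: "0 < d" "\<forall>h. 0 < h \<and> h < d \<longrightarrow> ?Q t h" using r3(2)[of t] t a b by auto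
      define h where "h = min (d / 2) (b - t)"
      have h: "0 < h" "h < d" "t + h \<le> b" using d(1) t by (auto simp: h_def)
      have "t > 0" using t a by simp
      have "1 + h / t = (t + h) / t" using \<open>t > 0\<close> by (simp add: field_simps)
      then have "ln (t + h) - ln t = ln (1 + h / t)"
        using \<open>t > 0\<close> h by (simp add: ln_div)
      also have "\<dots> \<le> h / t" using \<open>t > 0\<close> h by (intro ln_add_one_self_le_self) auto
      finally have "\<epsilon> * (ln (t + h) - ln t) \<le> \<epsilon> * (h / t)" using \<open>0 < \<epsilon>\<close> by (intro mult_left_mono) auto
      also have "\<dots> < \<phi> (t + h) - \<phi> t"
      proof -
        have "?Q t h" using d(2) h by blast
        then show ?thesis using \<open>t > 0\<close> by (simp add: field_simps)
      qed
      finally show "\<exists>t'. t < t' \<and> t' \<le> b \<and> \<phi> t - \<epsilon> * ln t \<le> \<phi> t' - \<epsilon> * ln t'"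
        using h by (intro exI[of _ "t + h"]) (auto simp: algebra_simps)
    qed
    moreover have "\<epsilon> * ln a = \<epsilon> * ln b - (2 * B + 1)"
      using b \<open>0 < \<epsilon>\<close> by (simp add: a_def ln_mult field_simps)
    ultimately have "2 * B + 1 \<le> \<phi> b - \<phi> a" by linarith
    moreover have "\<bar>\<phi> a\<bar> \<le> B" "\<bar>\<phi> b\<bar> \<le> B" using a b by (auto intro!: r2)
    ultimately show ?thesis by linarith
  next
    assume "\<forall>\<^sub>F r in at_right 0. \<not> ?P r"
    then obtain r3 where r3: "0 < r3" "\<And>r. 0 < r \<Longrightarrow> r < r3 \<Longrightarrow> \<not> ?P r"
      unfolding eventually_at_right_field by metis
    show ?thesis
    proof (intro exI[of _ "min r2 r3"] conjI allI impI)
      fix s r :: real assume sr: "0 < s \<and> s \<le> r \<and> r < min r2 r3"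
      have "\<epsilon> / s * s - \<phi> s \<le> \<epsilon> / s * r - \<phi> r"
      proof (rule creeping[where \<phi> = "\<lambda>t. \<epsilon> / s * t - \<phi> t" and a = s and b = r])
        show "continuous_on {s..r} (\<lambda>t. \<epsilon> / s * t - \<phi> t)"
          using sr by (intro continuous_intros cont) auto
      next
        fix t assume t: "s \<le> t" "t < r"
        \<comment> \<open>Failure of \<open>?P t\<close> only says that not all small steps gain too
          much; the germ in \<open>h\<close> improves this to no small step.\<close>
        have "(\<forall>\<^sub>F h in at_right 0. ?Q t h) \<or> (\<forall>\<^sub>F h in at_right 0. \<not> ?Q t h)"
          by (rule definable_germ) (intro definable_intros definable_fun_comp[OF \<phi>])
        moreover have "\<not> (\<forall>\<^sub>F h in at_right 0. ?Q t h)"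
          using r3(2)[of t] t sr unfolding eventually_at_right_field by auto
        ultimately obtain d where d: "0 < d" "\<And>h. 0 < h \<Longrightarrow> h < d \<Longrightarrow> \<not> ?Q t h"
          unfolding eventually_at_right_field by blast
        define h where "h = min (d / 2) (r - t)"
        have h: "0 < h" "h < d" "t + h \<le> r" using d(1) t by (auto simp: h_def)
        have "t > 0" using t sr by simp
        have "\<phi> (t + h) - \<phi> t \<le> \<epsilon> * h / t" using d(2)[OF h(1,2)] \<open>t > 0\<close> by (simp add: field_simps)
        also have "\<dots> \<le> \<epsilon> * h / s" using t sr h \<open>0 < \<epsilon>\<close> by (intro divide_left_mono) auto
        finally show "\<exists>t'. t < t' \<and> t' \<le> r \<and> \<epsilon> / s * t - \<phi> t \<le> \<epsilon> / s * t' - \<phi> t'"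
          using h by (intro exI[of _ "t + h"]) (auto simp: algebra_simps add_divide_distrib)
      qed (use sr in auto)
      then show "\<phi> r - \<phi> s \<le> \<epsilon> * (r - s) / s" by (simp add: algebra_simps diff_divide_distrib)
    qed (use r2 r3 in auto)
  qed
qed

(* The chosen point is the minimum of a fibre that has one, and otherwise the midpoint of the
   leftmost maximal open interval contained in the fibre. *)

lemma definable_choice_real:
  fixes R :: "'p::euclidean_space \<Rightarrow> real \<Rightarrow> bool"
  assumes R: "definable (\<lambda>z. R (fst z) (snd z))" and bound: "\<And>p t. R p t \<Longrightarrow> \<bar>t\<bar> \<le> B"
  shows "\<exists>g. definable_fun g \<and> (\<forall>p t. R p t \<longrightarrow> R p (g p))"
proof -
  define I where "I p t a b \<longleftrightarrow> a < b \<and> 2 * t = a + b \<and> (\<forall>t'. t' \<le> a \<longrightarrow> \<not> R p t') \<and>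
      (\<forall>t'. a < t' \<and> t' < b \<longrightarrow> R p t') \<and>
      (\<forall>b'. b < b' \<longrightarrow> (\<exists>t'. a < t' \<and> t' < b' \<and> \<not> R p t'))" for p t a b
  define C where "C p t \<longleftrightarrow> (R p t \<and> (\<forall>t'. t' < t \<longrightarrow> \<not> R p t')) \<or> (\<exists>a b. I p t a b)" for p t
  have "definable (\<lambda>z. C (fst z) (snd z))"
    unfolding C_def I_def by (intro definable_intros definable_subst2[OF R])
  have CR: "R p t" if "C p t" for p t
    using that unfolding C_def I_def by force
  have exC: "\<exists>t. C p t" if "R p t0" for p t0
  proof -
    let ?A = "{t. R p t}"
    have bdd: "bdd_below ?A" by (rule bdd_belowI[of _ "- B"]) (use bound[of p] in fastforce)
    define m where "m = Inf ?A"
    have m: "m \<le> t" if "R p t" for t unfolding m_def using that bdd by (intro cInf_lower) auto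
    show ?thesis
    proof (cases "R p m")
      case True
      then show ?thesis using m unfolding C_def by (intro exI[of _ m]) force
    next
      case False
      have "definable (R p)"
        using definable_subst2[OF R definable_fun_const definable_fun_id] by simp
      from definable_germ[OF this]
      have "(\<forall>\<^sub>F x in at_right m. R p x) \<or> (\<forall>\<^sub>F x in at_right m. \<not> R p x)" .
      moreover have "\<not> (\<forall>\<^sub>F x in at_right m. \<not> R p x)"
      proof
        assume "\<forall>\<^sub>F x in at_right m. \<not> R p x"
        then obtain b where b: "m < b" "\<And>x. m < x \<Longrightarrow> x < b \<Longrightarrow> \<not> R p x"
          unfolding eventually_at_right_field by blast
        have "\<exists>t\<in>?A. t < b"
          using b(1) that unfolding m_def by (intro cInf_lessD) auto
        then obtain t where "R p t" "t < b" by blast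
        moreover have "m < t" using m[OF \<open>R p t\<close>] False \<open>R p t\<close> by (cases "m = t") auto
        ultimately show False using b(2) by blast
      qed
      ultimately obtain b0 where b0: "m < b0" "\<And>x. m < x \<Longrightarrow> x < b0 \<Longrightarrow> R p x"
        unfolding eventually_at_right_field by blast
      \<comment> \<open>The supremum of this set is the right end of the leftmost interval; it is
        finite because the fibre is bounded.\<close>
      let ?U = "{b. \<forall>t'. m < t' \<and> t' < b \<longrightarrow> R p t'}"
      have bddU: "bdd_above ?U"
      proof (rule bdd_aboveI)
        fix b assume b: "b \<in> ?U"
        show "b \<le> max m B + 1"
        proof (rule ccontr)
          assume "\<not> b \<le> max m B + 1"
          then have "R p (max m B + 1)" using b by auto
          then show False using bound by fastforce
        qed
      qed
      define b where "b = Sup ?U"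
      have b0U: "b0 \<in> ?U" using b0 by auto
      have bU: "b' \<le> b" if "b' \<in> ?U" for b' unfolding b_def by (rule cSup_upper[OF that bddU])
      have "m < b" using b0(1) bU[OF b0U] by linarith
      moreover have "R p t'" if t': "m < t'" "t' < b" for t'
      proof -
        obtain b' where "b' \<in> ?U" "t' < b'"
          using less_cSupD[of ?U t'] t' b0U unfolding b_def by blast
        then show ?thesis using t' by auto
      qed
      moreover have "\<exists>t'. m < t' \<and> t' < b' \<and> \<not> R p t'" if "b < b'" for b'
        using bU[of b'] that by auto
      moreover have "\<not> R p t'" if "t' \<le> m" for t' using m[of t'] that False by force
      ultimately have "I p ((m + b) / 2) m b" unfolding I_def by simp
      then show ?thesis unfolding C_def by blast
    qed
  qed
  have I_unique: "a = a' \<and> b = b'" if "I p t a b" "I p t' a' b'" for p t t' a b a' b'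
  proof -
    \<comment> \<open>If \<open>a < a'\<close>, some point of the fibre between \<open>a\<close> and
      \<open>b\<close> would be at most \<open>a'\<close>, where the second interval excludes fibre
      points.\<close>
    have aa: "\<not> a < a'" if "I p t a b" "I p t' a' b'" for t t' a b a' b'
    proof
      assume "a < a'"
      then have "R p ((a + min a' b) / 2)" "(a + min a' b) / 2 \<le> a'"
        using that unfolding I_def by (auto simp: min_def)
      then show False using that unfolding I_def by blast
    qed
    have bb: "\<not> b < b'" if "I p t a b" "I p t' a b'" for t t' b b'
      using that unfolding I_def by blast
    have "a = a'" using aa[OF that] aa[OF that(2,1)] by linarith
    with that(2) have "I p t' a b'" by simp
    then show ?thesis using bb[OF that(1)] bb[OF _ that(1)] \<open>a = a'\<close> by force
  qed
  have C_unique: "t = t'" if "C p t" "C p t'" for p t t'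
  proof -
    have mixed: False if "R p t" "\<forall>t'. t' < t \<longrightarrow> \<not> R p t'" "I p t' a b" for t t' a b
    proof -
      have "a < t" using that unfolding I_def by force
      then have "R p ((a + min t b) / 2)" "(a + min t b) / 2 < t"
        using that(3) unfolding I_def by (auto simp: min_def)
      then show False using that(2) by blast
    qed
    from that consider "R p t" "R p t'" "\<forall>s<t. \<not> R p s" "\<forall>s<t'. \<not> R p s"
      | "R p t" "\<forall>s<t. \<not> R p s" "\<exists>a b. I p t' a b"
      | "R p t'" "\<forall>s<t'. \<not> R p s" "\<exists>a b. I p t a b"
      | "\<exists>a b. I p t a b" "\<exists>a b. I p t' a b"
      unfolding C_def by blast
    then show ?thesis
    proof cases
      case 1
      then show ?thesis by (meson linorder_less_linear)
    next
      case 4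
      then obtain a b a' b' where ab: "I p t a b" "I p t' a' b'" by blast
      then have "2 * t = a + b" "2 * t' = a' + b'" unfolding I_def by auto
      then show ?thesis using I_unique[OF ab] by simp
    qed (use mixed in blast)+
  qed
  \<comment> \<open>Empty fibres get the value 0, which the formula for the graph has to
    mention.\<close>
  define g where "g p = (if \<exists>t. R p t then THE t. C p t else 0)" for p
  have gC: "C p (g p)" if "R p t" for p t
  proof -
    have "\<exists>!t. C p t" using exC[OF that] C_unique by blast
    then show ?thesis using that theI'[of "C p"] by (auto simp: g_def)
  qed
  have "(t = g p) \<longleftrightarrow> C p t \<or> (\<not> (\<exists>t. R p t) \<and> t = 0)" for p t
    using gC CR C_unique by (metis g_def)
  moreover have "definable (\<lambda>z. C (fst z) (snd z) \<or> (\<not> (\<exists>t. R (fst z) t) \<and> snd z = 0))"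
    by (intro definable_intros definable_subst2[OF R] \<open>definable (\<lambda>z. C (fst z) (snd z))\<close>)
  ultimately have "definable_fun g" unfolding definable_fun_def by simp
  then show ?thesis using gC CR by blast
qed

text \<open>Coordinates are fixed one at a time. The invariant is that some point of the fibre
  agrees with \<open>g p\<close> on the coordinates in \<open>F\<close>; the next coordinate is
  chosen among those of the fibre points that still agree.\<close>

lemma definable_choice:
  fixes R :: "'p::euclidean_space \<Rightarrow> 'c::euclidean_space \<Rightarrow> bool"
  assumes R: "definable (\<lambda>z. R (fst z) (snd z))" and bound: "\<And>p x. R p x \<Longrightarrow> norm x \<le> B"
  shows "\<exists>g. definable_fun g \<and> (\<forall>p x. R p x \<longrightarrow> R p (g p))"
proof -
  have "\<exists>g :: 'p \<Rightarrow> 'c. definable_fun g \<and>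
      (\<forall>p x. R p x \<longrightarrow> (\<exists>y. R p y \<and> (\<forall>b\<in>F. y \<bullet> b = g p \<bullet> b)))"
    if "finite F" "F \<subseteq> Basis" for F
    using that
  proof (induction F rule: finite_induct)
    case empty
    have "definable_fun (\<lambda>p::'p. 0::'c)" by (rule definable_fun_const)
    then show ?case by auto
  next
    case (insert b F)
    then obtain g :: "'p \<Rightarrow> 'c" where g: "definable_fun g"
      "\<forall>p x. R p x \<longrightarrow> (\<exists>y. R p y \<and> (\<forall>b\<in>F. y \<bullet> b = g p \<bullet> b))" by blast
    define R' where "R' p t \<longleftrightarrow> (\<exists>y. R p y \<and> (\<forall>b\<in>F. y \<bullet> b = g p \<bullet> b) \<and> y \<bullet> b = t)" for p t
    have defR': "definable (\<lambda>z. R' (fst z) (snd z))"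
      unfolding R'_def
      by (intro definable_intros definable_ball_finite insert.hyps definable_subst2[OF R]
          definable_fun_comp[OF g(1)])
    have "\<bar>t\<bar> \<le> B" if "R' p t" for p t
    proof -
      obtain y where "R p y" "y \<bullet> b = t" using \<open>R' p t\<close> unfolding R'_def by blast
      then show ?thesis using Basis_le_norm[of b y] bound[of p y] insert.prems by auto
    qed
    then have "\<exists>h. definable_fun h \<and> (\<forall>p t. R' p t \<longrightarrow> R' p (h p))"
      by (rule definable_choice_real[OF defR'])
    then obtain h where h: "definable_fun h" "\<And>p t. R' p t \<Longrightarrow> R' p (h p)"
      by blast
    \<comment> \<open>Since the basis is orthonormal, only the \<open>b\<close>-coordinate
      changes.\<close>
    define g' where "g' p = g p + (h p - g p \<bullet> b) *\<^sub>R b" for p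
    have "definable_fun g'"
      unfolding g'_def by (intro definable_intros g(1) h(1))
    moreover have "\<exists>y. R p y \<and> (\<forall>b'\<in>insert b F. y \<bullet> b' = g' p \<bullet> b')" if Rx: "R p x" for p x
    proof -
      have "\<exists>t. R' p t" using g(2) Rx unfolding R'_def by blast
      then obtain y where y: "R p y" "\<forall>b\<in>F. y \<bullet> b = g p \<bullet> b" "y \<bullet> b = h p"
        using h(2) unfolding R'_def by blast
      have "g' p \<bullet> b = h p" using insert.prems by (simp add: g'_def inner_left_distrib)
      moreover have "g' p \<bullet> b' = g p \<bullet> b'" if "b' \<in> F" for b'
      proof -
        have "b \<bullet> b' = 0" using insert that by (auto simp: inner_Basis)
        then show ?thesis by (simp add: g'_def inner_left_distrib)
      qed
      ultimately show ?thesis using y by (intro exI[of _ y]) auto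
    qed
    ultimately show ?case by blast
  qed
  from this[OF finite_Basis subset_refl] obtain g :: "'p \<Rightarrow> 'c" where
    g: "definable_fun g" "\<And>p x. R p x \<Longrightarrow> (\<exists>y. R p y \<and> (\<forall>b\<in>Basis. y \<bullet> b = g p \<bullet> b))" by blast
  have "R p (g p)" if "R p x" for p x
    using g(2)[OF that] euclidean_eqI by blast
  then show ?thesis using g(1) by blast
qed

end

subsection \<open>Clarke subdifferentials and definable functions\<close>

text \<open>A lower bound on the limsup, spelled out and multiplied by \<open>t\<close>, is a
  first-order condition on f. It provides nearby difference quotients for estimates and makes the
  critical points definable.\<close>

lemma clarke_ge_iff:
  "ereal q \<le> clarke_dir_deriv f x d \<longleftrightarrow>
    (\<forall>\<rho>>0. \<forall>\<delta>>0. \<exists>z t. norm (z - x) < \<delta> \<and> 0 < t \<and> t < \<delta> \<and> t * (q - \<rho>) < f (z + t *\<^sub>R d) - f z)"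
  (is "_ \<longleftrightarrow> ?R")
proof
  let ?X = "\<lambda>(y, t). ereal ((f (y + t *\<^sub>R d) - f y) / t)"
  assume L: "ereal q \<le> clarke_dir_deriv f x d"
  show ?R
  proof (intro allI impI, rule ccontr)
    fix \<rho> \<delta> :: real
    assume "0 < \<rho>" "0 < \<delta>"
      and "\<nexists>z t. norm (z - x) < \<delta> \<and> 0 < t \<and> t < \<delta> \<and> t * (q - \<rho>) < f (z + t *\<^sub>R d) - f z"
    then have *: "f (z + t *\<^sub>R d) - f z \<le> t * (q - \<rho>)" if "norm (z - x) < \<delta>" "0 < t" "t < \<delta>" for z t
      using that by fastforce
    have "\<forall>\<^sub>F z in nhds x. norm (z - x) < \<delta>"
      unfolding eventually_nhds_metric dist_norm using \<open>0 < \<delta>\<close> by blast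
    moreover have "\<forall>\<^sub>F t in at_right 0. 0 < t \<and> t < \<delta>"
      unfolding eventually_at_right_field using \<open>0 < \<delta>\<close> by blast
    ultimately have "\<forall>\<^sub>F z in nhds x \<times>\<^sub>F at_right 0. ?X z \<le> ereal (q - \<rho>)"
      unfolding eventually_prod_filter
      by (intro exI conjI) (auto simp: divide_le_eq mult.commute dest!: *)
    then have "clarke_dir_deriv f x d \<le> ereal (q - \<rho>)"
      unfolding clarke_dir_deriv_def by (rule Limsup_bounded)
    then have "ereal q \<le> ereal (q - \<rho>)" using L by (rule order_trans[rotated])
    then show False using \<open>0 < \<rho>\<close> by simp
  qed
next
  let ?X = "\<lambda>(y, t). ereal ((f (y + t *\<^sub>R d) - f y) / t)"
  assume R: ?R
  show "ereal q \<le> clarke_dir_deriv f x d"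
  proof (rule ccontr)
    assume "\<not> ereal q \<le> clarke_dir_deriv f x d"
    then have "clarke_dir_deriv f x d < ereal q" by (rule not_le_imp_less)
    from ereal_dense2[OF this] obtain c where c: "clarke_dir_deriv f x d < ereal c" "c < q"
      unfolding less_ereal.simps by blast
    have "\<forall>\<^sub>F z in nhds x \<times>\<^sub>F at_right 0. ?X z < ereal c"
      using c(1) unfolding clarke_dir_deriv_def by (rule Limsup_lessD)
    then obtain P Q where PQ: "\<forall>\<^sub>F z in nhds x. P z" "\<forall>\<^sub>F t in at_right 0. Q t"
      "\<And>z t. P z \<Longrightarrow> Q t \<Longrightarrow> (f (z + t *\<^sub>R d) - f z) / t < c"
      unfolding eventually_prod_filter by auto
    obtain d1 where d1: "0 < d1" "\<And>z. norm (z - x) < d1 \<Longrightarrow> P z"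
      using PQ(1) unfolding eventually_nhds_metric dist_norm by blast
    obtain d2 where d2: "0 < d2" "\<And>t. 0 < t \<Longrightarrow> t < d2 \<Longrightarrow> Q t"
      using PQ(2) unfolding eventually_at_right_field by auto
    obtain z t where zt: "norm (z - x) < min d1 d2" "0 < t" "t < min d1 d2"
      "t * (q - (q - c)) < f (z + t *\<^sub>R d) - f z"
      using R[rule_format, of "q - c" "min d1 d2"] c d1 d2 by auto
    have "(f (z + t *\<^sub>R d) - f z) / t < c" using PQ(3) d1(2) d2(2) zt by simp
    then show False using zt by (simp add: field_simps)
  qed
qed

text \<open>The base point and the displaced point both tend to \<open>x\<close>, so the quotients
  agree eventually. This permits replacing f by a definable cut-off.\<close>

lemma clarke_dir_deriv_local:
  assumes "0 < e" "\<And>y. norm (y - x) < e \<Longrightarrow> f y = g y"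
  shows "clarke_dir_deriv f x d = clarke_dir_deriv g x d"
  unfolding clarke_dir_deriv_def
proof (rule Limsup_eq)
  let ?F = "nhds x \<times>\<^sub>F at_right (0::real)"
  have 1: "((\<lambda>z. fst z) \<longlongrightarrow> x) ?F" by (rule filterlim_fst)
  have "filterlim snd (at_right 0) ?F" by (rule filterlim_snd)
  then have 2: "((\<lambda>z. snd z) \<longlongrightarrow> 0) ?F" unfolding filterlim_at by auto
  have "((\<lambda>z. fst z + snd z *\<^sub>R d) \<longlongrightarrow> x + 0 *\<^sub>R d) ?F"
    by (intro tendsto_intros 1 2)
  then have "\<forall>\<^sub>F z in ?F. norm (fst z + snd z *\<^sub>R d - x) < e"
    using assms(1) by (simp add: tendsto_iff dist_norm)
  moreover have "\<forall>\<^sub>F z in ?F. norm (fst z - x) < e"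
    using 1 assms(1) by (simp add: tendsto_iff dist_norm)
  ultimately show "\<forall>\<^sub>F z in ?F. (case z of (y, t) \<Rightarrow> ereal ((f (y + t *\<^sub>R d) - f y) / t)) =
      (case z of (y, t) \<Rightarrow> ereal ((g (y + t *\<^sub>R d) - g y) / t))"
    by eventually_elim (auto simp: assms(2))
qed

lemma clarke_subdiff_local:
  "0 < e \<Longrightarrow> (\<And>y. norm (y - x) < e \<Longrightarrow> f y = g y) \<Longrightarrow> clarke_subdiff f x = clarke_subdiff g x"
  unfolding clarke_subdiff_def using clarke_dir_deriv_local[of e x f g] by simp

lemma critical_points_iff:
  "x \<in> critical_points f \<longleftrightarrow> (\<forall>d. \<forall>\<rho>>0. \<forall>\<delta>>0. \<exists>z t. norm (z - x) < \<delta> \<and> 0 < t \<and> t < \<delta> \<and>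
     t * - \<rho> < f (z + t *\<^sub>R d) - f z)"
  unfolding critical_points_def clarke_subdiff_def
  using clarke_ge_iff[of 0 f x] by (simp del: mult_minus_right)

text \<open>The direction \<open>s\<close> itself is tested: difference quotients along it are at
  most \<open>L * norm s\<close>, while the subgradient property forces nearly
  \<open>norm s ^ 2\<close>.\<close>

lemma clarke_subdiff_norm_le:
  fixes f :: "'a::euclidean_space \<Rightarrow> real"
  assumes "0 < r" "L-lipschitz_on (cball x r) f" "norm (y - x) < r" "s \<in> clarke_subdiff f y"
  shows "norm s \<le> L"
proof (rule ccontr)
  assume "\<not> norm s \<le> L"
  moreover have "0 \<le> L" using assms(2) by (rule lipschitz_on_nonneg)
  ultimately have s: "L < norm s" "0 < norm s" by auto
  \<comment> \<open>Chosen so that \<open>s \<bullet> s - \<rho>\<close> is exactly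
    \<open>L * norm s\<close>; the next constant keeps both points of the quotient in the
    ball.\<close>
  define \<rho> where "\<rho> = norm s * (norm s - L)"
  define \<delta> where "\<delta> = (r - norm (y - x)) / (1 + norm s)"
  have "0 < \<rho>" using s by (simp add: \<rho>_def)
  moreover have "0 < \<delta>" unfolding \<delta>_def using assms(3) s(2) by (intro divide_pos_pos) linarith+
  moreover have "ereal (s \<bullet> s) \<le> clarke_dir_deriv f y s" using assms(4) by (simp add: clarke_subdiff_def)
  ultimately obtain z t where zt: "norm (z - y) < \<delta>" "0 < t" "t < \<delta>" "t * (s \<bullet> s - \<rho>) < f (z + t *\<^sub>R s) - f z"
    unfolding clarke_ge_iff by blast
  have d: "\<delta> + \<delta> * norm s = r - norm (y - x)"
  proof -
    have "1 + norm s \<noteq> 0" using s(2) by linarith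
    then have "\<delta> * (1 + norm s) = r - norm (y - x)" unfolding \<delta>_def by simp
    then show ?thesis by (simp add: distrib_left)
  qed
  have ts: "t * norm s \<le> \<delta> * norm s" using zt s by (intro mult_right_mono) auto
  have "norm (z - x) \<le> norm (z - y) + norm (y - x)" by (metis norm_triangle_ineq diff_add_cancel add_diff_eq)
  moreover have "norm (z + t *\<^sub>R s - x) \<le> norm (z - x) + t * norm s"
    using norm_triangle_ineq[of "z - x" "t *\<^sub>R s"] zt by (simp add: algebra_simps)
  moreover have "0 \<le> \<delta> * norm s" using s \<open>0 < \<delta>\<close> by simp
  ultimately have "z \<in> cball x r" "z + t *\<^sub>R s \<in> cball x r"
    using zt(1) d ts by (auto simp: dist_norm norm_minus_commute)
  from lipschitz_onD[OF assms(2) this(2,1)] have "f (z + t *\<^sub>R s) - f z \<le> L * (t * norm s)"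
    using zt(2) by (simp add: dist_norm)
  then have "t * (s \<bullet> s - \<rho>) < t * (L * norm s)" using zt(4) by (simp add: algebra_simps)
  moreover have "s \<bullet> s - \<rho> = L * norm s" by (simp add: \<rho>_def dot_square_norm power2_eq_square algebra_simps)
  ultimately show False by simp
qed

text \<open>Noncriticality means a direction with negative generalised derivative at
  \<open>x\<close>. The quotients defining it range over all base points near \<open>x\<close>, so
  the same bound holds at every nearby \<open>y\<close>, with one direction for all.\<close>

lemma noncritical_descent:
  assumes "x \<notin> critical_points f"
  obtains d \<mu> \<delta> where "0 < \<mu>" "0 < \<delta>"
    "\<And>y s. norm (y - x) < \<delta> \<Longrightarrow> s \<in> clarke_subdiff f y \<Longrightarrow> s \<bullet> d \<le> - \<mu>"
proof -
  obtain d \<rho> \<delta> where *: "0 < \<rho>" "0 < \<delta>"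
    "\<And>z t. norm (z - x) < \<delta> \<Longrightarrow> 0 < t \<Longrightarrow> t < \<delta> \<Longrightarrow> f (z + t *\<^sub>R d) - f z \<le> t * - \<rho>"
    using assms unfolding critical_points_iff by (meson not_less)
  show ?thesis
  proof (rule that[of \<rho> "\<delta> / 2" d])
    fix y s assume y: "norm (y - x) < \<delta> / 2" "s \<in> clarke_subdiff f y"
    show "s \<bullet> d \<le> - \<rho>"
    proof (rule ccontr)
      assume "\<not> s \<bullet> d \<le> - \<rho>"
      then have "0 < s \<bullet> d + \<rho>" by simp
      moreover have "ereal (s \<bullet> d) \<le> clarke_dir_deriv f y d" using y by (simp add: clarke_subdiff_def)
      moreover have "0 < \<delta> / 2" using * by simp
      ultimately obtain z t where zt: "norm (z - y) < \<delta> / 2" "0 < t" "t < \<delta> / 2"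
        "t * (s \<bullet> d - (s \<bullet> d + \<rho>)) < f (z + t *\<^sub>R d) - f z"
        unfolding clarke_ge_iff by blast
      have "norm (z - x) \<le> norm (z - y) + norm (y - x)" by (metis norm_triangle_ineq diff_add_cancel add_diff_eq)
      then have "f (z + t *\<^sub>R d) - f z \<le> t * - \<rho>" using * zt y by (intro *(3)) auto
      then show False using zt by simp
    qed
  qed (use * in auto)
qed

lemma closed_critical_points: "closed (critical_points f)"
proof -
  have "open (- critical_points f)"
    unfolding open_contains_ball
  proof
    fix x assume "x \<in> - critical_points f"
    then obtain d \<mu> \<delta> where *: "0 < \<mu>" "0 < \<delta>"
      "\<And>y s. norm (y - x) < \<delta> \<Longrightarrow> s \<in> clarke_subdiff f y \<Longrightarrow> s \<bullet> d \<le> - \<mu>"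
      using noncritical_descent by (metis ComplD)
    \<comment> \<open>A critical point in the ball would give \<open>0 \<le> - \<mu>\<close> through
      the subgradient 0.\<close>
    have "ball x \<delta> \<subseteq> - critical_points f"
      using *(1) *(3)[of _ 0] by (force simp: critical_points_def dist_norm norm_minus_commute)
    then show "\<exists>e>0. ball x e \<subseteq> - critical_points f" using *(2) by blast
  qed
  then show ?thesis by (simp add: closed_def)
qed

context o_min
begin

(* Tameness controls f on balls only, hence the cut-off, with junk value 0 outside the ball. *)

definition loc_definable :: "('a::euclidean_space \<Rightarrow> real) \<Rightarrow> bool" where
  "loc_definable f \<longleftrightarrow> (\<forall>R. definable_fun (\<lambda>x. if norm x \<le> R then f x else 0))"

lemma tame_loc_definable:
  fixes f :: "'a::euclidean_space \<Rightarrow> real"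
  assumes "ordered_basis bs" "tame_function S bs f" "continuous_on UNIV f"
  shows "loc_definable f"
  unfolding loc_definable_def
proof
  fix R
  have "bounded (f ` cball 0 R)"
    by (intro compact_imp_bounded compact_continuous_image continuous_on_subset[OF assms(3)]) auto
  then obtain B where B: "0 < B" "\<And>x. norm x \<le> R \<Longrightarrow> \<bar>f x\<bar> \<le> B"
    unfolding bounded_pos by auto
  \<comment> \<open>The product ball of this radius contains the whole graph of f over
    \<open>cball 0 R\<close>.\<close>
  define r where "r = \<bar>R\<bar> + B"
  have "0 < r" using B by (simp add: r_def)
  let ?c = "\<lambda>(x::'a, t::real). coords bs x @ (\<lambda>t. [t]) t"
  have "?c ` ({(x, t). f x = t} \<inter> cball 0 r) \<in> S DIM('a \<times> real)"
    using assms(2) \<open>0 < r\<close> unfolding tame_function_def tame_set_def by blast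
  moreover have "{(x, t). f x = t} \<inter> cball 0 r = {z. f (fst z) = snd z \<and> norm z \<le> r}" by auto
  ultimately have graph: "definable (\<lambda>z. f (fst z) = snd z \<and> norm z \<le> r)"
    using definableI_chart[OF chart_Pair[OF chart_coords[OF assms(1)] chart_real]] by simp
  have "definable (\<lambda>z. norm (fst z) \<le> R \<and> (f (fst z) = snd z \<and> norm z \<le> r) \<or>
      \<not> norm (fst z) \<le> R \<and> snd z = 0)"
    by (rule definable_disj[OF definable_conj[OF _ graph]]) (intro definable_intros)+
  moreover have "(norm (fst z) \<le> R \<and> (f (fst z) = snd z \<and> norm z \<le> r) \<or>
      \<not> norm (fst z) \<le> R \<and> snd z = 0) \<longleftrightarrow> snd z = (if norm (fst z) \<le> R then f (fst z) else 0)" for z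
  proof -
    have "norm z \<le> r" if "norm (fst z) \<le> R" "f (fst z) = snd z"
      using norm_Pair_le[of "fst z" "snd z"] B(2)[OF that(1)] that by (auto simp: r_def)
    then show ?thesis by auto
  qed
  ultimately show "definable_fun (\<lambda>x. if norm x \<le> R then f x else 0)"
    unfolding definable_fun_def by simp
qed

lemma slow_curve_near_0:
  fixes u :: "real \<Rightarrow> 'a::euclidean_space"
  assumes u: "definable_fun u" and bound: "\<forall>\<^sub>F r in at_right 0. norm (u r) \<le> B" and "0 < \<epsilon>"
  shows "\<exists>r1>0. \<forall>s r. 0 < s \<and> s \<le> r \<and> r < r1 \<longrightarrow> norm (u r - u s) \<le> \<epsilon> * (r - s) / s"
proof -
  define e where "e = \<epsilon> / DIM('a)"
  have "0 < e" using \<open>0 < \<epsilon>\<close> by (simp add: e_def)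
  let ?Q = "\<lambda>b r1. \<forall>s r. 0 < s \<and> s \<le> r \<and> r < r1 \<longrightarrow> \<bar>(u r - u s) \<bullet> b\<bar> \<le> e * (r - s) / s"
  have "\<forall>\<^sub>F r1 in at_right 0. ?Q b r1" if b: "b \<in> Basis" for b
  proof -
    have bb: "\<forall>\<^sub>F r in at_right 0. \<bar>u r \<bullet> b\<bar> \<le> B"
      using bound by eventually_elim (use Basis_le_norm[OF b] order_trans in blast)
    have d: "definable_fun (\<lambda>r. u r \<bullet> b)" by (intro definable_fun_inner_const u)
    obtain r1 where r1: "0 < r1" "\<And>s r. 0 < s \<Longrightarrow> s \<le> r \<Longrightarrow> r < r1 \<Longrightarrow> u r \<bullet> b - u s \<bullet> b \<le> e * (r - s) / s"
      using slope_bound_near_0[OF d bb \<open>0 < e\<close>] by blast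
    have bb': "\<forall>\<^sub>F r in at_right 0. \<bar>- (u r \<bullet> b)\<bar> \<le> B" using bb by simp
    obtain r2 where r2: "0 < r2" "\<And>s r. 0 < s \<Longrightarrow> s \<le> r \<Longrightarrow> r < r2 \<Longrightarrow> - (u r \<bullet> b) - - (u s \<bullet> b) \<le> e * (r - s) / s"
      using slope_bound_near_0[OF definable_fun_minus[OF d] bb' \<open>0 < e\<close>] by blast
    have "?Q b t" if "t < min r1 r2" for t
    proof (intro allI impI)
      fix s r assume sr: "0 < s \<and> s \<le> r \<and> r < t"
      show "\<bar>(u r - u s) \<bullet> b\<bar> \<le> e * (r - s) / s"
        using r1(2)[of s r] r2(2)[of s r] sr that by (auto simp: inner_diff_left abs_le_iff)
    qed
    then show ?thesis unfolding eventually_at_right_field using r1(1) r2(1)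
      by (intro exI[of _ "min r1 r2"]) auto
  qed
  then have "\<forall>\<^sub>F r1 in at_right 0. \<forall>b\<in>Basis. ?Q b r1"
    by (intro eventually_ball_finite) auto
  then obtain c where c: "0 < c" "\<And>t. 0 < t \<Longrightarrow> t < c \<Longrightarrow> \<forall>b\<in>Basis. ?Q b t"
    unfolding eventually_at_right_field by auto
  show ?thesis
  proof (intro exI[of _ "c / 2"] conjI allI impI)
    fix s r assume sr: "0 < s \<and> s \<le> r \<and> r < c / 2"
    have "norm (u r - u s) \<le> (\<Sum>b\<in>Basis. \<bar>(u r - u s) \<bullet> b\<bar>)" by (rule norm_le_l1)
    also have "\<dots> \<le> (\<Sum>b\<in>(Basis::'a set). e * (r - s) / s)"
    proof (rule sum_mono)
      fix b :: 'a assume "b \<in> Basis"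
      then show "\<bar>(u r - u s) \<bullet> b\<bar> \<le> e * (r - s) / s" using c(2)[of "c / 2"] c(1) sr by auto
    qed
    also have "\<dots> = \<epsilon> * (r - s) / s" by (simp add: e_def)
    finally show "norm (u r - u s) \<le> \<epsilon> * (r - s) / s" .
  qed (use c in auto)
qed

end

section \<open>Semismoothness from above and finiteness of critical values\<close>

context o_min
begin

text \<open>A failure is first freed of subgradients: if \<open>s\<close> at \<open>y\<close>
  violates the claim, then from some nearby \<open>z\<close> a short step towards \<open>x\<close>
  raises f too much, which is \<open>bad z\<close>. Along a definable curve of bad points such a
  step stays on a ray through \<open>x\<close>; since the direction \<open>u\<close> turns slowly,
  its end may be replaced by the curve point at the smaller radius. Each step makes
  \<open>(f (w r) - f x) / r\<close> gain at least \<open>\<eta> / 2\<close> times the decrease of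
  \<open>ln r\<close>, until the Lipschitz bound is exceeded.\<close>

lemma upper_semismooth:
  fixes f :: "'a::euclidean_space \<Rightarrow> real"
  assumes lip: "locally_lipschitz f" and def: "loc_definable f" and "0 < \<eta>"
  shows "\<exists>r>0. \<forall>y s. norm (y - x) < r \<and> s \<in> clarke_subdiff f y \<longrightarrow>
           f y - f x \<le> s \<bullet> (y - x) + \<eta> * norm (y - x)"
proof (rule ccontr)
  assume "\<not> ?thesis"
  then have fail: "\<exists>y s. norm (y - x) < r \<and> s \<in> clarke_subdiff f y \<and>
      s \<bullet> (y - x) + \<eta> * norm (y - x) < f y - f x" if "0 < r" for r
    using that by (meson not_less)
  obtain \<rho> L where \<rho>: "0 < \<rho>" "0 < L" and L: "L-lipschitz_on (cball x \<rho>) f"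
    using lip unfolding locally_lipschitz_def by blast
  have lipf: "\<bar>f y - f z\<bar> \<le> L * norm (y - z)" if "norm (y - x) \<le> \<rho>" "norm (z - x) \<le> \<rho>" for y z
    using lipschitz_onD[OF L, of y z] that by (simp add: dist_norm norm_minus_commute)
  define g where "g y = (if norm y \<le> norm x + \<rho> then f y else 0)" for y
  have defg: "definable_fun g" using def unfolding g_def loc_definable_def by blast
  have gf: "g y = f y" if "norm (y - x) \<le> \<rho>" for y
    using norm_triangle_sub[of y x] that by (simp add: g_def)
  \<comment> \<open>Moving the fraction \<open>h\<close> of the way to \<open>x\<close> gains more
    than the share \<open>h\<close> of \<open>f x - f w\<close>, by \<open>h * \<eta>\<close> times
    the distance. With \<open>h\<close> at most one half, the new radius is at least half of the old
    one.\<close>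
  define bad where "bad w \<longleftrightarrow> (\<exists>h. 0 < h \<and> 2 * h \<le> 1 \<and>
      h * (f x - g w + \<eta> * norm (w - x)) < g (w + h *\<^sub>R (x - w)) - g w)" for w
  define rel where "rel r u \<longleftrightarrow> norm u = 1 \<and> bad (x + r *\<^sub>R u)" for r u
  have defbad: "definable bad"
    unfolding bad_def by (intro definable_intros definable_fun_comp[OF defg])
  have defrel: "definable (\<lambda>z. rel (fst z) (snd z))"
    unfolding rel_def by (intro definable_intros definable_subst[OF defbad])
  have frequent: "\<exists>r u. 0 < r \<and> r < \<delta> \<and> rel r u" if "0 < \<delta>" for \<delta>
  proof -
    define \<delta>1 where "\<delta>1 = min \<delta> (\<rho> / 4)"
    have "0 < \<delta>1" using that \<rho> by (simp add: \<delta>1_def)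
    then obtain y s where ys: "norm (y - x) < \<delta>1" "s \<in> clarke_subdiff f y"
      "s \<bullet> (y - x) + \<eta> * norm (y - x) < f y - f x" using fail by blast
    then have "y \<noteq> x" by auto
    define q where "q = f x - f y + \<eta> * norm (y - x)"
    define \<sigma> where "\<sigma> = s \<bullet> (x - y) - q"
    have "0 < \<sigma>" using ys(3) by (simp add: \<sigma>_def q_def inner_diff_right)
    \<comment> \<open>The point \<open>z\<close> will be within \<open>\<delta>2\<close> of
      \<open>y\<close>. The errors in the base value, in the direction and in the distance to
      \<open>x\<close> total \<open>(2 * L + \<eta>) * \<delta>2\<close>, at most half of the
      violation \<open>\<sigma>\<close>; the other bounds keep \<open>z\<close> off \<open>x\<close>
      and within \<open>\<delta>1\<close> of it.\<close>
    define \<delta>2 where "\<delta>2 = min (min (\<sigma> / (2 * (2 * L + \<eta>))) (1 / 2)) (min (norm (y - x)) (\<delta>1 - norm (y - x)))"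
    have "0 < \<delta>2" using \<open>0 < \<sigma>\<close> \<rho>(2) \<open>0 < \<eta>\<close> ys(1) \<open>y \<noteq> x\<close> by (auto simp: \<delta>2_def)
    have \<delta>2: "\<delta>2 \<le> 1 / 2" "\<delta>2 \<le> norm (y - x)" "\<delta>2 \<le> \<delta>1 - norm (y - x)" "(2 * L + \<eta>) * \<delta>2 \<le> \<sigma> / 2"
    proof -
      have "\<delta>2 \<le> \<sigma> / (2 * (2 * L + \<eta>))" by (simp add: \<delta>2_def)
      moreover have "0 < 2 * L + \<eta>" using \<rho>(2) \<open>0 < \<eta>\<close> by simp
      ultimately show "(2 * L + \<eta>) * \<delta>2 \<le> \<sigma> / 2" by (simp add: field_simps)
    qed (unfold \<delta>2_def, linarith+)
    have "ereal (s \<bullet> (x - y)) \<le> clarke_dir_deriv f y (x - y)"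
      using ys(2) unfolding clarke_subdiff_def by blast
    moreover have "0 < \<sigma> / 2" using \<open>0 < \<sigma>\<close> by simp
    ultimately obtain z t where zt: "norm (z - y) < \<delta>2" "0 < t" "t < \<delta>2"
      "t * (s \<bullet> (x - y) - \<sigma> / 2) < f (z + t *\<^sub>R (x - y)) - f z"
      unfolding clarke_ge_iff using \<open>0 < \<delta>2\<close> by blast
    have tri: "norm (z - x) \<le> norm (z - y) + norm (y - x)" "norm (y - x) \<le> norm (z - y) + norm (z - x)"
      using norm_triangle_ineq[of "z - y" "y - x"] norm_triangle_ineq[of "y - z" "z - x"]
      by (auto simp: norm_minus_commute)
    have zx: "norm (z - x) < \<delta>1" "z \<noteq> x" using tri zt(1) \<delta>2 by auto
    have t1: "t \<le> 1" using zt(3) \<delta>2(1) by simp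
    have in1: "norm (z + t *\<^sub>R (x - z) - x) \<le> \<rho>"
    proof -
      have "z + t *\<^sub>R (x - z) - x = (1 - t) *\<^sub>R (z - x)" by (simp add: algebra_simps)
      then have "norm (z + t *\<^sub>R (x - z) - x) = (1 - t) * norm (z - x)" using t1 by simp
      also have "\<dots> \<le> norm (z - x)" using zt(2) by (simp add: mult_left_le_one_le t1)
      finally show ?thesis using zx(1) \<rho> by (simp add: \<delta>1_def)
    qed
    have in2: "norm (z + t *\<^sub>R (x - y) - x) \<le> \<rho>"
    proof -
      have eq: "z + t *\<^sub>R (x - y) - x = (z - x) + t *\<^sub>R (x - y)" by simp
      have "norm (z + t *\<^sub>R (x - y) - x) \<le> norm (z - x) + t * norm (x - y)"
        unfolding eq using norm_triangle_ineq[of "z - x" "t *\<^sub>R (x - y)"] zt(2) by simp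
      also have "\<dots> \<le> norm (z - x) + norm (y - x)"
        using zt(2) t1 by (simp add: norm_minus_commute mult_left_le_one_le)
      finally show ?thesis using zx(1) ys(1) \<rho> by (simp add: \<delta>1_def)
    qed
    have in3: "norm (z - x) \<le> \<rho>" "norm (y - x) \<le> \<rho>" using zx(1) ys(1) \<rho> by (auto simp: \<delta>1_def)
    \<comment> \<open>The Clarke quotient moves along \<open>x - y\<close>, the definition of
      \<open>bad\<close> along \<open>x - z\<close>; the Lipschitz bound pays for the
      exchange.\<close>
    have "norm (z + t *\<^sub>R (x - y) - (z + t *\<^sub>R (x - z))) = t * norm (z - y)"
      using zt(2) by (simp flip: scaleR_diff_right)
    then have "f (z + t *\<^sub>R (x - y)) - f (z + t *\<^sub>R (x - z)) \<le> L * (t * norm (z - y))"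
      using lipf[OF in2 in1] by simp
    moreover have "L * (t * norm (z - y)) \<le> t * (L * \<delta>2)" using zt \<rho>(2) by simp
    ultimately have A: "t * (s \<bullet> (x - y) - \<sigma> / 2) - t * (L * \<delta>2) < f (z + t *\<^sub>R (x - z)) - f z"
      using zt(4) by linarith
    have "f y - f z \<le> L * norm (z - y)"
      using lipf[OF in3(2,1)] by (simp add: norm_minus_commute)
    also have "\<dots> \<le> L * \<delta>2" using zt(1) \<rho>(2) by simp
    finally have "f y - f z \<le> L * \<delta>2" .
    moreover have "\<eta> * norm (z - x) \<le> \<eta> * (norm (y - x) + \<delta>2)"
      using tri(1) zt(1) \<open>0 < \<eta>\<close> by (intro mult_left_mono) auto
    ultimately have "f x - f z + \<eta> * norm (z - x) \<le> q + (L + \<eta>) * \<delta>2"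
      by (simp add: q_def algebra_simps)
    also have "\<dots> \<le> s \<bullet> (x - y) - \<sigma> / 2 - L * \<delta>2"
    proof -
      have "(2 * L + \<eta>) * \<delta>2 = (L + \<eta>) * \<delta>2 + L * \<delta>2" by (simp add: algebra_simps)
      moreover have "s \<bullet> (x - y) = q + \<sigma>" by (simp add: \<sigma>_def)
      ultimately show ?thesis using \<delta>2(4) by linarith
    qed
    finally have "t * (f x - f z + \<eta> * norm (z - x)) \<le> t * (s \<bullet> (x - y) - \<sigma> / 2 - L * \<delta>2)"
      using zt(2) by simp
    then have "t * (f x - f z + \<eta> * norm (z - x)) < f (z + t *\<^sub>R (x - z)) - f z"
      using A by (simp add: algebra_simps)
    then have "bad z"
      unfolding bad_def using zt \<delta>2(1) gf[OF in1] gf[OF in3(1)] by (intro exI[of _ t]) auto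
    define r where "r = norm (z - x)"
    have "rel r ((z - x) /\<^sub>R r)" using \<open>bad z\<close> zx(2) by (simp add: rel_def r_def)
    moreover have "0 < r" "r < \<delta>" using zx by (auto simp: r_def \<delta>1_def)
    ultimately show ?thesis by blast
  qed
  \<comment> \<open>Bad directions exist at arbitrarily small radii, hence by the germ alternative
    at all small radii, and definable choice selects one of them.\<close>
  have "definable (\<lambda>r. \<exists>u. rel r u)" by (intro definable_intros defrel)
  from definable_germ[OF this, of 0]
  have ev: "\<forall>\<^sub>F r in at_right 0. \<exists>u. rel r u"
    unfolding eventually_at_right_field using frequent by blast
  obtain u where u: "definable_fun u" "\<And>r v. rel r v \<Longrightarrow> rel r (u r)"
    using definable_choice[OF defrel, of 1] unfolding rel_def by force
  have evu: "\<forall>\<^sub>F r in at_right 0. rel r (u r)"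
    using ev by eventually_elim (use u(2) in blast)
  then have "\<forall>\<^sub>F r in at_right 0. norm (u r) \<le> 1" by eventually_elim (simp add: rel_def)
  \<comment> \<open>At this rate the turning of \<open>u\<close> costs
    \<open>\<eta> / 2 * (r - r')\<close>, half of the excess gained by a bad step.\<close>
  moreover define \<epsilon> where "\<epsilon> = \<eta> / (2 * L)"
  moreover have "0 < \<epsilon>" using \<rho> \<open>0 < \<eta>\<close> by (simp add: \<epsilon>_def)
  ultimately obtain r1 where r1: "0 < r1"
    "\<And>s r. 0 < s \<Longrightarrow> s \<le> r \<Longrightarrow> r < r1 \<Longrightarrow> norm (u r - u s) \<le> \<epsilon> * (r - s) / s"
    using slow_curve_near_0[OF u(1)] by metis
  obtain r2 where r2: "0 < r2" "\<And>r. 0 < r \<Longrightarrow> r < r2 \<Longrightarrow> rel r (u r)"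
    using evu unfolding eventually_at_right_field by auto
  define r0 where "r0 = min (min r1 r2) \<rho> / 2"
  have r0: "0 < r0" "r0 < r1" "r0 < r2" "r0 \<le> \<rho>" using r1 r2 \<rho> by (auto simp: r0_def)
  define w where "w r = x + r *\<^sub>R u r" for r
  have wx: "norm (w r - x) = r" if "0 < r" "r \<le> r0" for r
    using r2(2)[of r] that r0 by (simp add: w_def rel_def)
  define \<Phi> where "\<Phi> r = (f (w r) - f x) / r + \<eta> / 2 * ln r" for r
  have step: "\<exists>r'. r / 2 \<le> r' \<and> r' < r \<and> \<Phi> r \<le> \<Phi> r'" if r: "0 < r" "r \<le> r0" for r
  proof -
    have "rel r (u r)" using r r0 by (intro r2(2)) auto
    then have nu: "norm (u r) = 1" and "bad (w r)" by (auto simp: rel_def w_def)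
    then obtain h where h: "0 < h" "2 * h \<le> 1"
      "h * (f x - g (w r) + \<eta> * norm (w r - x)) < g (w r + h *\<^sub>R (x - w r)) - g (w r)"
      unfolding bad_def by blast
    define r' where "r' = (1 - h) * r"
    have "0 < h * r" "2 * (h * r) \<le> r" "r' = r - h * r"
      using h r mult_right_mono[OF h(2), of r] by (auto simp: r'_def algebra_simps)
    then have r': "0 < r'" "r / 2 \<le> r'" "r' < r" "r' \<le> r0" "r - r' = h * r"
      using r by linarith+
    have eq: "w r + h *\<^sub>R (x - w r) = x + r' *\<^sub>R u r"
      by (simp add: w_def r'_def algebra_simps)
    have in1: "norm (w r - x) \<le> \<rho>" "norm (w r' - x) \<le> \<rho>" "norm (x + r' *\<^sub>R u r - x) \<le> \<rho>"
      using wx[OF r] wx[OF r'(1,4)] r r' r0 nu by auto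
    have "h * (f x - f (w r) + \<eta> * r) < f (x + r' *\<^sub>R u r) - f (w r)"
      using h(3) gf[OF in1(1)] gf[OF in1(3)] wx[OF r] by (simp add: eq)
    moreover have "f (x + r' *\<^sub>R u r) - f (w r') \<le> \<eta> / 2 * (h * r)"
    proof -
      have "x + r' *\<^sub>R u r - w r' = r' *\<^sub>R (u r - u r')" by (simp add: w_def algebra_simps)
      then have "f (x + r' *\<^sub>R u r) - f (w r') \<le> L * (r' * norm (u r - u r'))"
        using lipf[OF in1(3,2)] r'(1) by simp
      also have "\<dots> \<le> L * (r' * (\<epsilon> * (r - r') / r'))"
        using r1(2)[of r' r] r r' r0 \<rho>(2) by (intro mult_left_mono) auto
      also have "\<dots> = \<eta> / 2 * (h * r)"
        using r' \<rho>(2) by (simp add: \<epsilon>_def)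
      finally show ?thesis .
    qed
    ultimately have "(1 - h) * (f (w r) - f x) + \<eta> / 2 * (h * r) \<le> f (w r') - f x"
      by (simp add: algebra_simps)
    then have "((1 - h) * (f (w r) - f x) + \<eta> / 2 * (h * r)) / r' \<le> (f (w r') - f x) / r'"
      using r'(1) by (simp add: divide_right_mono)
    moreover have "((1 - h) * (f (w r) - f x) + \<eta> / 2 * (h * r)) / r'
        = (f (w r) - f x) / r + \<eta> / 2 * ((r - r') / r')"
      using r r' h unfolding r'(5) by (simp add: add_divide_distrib r'_def)
    moreover have "ln r - ln r' \<le> (r - r') / r'"
    proof -
      have "ln r - ln r' = ln (r / r')" using r r' by (simp add: ln_div)
      also have "\<dots> \<le> r / r' - 1" using r r' by (intro ln_le_minus_one) auto
      finally show ?thesis using r'(1) by (simp add: diff_divide_distrib)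
    qed
    then have "\<eta> / 2 * (ln r - ln r') \<le> \<eta> / 2 * ((r - r') / r')" using \<open>0 < \<eta>\<close> by (intro mult_left_mono) auto
    moreover have "\<eta> / 2 * (ln r - ln r') = \<eta> / 2 * ln r - \<eta> / 2 * ln r'" by (rule right_diff_distrib)
    ultimately have "\<Phi> r \<le> \<Phi> r'" unfolding \<Phi>_def by linarith
    then show ?thesis using r' by blast
  qed
  \<comment> \<open>From \<open>r0\<close> down to \<open>s\<close> the logarithm falls by
    \<open>6 * L / \<eta>\<close>, so the quotient would have to rise by \<open>3 * L\<close>,
    although its absolute value is at most \<open>L\<close>.\<close>
  define s where "s = r0 * exp (- (6 * L / \<eta>))"
  have s: "0 < s" "s \<le> r0" using r0 \<rho> \<open>0 < \<eta>\<close> by (auto simp: s_def)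
  \<comment> \<open>The interval extends to \<open>s / 2\<close> because a step may halve the
    radius: from a minimum above \<open>s\<close> the next radius is still inside.\<close>
  let ?K = "{t \<in> {s / 2..r0}. \<Phi> r0 \<le> \<Phi> t}"
  have contu: "continuous_on {s / 2..r0} u"
  proof (rule lipschitz_on_continuous_on[of "\<epsilon> / (s / 2)"], rule lipschitz_on_leI)
    fix a b assume ab: "a \<in> {s / 2..r0}" "b \<in> {s / 2..r0}" "a \<le> b"
    have "norm (u b - u a) \<le> \<epsilon> * (b - a) / a" using ab s r0 by (intro r1(2)) auto
    also have "\<dots> \<le> \<epsilon> * (b - a) / (s / 2)"
      using ab s \<open>0 < \<epsilon>\<close> by (intro divide_left_mono mult_nonneg_nonneg mult_pos_pos) auto
    finally show "dist (u a) (u b) \<le> \<epsilon> / (s / 2) * dist a b"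
      using ab by (simp add: dist_norm norm_minus_commute mult_ac)
  qed (use s \<open>0 < \<epsilon>\<close> in auto)
  have contf: "continuous_on (cball x \<rho>) f" using L by (rule lipschitz_on_continuous_on)
  have "continuous_on {s / 2..r0} (\<lambda>r. f (w r))"
  proof (rule continuous_on_compose2[OF contf])
    show "continuous_on {s / 2..r0} w" unfolding w_def by (intro continuous_intros contu)
    show "w ` {s / 2..r0} \<subseteq> cball x \<rho>"
      using wx r0 s by (force simp: dist_norm norm_minus_commute)
  qed
  then have "continuous_on {s / 2..r0} \<Phi>"
    unfolding \<Phi>_def using s by (intro continuous_intros) auto
  then have "closed ?K" by (intro continuous_on_closed_Collect_le continuous_on_const) auto
  then have "compact ?K" by (metis (no_types, lifting) bounded_closed_interval bounded_subset
      compact_eq_bounded_closed mem_Collect_eq subsetI)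
  moreover have "r0 \<in> ?K" using s by auto
  ultimately obtain m where m: "m \<in> ?K" "\<And>t. t \<in> ?K \<Longrightarrow> m \<le> t"
    using compact_attains_inf[of ?K] by blast
  have "m \<le> s"
  proof (rule ccontr)
    assume "\<not> m \<le> s"
    then obtain r' where "m / 2 \<le> r'" "r' < m" "\<Phi> m \<le> \<Phi> r'" using step[of m] m(1) s by auto
    then have "r' \<in> ?K" using m(1) \<open>\<not> m \<le> s\<close> by auto
    then show False using m(2) \<open>r' < m\<close> by force
  qed
  have bound: "\<bar>(f (w r) - f x) / r\<bar> \<le> L" if "0 < r" "r \<le> r0" for r
    using lipf[of "w r" x] wx[OF that] that r0 \<rho> by (simp add: field_simps)
  have "ln m \<le> ln r0 - 6 * L / \<eta>"
  proof -
    have "ln m \<le> ln s" using \<open>m \<le> s\<close> m(1) s by auto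
    then show ?thesis using r0 by (simp add: s_def ln_mult)
  qed
  then have "\<eta> / 2 * ln m \<le> \<eta> / 2 * (ln r0 - 6 * L / \<eta>)" using \<open>0 < \<eta>\<close> by (intro mult_left_mono) auto
  also have "\<dots> = \<eta> / 2 * ln r0 - 3 * L" using \<open>0 < \<eta>\<close> by (simp add: algebra_simps)
  finally have "\<eta> / 2 * ln m \<le> \<eta> / 2 * ln r0 - 3 * L" .
  moreover have "\<Phi> r0 \<le> \<Phi> m" using m(1) by simp
  moreover have "\<bar>(f (w r0) - f x) / r0\<bar> \<le> L" "\<bar>(f (w m) - f x) / m\<bar> \<le> L"
    using bound[of r0] bound[of m] m(1) s by auto
  ultimately show False using \<rho>(2) unfolding \<Phi>_def by linarith
qed

text \<open>Infinitely many points of infinite right slope would fill an interval, and \<phi> is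
  continuous on a smaller one. There every small step gains more than any prescribed slope, and
  creeping contradicts the actual increment.\<close>

lemma finite_vertical_slope:
  fixes \<phi> :: "real \<Rightarrow> real"
  assumes \<phi>: "definable_fun \<phi>"
  shows "finite {t. \<not> (\<exists>M. \<forall>\<^sub>F h in at_right 0. \<phi> (t + h) - \<phi> t \<le> M * h)}"
proof (rule ccontr)
  let ?A = "\<lambda>t. \<forall>M. \<exists>d. 0 < d \<and> (\<forall>h. 0 < h \<and> h < d \<longrightarrow> M * h < \<phi> (t + h) - \<phi> t)"
  assume inf: "infinite {t. \<not> (\<exists>M. \<forall>\<^sub>F h in at_right 0. \<phi> (t + h) - \<phi> t \<le> M * h)}"
  have "?A t" if "\<not> (\<exists>M. \<forall>\<^sub>F h in at_right 0. \<phi> (t + h) - \<phi> t \<le> M * h)" for t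
  proof
    fix M
    have "(\<forall>\<^sub>F h in at_right 0. \<phi> (t + h) - \<phi> t \<le> M * h) \<or> (\<forall>\<^sub>F h in at_right 0. \<not> \<phi> (t + h) - \<phi> t \<le> M * h)"
      by (rule definable_germ) (intro definable_intros definable_fun_comp[OF \<phi>])
    then show "\<exists>d. 0 < d \<and> (\<forall>h. 0 < h \<and> h < d \<longrightarrow> M * h < \<phi> (t + h) - \<phi> t)"
      using that unfolding eventually_at_right_field not_le by blast
  qed
  then have infA: "infinite {t. ?A t}" by (intro infinite_super[OF _ inf] Collect_mono impI)
  have "definable ?A" by (intro definable_intros definable_fun_comp[OF \<phi>])
  from definable_infinite_interval[OF this infA]
  obtain a b where ab: "a < b" "\<And>t. a < t \<Longrightarrow> t < b \<Longrightarrow> ?A t" by blast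
  have "\<forall>\<^sub>F t in at_right a. t \<notin> {p. \<not> isCont \<phi> p}"
    by (rule eventually_at_right_notin_finite[OF finite_not_continuous[OF \<phi>]])
  then obtain c where c: "a < c" "\<And>t. a < t \<Longrightarrow> t < c \<Longrightarrow> isCont \<phi> t"
    unfolding eventually_at_right_field by auto
  define e where "e = min b c"
  define p where "p = (2 * a + e) / 3"
  define q where "q = (a + 2 * e) / 3"
  have pq: "a < p" "p < q" "q < b" "q < c" using ab(1) c(1) by (auto simp: p_def q_def e_def)
  have cont: "continuous_on {p..q} \<phi>"
    using pq by (intro continuous_at_imp_continuous_on) (auto intro!: c)
  \<comment> \<open>This slope would force an increment from \<open>p\<close> to \<open>q\<close>
    that is larger by 1 than the true one.\<close>
  define M where "M = (\<phi> q - \<phi> p + 1) / (q - p)"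
  have "\<phi> p - M * p \<le> \<phi> q - M * q"
  proof (rule creeping[where \<phi> = "\<lambda>t. \<phi> t - M * t" and a = p and b = q])
    show "continuous_on {p..q} (\<lambda>t. \<phi> t - M * t)" by (intro continuous_intros cont)
    fix t assume t: "p \<le> t" "t < q"
    obtain d where d: "0 < d" "\<forall>h. 0 < h \<and> h < d \<longrightarrow> M * h < \<phi> (t + h) - \<phi> t"
      using ab(2)[of t] t pq by auto
    define h where "h = min (d / 2) (q - t)"
    have h: "0 < h" "h < d" "t + h \<le> q" using d(1) t by (auto simp: h_def)
    then have "M * h < \<phi> (t + h) - \<phi> t" using d(2) by blast
    then show "\<exists>t'. t < t' \<and> t' \<le> q \<and> \<phi> t - M * t \<le> \<phi> t' - M * t'"
      using h by (intro exI[of _ "t + h"]) (auto simp: algebra_simps)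
  qed (use pq in auto)
  moreover have "M * (q - p) = \<phi> q - \<phi> p + 1" using pq by (simp add: M_def)
  ultimately show False by (simp add: algebra_simps)
qed

text \<open>At all but finitely many \<open>t\<close> the curve of critical points has bounded right
  slope, \<open>norm (\<gamma> (t + h) - \<gamma> t) \<le> N * h\<close> for small \<open>h\<close>.
  Semismoothness centred at \<open>\<gamma> t\<close>, with the zero subgradient at
  \<open>\<gamma> (t + h)\<close>, then bounds the increment \<open>h\<close> of f by
  \<open>h / 2\<close>.\<close>

lemma finite_critical_values:
  fixes f :: "'a::euclidean_space \<Rightarrow> real"
  assumes lip: "locally_lipschitz f" and def: "loc_definable f"
  shows "finite (f ` (critical_points f \<inter> ball 0 R))"
proof (rule ccontr)
  assume inf: "infinite (f ` (critical_points f \<inter> ball 0 R))"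
  define g where "g y = (if norm y \<le> R then f y else 0)" for y
  have defg: "definable_fun g" using def unfolding g_def loc_definable_def by blast
  have crit: "x \<in> critical_points f \<longleftrightarrow> x \<in> critical_points g" if "norm x < R" for x
  proof -
    have "f y = g y" if "norm (y - x) < R - norm x" for y
      using norm_triangle_sub[of y x] that by (simp add: g_def)
    then have "clarke_subdiff f x = clarke_subdiff g x"
      using that by (intro clarke_subdiff_local[of "R - norm x"]) auto
    then show ?thesis by (simp add: critical_points_def)
  qed
  define C where "C v x \<longleftrightarrow> norm x < R \<and> x \<in> critical_points g \<and> g x = v" for v x
  have defC: "definable (\<lambda>z. C (fst z) (snd z))"
    unfolding C_def critical_points_iff by (intro definable_intros definable_fun_comp[OF defg])
  have "f ` (critical_points f \<inter> ball 0 R) = {v. \<exists>x. C v x}"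
    using crit by (force simp: C_def g_def)
  then have infC: "infinite {v. \<exists>x. C v x}" using inf by simp
  have "definable (\<lambda>v. \<exists>x. C v x)" by (intro definable_intros defC)
  from definable_infinite_interval[OF this infC]
  obtain a b where ab: "a < b" "\<And>v. a < v \<Longrightarrow> v < b \<Longrightarrow> \<exists>x. C v x" by blast
  have "\<exists>g. definable_fun g \<and> (\<forall>v x. C v x \<longrightarrow> C v (g v))"
    by (rule definable_choice[OF defC, of R]) (simp add: C_def)
  then obtain \<gamma> where \<gamma>: "definable_fun \<gamma>" "\<And>v x. C v x \<Longrightarrow> C v (\<gamma> v)" by blast
  have C\<gamma>: "C v (\<gamma> v)" if "a < v" "v < b" for v using ab(2)[OF that] \<gamma>(2) by blast
  have f\<gamma>: "f (\<gamma> v) = v" "\<gamma> v \<in> critical_points f" if "a < v" "v < b" for v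
    using C\<gamma>[OF that] crit by (auto simp: C_def g_def)
  \<comment> \<open>Used for every coordinate and its negative, so that the slope is bounded from
    both sides outside a finite set.\<close>
  let ?V = "\<lambda>\<phi>. {t. \<not> (\<exists>M. \<forall>\<^sub>F h in at_right 0. \<phi> (t + h) - \<phi> t \<le> M * h)}"
  have "finite (\<Union>b\<in>Basis. ?V (\<lambda>t. \<gamma> t \<bullet> b) \<union> ?V (\<lambda>t. - (\<gamma> t \<bullet> b)))"
    by (intro finite_UN_I finite_UnI finite_vertical_slope definable_intros \<gamma>(1)) auto
  from eventually_happens[OF eventually_conj[OF eventually_at_right_notin_finite[OF this, of a]
        eventually_at_rightI[of a b "\<lambda>t. a < t \<and> t < b"]]]
  obtain t where t: "t \<notin> (\<Union>b\<in>Basis. ?V (\<lambda>t. \<gamma> t \<bullet> b) \<union> ?V (\<lambda>t. - (\<gamma> t \<bullet> b)))" "a < t" "t < b"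
    using ab(1) by auto
  have "\<exists>M. \<forall>\<^sub>F h in at_right 0. \<bar>(\<gamma> (t + h) - \<gamma> t) \<bullet> b\<bar> \<le> M * h" if "b \<in> Basis" for b
  proof -
    have "t \<notin> ?V (\<lambda>t. \<gamma> t \<bullet> b) \<union> ?V (\<lambda>t. - (\<gamma> t \<bullet> b))"
      by (rule contra_subsetD[OF _ t(1)]) (use that in \<open>rule UN_upper\<close>)
    then obtain M1 M2 where M: "\<forall>\<^sub>F h in at_right 0. \<gamma> (t + h) \<bullet> b - \<gamma> t \<bullet> b \<le> M1 * h"
      "\<forall>\<^sub>F h in at_right 0. - (\<gamma> (t + h) \<bullet> b) - - (\<gamma> t \<bullet> b) \<le> M2 * h"
      unfolding Un_iff mem_Collect_eq by blast
    define K where "K = max M1 M2"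
    have K: "M1 \<le> K" "M2 \<le> K" by (auto simp: K_def)
    have "\<forall>\<^sub>F h in at_right (0::real). 0 < h" by (simp add: eventually_at_right_less)
    with M have "\<forall>\<^sub>F h in at_right 0. \<bar>(\<gamma> (t + h) - \<gamma> t) \<bullet> b\<bar> \<le> K * h"
    proof eventually_elim
      case (elim h)
      have "M1 * h \<le> K * h" "M2 * h \<le> K * h" using elim K by (auto intro!: mult_right_mono)
      then show ?case using elim unfolding inner_diff_left by linarith
    qed
    then show ?thesis by blast
  qed
  then obtain M where M: "\<And>b. b \<in> Basis \<Longrightarrow> \<forall>\<^sub>F h in at_right 0. \<bar>(\<gamma> (t + h) - \<gamma> t) \<bullet> b\<bar> \<le> M b * h"
    by metis
  define N where "N = (\<Sum>b\<in>(Basis::'a set). M b)"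
  have "\<forall>\<^sub>F h in at_right 0. \<forall>b\<in>Basis. \<bar>(\<gamma> (t + h) - \<gamma> t) \<bullet> b\<bar> \<le> M b * h"
    using M by (intro eventually_ball_finite) auto
  then have slope: "\<forall>\<^sub>F h in at_right 0. norm (\<gamma> (t + h) - \<gamma> t) \<le> N * h"
  proof eventually_elim
    case (elim h)
    have "norm (\<gamma> (t + h) - \<gamma> t) \<le> (\<Sum>b\<in>Basis. \<bar>(\<gamma> (t + h) - \<gamma> t) \<bullet> b\<bar>)" by (rule norm_le_l1)
    also have "\<dots> \<le> (\<Sum>b\<in>Basis. M b * h)" using elim by (intro sum_mono) auto
    finally show ?case by (simp add: N_def sum_distrib_right)
  qed
  \<comment> \<open>Makes \<open>\<eta> * (\<bar>N\<bar> + 1)\<close> equal to one half.\<close>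
  define \<eta> where "\<eta> = 1 / (2 * (\<bar>N\<bar> + 1))"
  have "0 < \<eta>" by (simp add: \<eta>_def)
  then obtain r where r: "0 < r" "\<And>y s. norm (y - \<gamma> t) < r \<Longrightarrow> s \<in> clarke_subdiff f y \<Longrightarrow>
      f y - f (\<gamma> t) \<le> s \<bullet> (y - \<gamma> t) + \<eta> * norm (y - \<gamma> t)"
    using upper_semismooth[OF lip def] by blast
  have "\<forall>\<^sub>F h in at_right 0. 0 < h \<and> h < min (b - t) (r / (\<bar>N\<bar> + 1))"
    unfolding eventually_at_right_field using t r(1) by (intro exI[of _ "min (b - t) (r / (\<bar>N\<bar> + 1))"]) auto
  with slope have "\<forall>\<^sub>F h in at_right (0::real). False"
  proof eventually_elim
    case (elim h)
    have N: "N * h \<le> (\<bar>N\<bar> + 1) * h" using elim by (intro mult_right_mono) auto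
    have "(\<bar>N\<bar> + 1) * h < r" using elim by (simp add: field_simps)
    then have "norm (\<gamma> (t + h) - \<gamma> t) < r" using N elim by linarith
    moreover have "a < t + h" "t + h < b" using t elim by auto
    moreover have "0 \<in> clarke_subdiff f (\<gamma> (t + h))"
      using f\<gamma>(2)[OF \<open>a < t + h\<close> \<open>t + h < b\<close>] by (simp add: critical_points_def)
    ultimately have "f (\<gamma> (t + h)) - f (\<gamma> t) \<le> \<eta> * norm (\<gamma> (t + h) - \<gamma> t)"
      using r(2)[of "\<gamma> (t + h)" 0] by simp
    also have "\<dots> \<le> \<eta> * ((\<bar>N\<bar> + 1) * h)" using order_trans[OF elim(1) N] \<open>0 < \<eta>\<close>
      by (intro mult_left_mono) auto
    also have "\<dots> = h / 2"
    proof -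
      define c where "c = \<bar>N\<bar> + 1"
      have "c \<noteq> 0" unfolding c_def by linarith
      then show ?thesis unfolding \<eta>_def c_def[symmetric] by simp
    qed
    finally show False
      using f\<gamma>(1)[of "t + h"] f\<gamma>(1)[of t] t elim by simp
  qed
  then show False by simp
qed

end

subsection \<open>Absolutely continuous functions\<close>

lemma absolutely_continuous_on_imp_continuous_on:
  assumes "absolutely_continuous_on a b x"
  shows "continuous_on {a..b} x"
  unfolding continuous_on_iff
proof (intro ballI allI impI)
  fix t e :: real assume t: "t \<in> {a..b}" and "0 < e"
  then have "0 < e / 2" by simp
  then obtain \<delta> where \<delta>: "0 < \<delta>" and H: "\<And>(m::nat) l u. (\<forall>i<m. a \<le> l i \<and> l i \<le> u i \<and> u i \<le> b) \<and>
        disjoint_family_on (\<lambda>i. {l i..u i}) {..<m} \<and> (\<Sum>i<m. u i - l i) \<le> \<delta>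
        \<longrightarrow> (\<Sum>i<m. norm (x (u i) - x (l i))) \<le> e / 2"
    using assms unfolding absolutely_continuous_on_def by meson
  have one: "norm (x v - x w) \<le> e / 2" if "a \<le> w" "w \<le> v" "v \<le> b" "v - w \<le> \<delta>" for v w
    using H[of "Suc 0" "\<lambda>_. w" "\<lambda>_. v"] that by (simp add: disjoint_family_on_def)
  show "\<exists>d>0. \<forall>x'\<in>{a..b}. dist x' t < d \<longrightarrow> dist (x x') (x t) < e"
  proof (intro exI[of _ \<delta>] conjI ballI impI \<delta>)
    fix s assume s: "s \<in> {a..b}" "dist s t < \<delta>"
    show "dist (x s) (x t) < e"
      using one[of s t] one[of t s] s t \<open>0 < e\<close>
      by (cases "s \<le> t") (auto simp: dist_norm norm_minus_commute)
  qed
qed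

(* The definition of absolute continuity speaks of disjoint closed intervals; intervals that
   only overlap at endpoints are reached by shrinking them and passing to the limit. *)

lemma absolutely_continuous_on_nonoverlapping:
  fixes x :: "real \<Rightarrow> 'a::euclidean_space"
  assumes "absolutely_continuous_on a b x" "0 < \<epsilon>"
  obtains \<delta> where "0 < \<delta>" "\<And>(I :: 'i set) l u. finite I \<Longrightarrow> (\<And>i. i \<in> I \<Longrightarrow> a \<le> l i \<and> l i \<le> u i \<and> u i \<le> b) \<Longrightarrow>
      disjoint_family_on (\<lambda>i. {l i<..<u i}) I \<Longrightarrow> (\<Sum>i\<in>I. u i - l i) \<le> \<delta> \<Longrightarrow>
      (\<Sum>i\<in>I. norm (x (u i) - x (l i))) \<le> \<epsilon>"
proof -
  obtain \<delta> where \<delta>: "0 < \<delta>" and H: "\<And>(m::nat) l u. (\<forall>i<m. a \<le> l i \<and> l i \<le> u i \<and> u i \<le> b) \<and>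
        disjoint_family_on (\<lambda>i. {l i..u i}) {..<m} \<and> (\<Sum>i<m. u i - l i) \<le> \<delta>
        \<longrightarrow> (\<Sum>i<m. norm (x (u i) - x (l i))) \<le> \<epsilon>"
    using assms unfolding absolutely_continuous_on_def by meson
  have cont: "continuous_on {a..b} x" by (rule absolutely_continuous_on_imp_continuous_on) fact
  show ?thesis
  proof (rule that[OF \<delta>])
    fix I :: "'i set" and l u :: "'i \<Rightarrow> real"
    assume I: "finite I" "\<And>i. i \<in> I \<Longrightarrow> a \<le> l i \<and> l i \<le> u i \<and> u i \<le> b"
      "disjoint_family_on (\<lambda>i. {l i<..<u i}) I" "(\<Sum>i\<in>I. u i - l i) \<le> \<delta>"
    \<comment> \<open>Intervals of length zero contribute nothing and are left out, as shrinking
      cannot separate them from their neighbours.\<close>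
    define J where "J = {i \<in> I. l i < u i}"
    have "finite J" using I(1) by (simp add: J_def)
    then obtain h where h: "bij_betw h {..<card J} J"
      using ex_bij_betw_nat_finite by (metis lessThan_atLeast0)
    define L where "L s i = l i + s * (u i - l i)" for s i
    define U where "U s i = u i - s * (u i - l i)" for s i
    have LU: "l i < L s i" "L s i \<le> U s i" "U s i < u i" if "0 < s" "s < 1 / 2" "i \<in> J" for s i
    proof -
      have lu: "0 < u i - l i" using that by (simp add: J_def)
      then have "0 < s * (u i - l i)" "s * (u i - l i) \<le> 1 / 2 * (u i - l i)"
        using that by (auto intro!: mult_right_mono)
      then show "l i < L s i" "L s i \<le> U s i" "U s i < u i" by (auto simp: L_def U_def)
    qed
    have bound: "(\<Sum>i\<in>J. norm (x (U s i) - x (L s i))) \<le> \<epsilon>" if s: "0 < s" "s < 1 / 2" for s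
    proof -
      have "(\<Sum>k<card J. norm (x (U s (h k)) - x (L s (h k)))) \<le> \<epsilon>"
      proof (rule H[rule_format], intro conjI allI impI)
        fix k assume "k < card J"
        then have "h k \<in> J" using h by (auto simp: bij_betw_def)
        then show "a \<le> L s (h k)" "L s (h k) \<le> U s (h k)" "U s (h k) \<le> b"
          using LU[OF s \<open>h k \<in> J\<close>] I(2)[of "h k"] by (auto simp: J_def)
      next
        have sub: "{L s i..U s i} \<subseteq> {l i<..<u i}" if "i \<in> J" for i
          using LU[OF s that] by auto
        show "disjoint_family_on (\<lambda>i. {L s (h i)..U s (h i)}) {..<card J}"
          unfolding disjoint_family_on_def
        proof (intro ballI impI)
          fix j k assume jk: "j \<in> {..<card J}" "k \<in> {..<card J}" "j \<noteq> k"
          then have "h j \<in> J" "h k \<in> J" "h j \<noteq> h k" using h by (auto simp: bij_betw_def inj_on_def)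
          moreover from this have "{l (h j)<..<u (h j)} \<inter> {l (h k)<..<u (h k)} = {}"
            using I(3) unfolding disjoint_family_on_def J_def by blast
          ultimately show "{L s (h j)..U s (h j)} \<inter> {L s (h k)..U s (h k)} = {}"
            using sub by blast
        qed
        have "(\<Sum>k<card J. U s (h k) - L s (h k)) = (\<Sum>i\<in>J. U s i - L s i)"
          by (rule sum.reindex_bij_betw[OF h])
        also have "\<dots> \<le> (\<Sum>i\<in>J. u i - l i)"
          using LU[OF s] by (intro sum_mono) (force simp: less_imp_le)
        also have "\<dots> \<le> (\<Sum>i\<in>I. u i - l i)"
          using I(1,2) by (intro sum_mono2) (auto simp: J_def)
        finally show "(\<Sum>k<card J. U s (h k) - L s (h k)) \<le> \<delta>" using I(4) by simp
      qed
      then show ?thesis by (simp add: sum.reindex_bij_betw[OF h, of "\<lambda>i. norm (x (U s i) - x (L s i))"])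
    qed
    have lim: "((\<lambda>s. \<Sum>i\<in>J. norm (x (U s i) - x (L s i))) \<longlongrightarrow> (\<Sum>i\<in>J. norm (x (u i) - x (l i)))) (at_right 0)"
    proof (intro tendsto_intros)
      fix i assume i: "i \<in> J"
      have ev: "\<forall>\<^sub>F s in at_right 0. 0 < s \<and> s < 1 / (2::real)"
        unfolding eventually_at_right_field by (intro exI[of _ "1/2"]) auto
      have "((\<lambda>s. U s i) \<longlongrightarrow> u i - 0 * (u i - l i)) (at_right 0)"
        unfolding U_def by (intro tendsto_intros)
      moreover have "\<forall>\<^sub>F s in at_right 0. U s i \<in> {a..b}"
        using ev by eventually_elim (use LU[OF _ _ i] I(2)[of i] i in \<open>force simp: J_def\<close>)
      ultimately show "((\<lambda>s. x (U s i)) \<longlongrightarrow> x (u i)) (at_right 0)"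
        using I(2)[of i] i by (intro continuous_on_tendsto_compose[OF cont]) (auto simp: J_def)
      have "((\<lambda>s. L s i) \<longlongrightarrow> l i + 0 * (u i - l i)) (at_right 0)"
        unfolding L_def by (intro tendsto_intros)
      moreover have "\<forall>\<^sub>F s in at_right 0. L s i \<in> {a..b}"
        using ev by eventually_elim (use LU[OF _ _ i] I(2)[of i] i in \<open>force simp: J_def\<close>)
      ultimately show "((\<lambda>s. x (L s i)) \<longlongrightarrow> x (l i)) (at_right 0)"
        using I(2)[of i] i by (intro continuous_on_tendsto_compose[OF cont]) (auto simp: J_def)
    qed
    have "(\<Sum>i\<in>J. norm (x (u i) - x (l i))) \<le> \<epsilon>"
    proof (rule tendsto_upperbound[OF lim])
      show "\<forall>\<^sub>F s in at_right 0. (\<Sum>i\<in>J. norm (x (U s i) - x (L s i))) \<le> \<epsilon>"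
        unfolding eventually_at_right_field using bound by (intro exI[of _ "1/2"]) auto
    qed simp
    moreover have "(\<Sum>i\<in>J. norm (x (u i) - x (l i))) = (\<Sum>i\<in>I. norm (x (u i) - x (l i)))"
    proof (rule sum.mono_neutral_left)
      show "\<forall>i\<in>I - J. norm (x (u i) - x (l i)) = 0"
      proof
        fix i assume "i \<in> I - J"
        then have "u i = l i" using I(2)[of i] by (auto simp: J_def)
        then show "norm (x (u i) - x (l i)) = 0" by simp
      qed
    qed (use I(1) in \<open>auto simp: J_def\<close>)
    ultimately show "(\<Sum>i\<in>I. norm (x (u i) - x (l i))) \<le> \<epsilon>" by simp
  qed
qed

text \<open>A division fine for a suitable gauge has two kinds of tags. Where the derivative is at
  most 0, the increment is at most \<open>e\<close> times the length. Tags in the null set have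
  their intervals in an open set of measure below \<open>\<delta>\<close>, so absolute continuity
  bounds their total increment by \<open>e\<close>.\<close>

lemma absolutely_continuous_on_nonincreasing:
  fixes \<phi> :: "real \<Rightarrow> real"
  assumes "a \<le> b" and ac: "absolutely_continuous_on a b \<phi>"
    and ae: "AE t in lebesgue. t \<in> {a..b} \<longrightarrow> (\<exists>D\<le>0. (\<phi> has_real_derivative D) (at t within {a..b}))"
  shows "\<phi> b \<le> \<phi> a"
proof (rule field_le_epsilon)
  fix e0 :: real assume "0 < e0"
  define e where "e = e0 / (1 + (b - a))"
  have e: "0 < e" "e * (b - a) + e = e0"
    using \<open>0 < e0\<close> \<open>a \<le> b\<close> by (auto simp: e_def add_divide_distrib[symmetric] field_simps)
  obtain \<delta> where \<delta>: "0 < \<delta>" and H: "\<And>(I :: (real \<times> real set) set) l u. finite I \<Longrightarrow> (\<And>i. i \<in> I \<Longrightarrow> a \<le> l i \<and> l i \<le> u i \<and> u i \<le> b) \<Longrightarrow>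
      disjoint_family_on (\<lambda>i. {l i<..<u i}) I \<Longrightarrow> (\<Sum>i\<in>I. u i - l i) \<le> \<delta> \<Longrightarrow>
      (\<Sum>i\<in>I. norm (\<phi> (u i) - \<phi> (l i))) \<le> e"
    by (rule absolutely_continuous_on_nonoverlapping[OF ac e(1), where ?'i = "real \<times> real set"]) blast
  obtain N where "\<And>t. t \<in> space lebesgue - N \<Longrightarrow> t \<in> {a..b} \<longrightarrow>
      (\<exists>D\<le>0. (\<phi> has_real_derivative D) (at t within {a..b}))" "N \<in> null_sets lebesgue"
    by (rule AE_E3[OF ae]) blast
  then have N: "N \<in> null_sets lebesgue"
    "\<And>t. t \<in> {a..b} \<Longrightarrow> t \<notin> N \<Longrightarrow> \<exists>D\<le>0. (\<phi> has_real_derivative D) (at t within {a..b})"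
    by simp_all
  obtain U where U: "open U" "N \<subseteq> U" "(U - N) \<in> lmeasurable" "emeasure lebesgue (U - N) < ennreal \<delta>"
    using sets_lebesgue_outer_open[of N \<delta>] N(1) \<delta> by auto
  have "emeasure lebesgue U = emeasure lebesgue (U - N)"
    using N(1) U(1) by (intro emeasure_Diff_null_set[symmetric]) auto
  then have lmU: "U \<in> lmeasurable" and mU: "measure lebesgue U < \<delta>"
    using U \<delta> by (auto simp: fmeasurable_def measure_def enn2real_less_iff)
  define good where "good t r \<longleftrightarrow> (\<forall>v w. v \<le> t \<and> t \<le> w \<and> v \<in> {a..b} \<inter> ball t r \<and> w \<in> {a..b} \<inter> ball t r \<longrightarrow>
      \<phi> w - \<phi> v \<le> e * (w - v))" for t r
  have ex_good: "\<exists>r>0. good t r" if t: "t \<in> {a..b}" "t \<notin> N" for t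
  proof -
    obtain D where D: "D \<le> 0" "(\<phi> has_real_derivative D) (at t within {a..b})" using N(2) t by blast
    from D(2) have "(\<phi> has_derivative (*) D) (at t within {a..b})" by (simp add: has_field_derivative_def)
    then obtain r where r: "0 < r" "\<And>s. s \<in> {a..b} \<Longrightarrow> norm (s - t) < r \<Longrightarrow>
        norm (\<phi> s - \<phi> t - D * (s - t)) \<le> e * norm (s - t)"
      using e(1) unfolding has_derivative_within_alt by meson
    have "good t r"
      unfolding good_def
    proof (intro allI impI)
      fix v w assume vw: "v \<le> t \<and> t \<le> w \<and> v \<in> {a..b} \<inter> ball t r \<and> w \<in> {a..b} \<inter> ball t r"
      then have "\<bar>\<phi> v - \<phi> t - D * (v - t)\<bar> \<le> e * (t - v)" "\<bar>\<phi> w - \<phi> t - D * (w - t)\<bar> \<le> e * (w - t)"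
        using r(2)[of v] r(2)[of w] by (auto simp: dist_real_def)
      moreover have "D * (w - t) \<le> 0" "0 \<le> D * (v - t)"
        using vw D(1) by (auto intro: mult_nonpos_nonneg mult_nonpos_nonpos)
      moreover have "e * (w - v) = e * (w - t) + e * (t - v)" by (simp add: algebra_simps)
      ultimately show "\<phi> w - \<phi> v \<le> e * (w - v)" by linarith
    qed
    then show ?thesis using r(1) by blast
  qed
  have ex_U: "\<exists>r>0. ball t r \<subseteq> U" if "t \<in> N" for t
    using U(1,2) that open_contains_ball by blast
  \<comment> \<open>A gauge needs a radius at every real; outside both \<open>N\<close> and the
    interval any positive radius does.\<close>
  define R where "R t = (SOME r. 0 < r \<and> (if t \<in> N then ball t r \<subseteq> U else t \<in> {a..b} \<longrightarrow> good t r))" for t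
  have R: "0 < R t \<and> (if t \<in> N then ball t (R t) \<subseteq> U else t \<in> {a..b} \<longrightarrow> good t (R t))" for t
    unfolding R_def
  proof (rule someI_ex)
    show "\<exists>r. 0 < r \<and> (if t \<in> N then ball t r \<subseteq> U else t \<in> {a..b} \<longrightarrow> good t r)"
    proof (cases "t \<in> N \<or> t \<in> {a..b}")
      case True
      then show ?thesis using ex_good[of t] ex_U[of t] by auto
    next
      case False
      then show ?thesis by (intro exI[of _ 1]) auto
    qed
  qed
  have "gauge (\<lambda>t. ball t (R t))" using R by (simp add: gauge_def)
  then obtain p where p: "p tagged_division_of {a..b}" "(\<lambda>t. ball t (R t)) fine p"
    by (rule fine_division_exists_real)
  note pD = tagged_division_ofD[OF p(1)]
  have K: "Inf k \<le> t" "t \<le> Sup k" "Inf k \<in> k" "Sup k \<in> k" "interior k = {Inf k<..<Sup k}"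
      "a \<le> Inf k" "Sup k \<le> b" "k \<subseteq> {a..b}" "k \<subseteq> ball t (R t)" if tk: "(t, k) \<in> p" for t k
  proof -
    obtain c d where k: "k = {c..d}" using pD(4)[OF tk] by auto
    moreover have "t \<in> k" using pD(2)[OF tk] .
    ultimately have "Inf k = c" "Sup k = d" "c \<le> t" "t \<le> d" by auto
    then show "Inf k \<le> t" "t \<le> Sup k" "Inf k \<in> k" "Sup k \<in> k" "interior k = {Inf k<..<Sup k}"
      by (simp_all add: k interior_atLeastAtMost_real)
    show "k \<subseteq> {a..b}" using pD(3)[OF tk] .
    then show "a \<le> Inf k" "Sup k \<le> b" using \<open>Inf k \<in> k\<close> \<open>Sup k \<in> k\<close> by auto
    show "k \<subseteq> ball t (R t)" using fineD[OF p(2) tk] .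
  qed
  let ?pN = "{z \<in> p. fst z \<in> N}" and ?pG = "{z \<in> p. fst z \<notin> N}"
  let ?d = "\<lambda>z. \<phi> (Sup (snd z)) - \<phi> (Inf (snd z))"
  have fin: "finite p" by (rule pD)
  have "(\<Sum>z\<in>p. ?d z) = \<phi> b - \<phi> a"
    using additive_tagged_division_1[OF \<open>a \<le> b\<close> p(1), of \<phi>] by (simp add: case_prod_beta)
  moreover have "(\<Sum>z\<in>p. ?d z) = (\<Sum>z\<in>?pN. ?d z) + (\<Sum>z\<in>?pG. ?d z)"
  proof -
    have "p = ?pN \<union> ?pG" by auto
    then have "(\<Sum>z\<in>p. ?d z) = (\<Sum>z\<in>?pN \<union> ?pG. ?d z)" by simp
    also have "\<dots> = (\<Sum>z\<in>?pN. ?d z) + (\<Sum>z\<in>?pG. ?d z)"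
      using fin by (intro sum.union_disjoint) auto
    finally show ?thesis .
  qed
  moreover have "(\<Sum>z\<in>?pG. ?d z) \<le> e * (b - a)"
  proof -
    have "?d z \<le> e * (Sup (snd z) - Inf (snd z))" if "z \<in> ?pG" for z
    proof -
      obtain t k where z: "z = (t, k)" "(t, k) \<in> p" "t \<notin> N" using \<open>z \<in> ?pG\<close> by (cases z) auto
      note Kz = K[OF z(2)]
      have "t \<in> {a..b}" using Kz by auto
      then have "good t (R t)" using R[of t] z by auto
      moreover have "Inf k \<in> {a..b} \<inter> ball t (R t)" "Sup k \<in> {a..b} \<inter> ball t (R t)"
        using Kz(3,4,8,9) by blast+
      ultimately show ?thesis using Kz(1,2) unfolding good_def z by auto
    qed
    then have "(\<Sum>z\<in>?pG. ?d z) \<le> (\<Sum>z\<in>?pG. e * (Sup (snd z) - Inf (snd z)))" by (rule sum_mono)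
    also have "\<dots> \<le> (\<Sum>z\<in>p. e * (Sup (snd z) - Inf (snd z)))"
    proof (rule sum_mono2[OF fin])
      fix z assume "z \<in> p - ?pG"
      then have "Inf (snd z) \<le> Sup (snd z)" using K(1,2)[of "fst z" "snd z"] by (simp add: order_trans)
      then show "0 \<le> e * (Sup (snd z) - Inf (snd z))" using e(1) by simp
    qed auto
    also have "\<dots> = e * (b - a)"
      using additive_tagged_division_1[OF \<open>a \<le> b\<close> p(1), of "\<lambda>x. x"]
      by (simp add: case_prod_beta sum_distrib_left[symmetric])
    finally show ?thesis .
  qed
  moreover have "(\<Sum>z\<in>?pN. ?d z) \<le> e"
  proof -
    have int: "interior (snd z) = {Inf (snd z)<..<Sup (snd z)}" "Inf (snd z) \<le> Sup (snd z)"
      "a \<le> Inf (snd z)" "Sup (snd z) \<le> b" if "z \<in> p" for z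
    proof -
      have "(fst z, snd z) \<in> p" using that by simp
      note Kz = K[OF this]
      show "interior (snd z) = {Inf (snd z)<..<Sup (snd z)}" "Inf (snd z) \<le> Sup (snd z)"
        "a \<le> Inf (snd z)" "Sup (snd z) \<le> b"
        by (rule Kz order_trans[OF Kz(1,2)])+
    qed
    have disj: "interior (snd z) \<inter> interior (snd z') = {}" if "z \<in> p" "z' \<in> p" "z \<noteq> z'" for z z'
      using pD(5)[of "fst z" "snd z" "fst z'" "snd z'"] that by simp
    \<comment> \<open>The pieces overlap at most in end points, so their total length is the measure
      of a disjoint union of interiors, which lies in \<open>U\<close>.\<close>
    have "(\<Sum>z\<in>?pN. Sup (snd z) - Inf (snd z)) = (\<Sum>z\<in>?pN. measure lebesgue (interior (snd z)))"
      using int by (intro sum.cong) auto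
    also have "\<dots> = measure lebesgue (\<Union>z\<in>?pN. interior (snd z))"
      using fin int disj
      by (intro measure_negligible_finite_Union_image[symmetric]) (auto simp: pairwise_def)
    also have "\<dots> \<le> measure lebesgue U"
    proof (rule measure_mono_fmeasurable[OF _ _ lmU])
      show "(\<Union>z\<in>?pN. interior (snd z)) \<subseteq> U"
      proof
        fix s assume "s \<in> (\<Union>z\<in>?pN. interior (snd z))"
        then obtain t k where tk: "(t, k) \<in> p" "t \<in> N" "s \<in> interior k" by auto
        then have "s \<in> ball t (R t)" using K(9)[OF tk(1)] interior_subset by blast
        then show "s \<in> U" using R[of t] tk(2) by auto
      qed
      have "open (\<Union>z\<in>?pN. interior (snd z))" by (intro open_UN ballI open_interior)
      then show "(\<Union>z\<in>?pN. interior (snd z)) \<in> sets lebesgue" by (intro sets_completionI_sets) simp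
    qed
    finally have "(\<Sum>z\<in>?pN. Sup (snd z) - Inf (snd z)) \<le> \<delta>" using mU by simp
    moreover have "disjoint_family_on (\<lambda>z. {Inf (snd z)<..<Sup (snd z)}) ?pN"
      unfolding disjoint_family_on_def
    proof (intro ballI impI)
      fix z z' assume zz: "z \<in> ?pN" "z' \<in> ?pN" "z \<noteq> z'"
      then show "{Inf (snd z)<..<Sup (snd z)} \<inter> {Inf (snd z')<..<Sup (snd z')} = {}"
        using disj[of z z'] int(1)[of z] int(1)[of z'] by simp
    qed
    ultimately have "(\<Sum>z\<in>?pN. norm (?d z)) \<le> e"
      using fin int by (intro H) auto
    moreover have "(\<Sum>z\<in>?pN. ?d z) \<le> (\<Sum>z\<in>?pN. norm (?d z))" by (intro sum_mono) simp
    ultimately show ?thesis by linarith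
  qed
  ultimately show "\<phi> b \<le> \<phi> a + e0" using e(2) by linarith
qed

text \<open>Lets functions built from a trajectory, integrals along it and polynomials in time
  inherit absolute continuity.\<close>

lemma absolutely_continuous_on_dominated:
  fixes x :: "real \<Rightarrow> 'a::euclidean_space" and y :: "real \<Rightarrow> 'b::euclidean_space"
  assumes x: "absolutely_continuous_on a b x" and "0 < C" and "a \<le> c" "d \<le> b"
    and dom: "\<And>s t. c \<le> s \<Longrightarrow> s \<le> t \<Longrightarrow> t \<le> d \<Longrightarrow> norm (y t - y s) \<le> C * (norm (x t - x s) + (t - s))"
  shows "absolutely_continuous_on c d y"
  unfolding absolutely_continuous_on_def
proof (intro allI impI)
  fix \<epsilon> :: real assume "0 < \<epsilon>"
  then have e: "0 < \<epsilon> / (2 * C)" using \<open>0 < C\<close> by simp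
  then obtain \<delta> where \<delta>: "0 < \<delta>" and H: "\<And>(m::nat) l u. (\<forall>i<m. a \<le> l i \<and> l i \<le> u i \<and> u i \<le> b) \<and>
        disjoint_family_on (\<lambda>i. {l i..u i}) {..<m} \<and> (\<Sum>i<m. u i - l i) \<le> \<delta>
        \<longrightarrow> (\<Sum>i<m. norm (x (u i) - x (l i))) \<le> \<epsilon> / (2 * C)"
    using x unfolding absolutely_continuous_on_def by meson
  show "\<exists>\<delta>>0. \<forall>(m::nat) l u. (\<forall>i<m. c \<le> l i \<and> l i \<le> u i \<and> u i \<le> d) \<and>
        disjoint_family_on (\<lambda>i. {l i..u i}) {..<m} \<and> (\<Sum>i<m. u i - l i) \<le> \<delta>
        \<longrightarrow> (\<Sum>i<m. norm (y (u i) - y (l i))) \<le> \<epsilon>"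
  proof (intro exI[of _ "min \<delta> (\<epsilon> / (2 * C))"] conjI allI impI)
    fix m :: nat and l u :: "nat \<Rightarrow> real"
    assume A: "(\<forall>i<m. c \<le> l i \<and> l i \<le> u i \<and> u i \<le> d) \<and>
        disjoint_family_on (\<lambda>i. {l i..u i}) {..<m} \<and> (\<Sum>i<m. u i - l i) \<le> min \<delta> (\<epsilon> / (2 * C))"
    have "(\<Sum>i<m. norm (x (u i) - x (l i))) \<le> \<epsilon> / (2 * C)"
      using A \<open>a \<le> c\<close> \<open>d \<le> b\<close> by (intro H[rule_format]) force
    have "(\<Sum>i<m. norm (y (u i) - y (l i))) \<le> (\<Sum>i<m. C * (norm (x (u i) - x (l i)) + (u i - l i)))"
      using A by (intro sum_mono dom) auto
    also have "\<dots> = C * ((\<Sum>i<m. norm (x (u i) - x (l i))) + (\<Sum>i<m. u i - l i))"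
      by (simp only: sum_distrib_left[symmetric] sum.distrib)
    also have "\<dots> \<le> C * (\<epsilon> / (2 * C) + \<epsilon> / (2 * C))"
      using A \<open>(\<Sum>i<m. norm (x (u i) - x (l i))) \<le> \<epsilon> / (2 * C)\<close> \<open>0 < C\<close>
      by (intro mult_left_mono add_mono) auto
    also have "\<dots> = \<epsilon>" using \<open>0 < C\<close> by simp
    finally show "(\<Sum>i<m. norm (y (u i) - y (l i))) \<le> \<epsilon>" .
  qed (use \<delta> e in auto)
qed

subsection \<open>Subgradient trajectories\<close>

text \<open>The subgradient belongs to the moving point \<open>y\<close>, not to the centre
  \<open>x\<close>. Tameness acts on single trajectories only through this property.\<close>

definition semismooth_above :: "('a::euclidean_space \<Rightarrow> real) \<Rightarrow> bool" where
  "semismooth_above f \<longleftrightarrow> (\<forall>x. \<forall>\<eta>>0. \<exists>r>0. \<forall>y s. norm (y - x) < r \<and> s \<in> clarke_subdiff f y \<longrightarrow>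
     f y - f x \<le> s \<bullet> (y - x) + \<eta> * norm (y - x))"

definition subgradient_trajectory :: "('a::euclidean_space \<Rightarrow> real) \<Rightarrow> real \<Rightarrow> real \<Rightarrow> (real \<Rightarrow> 'a) \<Rightarrow> bool" where
  "subgradient_trajectory f c T y \<longleftrightarrow> absolutely_continuous_on 0 T y \<and>
     (AE t in lebesgue. t \<in> {0..T} \<longrightarrow>
        (\<exists>s \<in> clarke_subdiff f (y t). (y has_vector_derivative - c *\<^sub>R s) (at t within {0..T})))"

lemma locally_lipschitz_continuous:
  assumes "locally_lipschitz f"
  shows "continuous_on UNIV f"
proof (rule continuous_at_imp_continuous_on, rule ballI)
  fix x
  obtain r L where "0 < r" "L-lipschitz_on (cball x r) f" using assms unfolding locally_lipschitz_def by blast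
  then have "continuous_on (ball x r) f"
    using lipschitz_on_continuous_on lipschitz_on_subset ball_subset_cball by metis
  then show "isCont f x" using \<open>0 < r\<close> by (simp add: continuous_on_eq_continuous_at)
qed

text \<open>A bound that may be enlarged freely can be taken as the largest of finitely many local
  ones.\<close>

lemma compact_uniform_bound:
  fixes A :: "'a::euclidean_space set"
  assumes "compact A" and loc: "\<And>x. x \<in> A \<Longrightarrow> \<exists>e>0. \<exists>B::real. \<forall>y. norm (y - x) < e \<longrightarrow> Q y B"
    and mono: "\<And>y B B'. Q y B \<Longrightarrow> B \<le> B' \<Longrightarrow> Q y B'"
  shows "\<exists>B>0. \<forall>y\<in>A. Q y B"
proof -
  from loc obtain e B where eB: "\<And>x. x \<in> A \<Longrightarrow> 0 < e x" "\<And>x y. x \<in> A \<Longrightarrow> norm (y - x) < e x \<Longrightarrow> Q y (B x)"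
    by metis
  have "A \<subseteq> (\<Union>x\<in>A. ball x (e x))" using eB(1) by force
  then obtain D where D: "D \<subseteq> A" "finite D" "A \<subseteq> (\<Union>x\<in>D. ball x (e x))"
    using compactE_image[OF \<open>compact A\<close>, of A "\<lambda>x. ball x (e x)"] by auto
  define B0 where "B0 = Max (insert 1 (B ` D))"
  have "1 \<le> B0" "\<And>x. x \<in> D \<Longrightarrow> B x \<le> B0" using D(2) by (auto simp: B0_def)
  moreover have "Q y B0" if "y \<in> A" for y
  proof -
    obtain x where x: "x \<in> D" "y \<in> ball x (e x)" using D(3) \<open>y \<in> A\<close> by blast
    then have "Q y (B x)" using D(1) by (intro eB(2)) (auto simp: dist_norm norm_minus_commute)
    then show ?thesis using mono x(1) calculation(2) by blast
  qed
  ultimately show ?thesis by (intro exI[of _ B0]) auto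
qed

lemma clarke_subdiff_bounded_on_compact:
  assumes "compact A" "locally_lipschitz f"
  shows "\<exists>L>0. \<forall>y\<in>A. \<forall>s\<in>clarke_subdiff f y. norm s \<le> L"
proof (rule compact_uniform_bound[OF assms(1)])
  fix x
  obtain r L where "0 < r" "L-lipschitz_on (cball x r) f" using assms(2) unfolding locally_lipschitz_def by blast
  then show "\<exists>e>0. \<exists>L. \<forall>y. norm (y - x) < e \<longrightarrow> (\<forall>s\<in>clarke_subdiff f y. norm s \<le> L)"
    using clarke_subdiff_norm_le by blast
qed (use order_trans in blast)

text \<open>Compactness is applied to the reciprocal \<open>B\<close> of the descent rate, which may
  be enlarged; directions are scaled to norm at most 1 so that the rates at different points
  compare.\<close>

lemma uniform_descent:
  assumes "compact A" "A \<inter> critical_points f = {}"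
  shows "\<exists>\<nu>>0. \<forall>x\<in>A. \<exists>d \<delta>. 0 < \<delta> \<and> norm d \<le> 1 \<and>
           (\<forall>y s. norm (y - x) < \<delta> \<and> s \<in> clarke_subdiff f y \<longrightarrow> s \<bullet> d \<le> - \<nu>)"
proof -
  let ?Q = "\<lambda>x B. 0 < B \<and> (\<exists>d \<delta>. 0 < \<delta> \<and> norm d \<le> 1 \<and>
           (\<forall>y s. norm (y - x) < \<delta> \<and> s \<in> clarke_subdiff f y \<longrightarrow> s \<bullet> d \<le> - (1 / B)))"
  have "\<exists>B>0. \<forall>x\<in>A. ?Q x B"
  proof (rule compact_uniform_bound[OF assms(1)])
    fix x assume "x \<in> A"
    then have "x \<notin> critical_points f" using assms(2) by blast
    then obtain d \<mu> \<delta> where *: "0 < \<mu>" "0 < \<delta>"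
      "\<And>y s. norm (y - x) < \<delta> \<Longrightarrow> s \<in> clarke_subdiff f y \<Longrightarrow> s \<bullet> d \<le> - \<mu>"
      using noncritical_descent by metis
    define n where "n = norm d + 1"
    have n: "1 \<le> n" "norm d \<le> n" by (auto simp: n_def)
    show "\<exists>e>0. \<exists>B. \<forall>y. norm (y - x) < e \<longrightarrow> ?Q y B"
    proof (intro exI[where P = "\<lambda>e. 0 < e \<and> _ e"] conjI)
      show "0 < \<delta> / 2" using * by simp
      show "\<exists>B. \<forall>y. norm (y - x) < \<delta> / 2 \<longrightarrow> ?Q y B"
      proof (intro exI[of _ "n / \<mu>"] conjI allI impI)
      fix y assume y: "norm (y - x) < \<delta> / 2"
      show "\<exists>d \<delta>. 0 < \<delta> \<and> norm d \<le> 1 \<and>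
           (\<forall>z s. norm (z - y) < \<delta> \<and> s \<in> clarke_subdiff f z \<longrightarrow> s \<bullet> d \<le> - (1 / (n / \<mu>)))"
      proof (intro exI[of _ "d /\<^sub>R n"] exI[of _ "\<delta> / 2"] conjI allI impI)
        show "norm (d /\<^sub>R n) \<le> 1" using n by (simp add: field_simps)
        fix z s assume z: "norm (z - y) < \<delta> / 2 \<and> s \<in> clarke_subdiff f z"
        have "norm (z - x) \<le> norm (z - y) + norm (y - x)" by (metis norm_triangle_ineq diff_add_cancel add_diff_eq)
        then have "s \<bullet> d \<le> - \<mu>" using z y by (intro *(3)) auto
        then have "(s \<bullet> d) / n \<le> (- \<mu>) / n" using n by (intro divide_right_mono) auto
        then show "s \<bullet> (d /\<^sub>R n) \<le> - (1 / (n / \<mu>))" by (simp add: divide_inverse mult.commute)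
      qed (use * in auto)
      qed (use * n in auto)
    qed
  next
    fix y :: 'a and B B' :: real
    assume Q: "?Q y B" "B \<le> B'"
    then have "1 / B' \<le> 1 / B" by (intro divide_left_mono) auto
    then have "- (1 / B) \<le> - (1 / B')" by simp
    then show "?Q y B'" using Q by (meson order_trans less_le_trans)
  qed
  then obtain B where "0 < B" "\<forall>x\<in>A. ?Q x B" by blast
  then show ?thesis by (intro exI[of _ "1 / B"]) auto
qed

text \<open>The function \<open>y t \<bullet> w - m * t\<close> is absolutely continuous and has
  derivative at most 0 almost everywhere.\<close>

lemma absolutely_continuous_on_inner_bound:
  fixes y :: "real \<Rightarrow> 'a::euclidean_space"
  assumes ac: "absolutely_continuous_on a b y"
    and ae: "AE t in lebesgue. t \<in> {s..t0} \<longrightarrow> (\<exists>v. (y has_vector_derivative v) (at t within {a..b}) \<and> v \<bullet> w \<le> m)"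
    and st: "a \<le> s" "s \<le> t0" "t0 \<le> b"
  shows "(y t0 - y s) \<bullet> w \<le> m * (t0 - s)"
proof -
  let ?\<phi> = "\<lambda>t. y t \<bullet> w - m * t"
  have "?\<phi> t0 \<le> ?\<phi> s"
  proof (rule absolutely_continuous_on_nonincreasing[OF st(2)])
    show "absolutely_continuous_on s t0 ?\<phi>"
    proof (rule absolutely_continuous_on_dominated[OF ac _ st(1,3), of "norm w + \<bar>m\<bar> + 1"])
      fix u t assume ut: "s \<le> u" "u \<le> t" "t \<le> t0"
      have "?\<phi> t - ?\<phi> u = (y t - y u) \<bullet> w - m * (t - u)" by (simp add: algebra_simps inner_diff_left)
      also have "norm \<dots> \<le> norm ((y t - y u) \<bullet> w) + norm (m * (t - u))" by (rule norm_triangle_ineq4)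
      also have "\<dots> \<le> norm (y t - y u) * norm w + \<bar>m\<bar> * (t - u)"
        using ut Cauchy_Schwarz_ineq2[of "y t - y u" w] by (simp add: abs_mult)
      also have "\<dots> \<le> norm (y t - y u) * (norm w + \<bar>m\<bar> + 1) + (norm w + \<bar>m\<bar> + 1) * (t - u)"
        using ut by (intro add_mono mult_left_mono mult_right_mono) auto
      finally show "norm (?\<phi> t - ?\<phi> u) \<le> (norm w + \<bar>m\<bar> + 1) * (norm (y t - y u) + (t - u))"
        by (simp add: algebra_simps)
    qed (simp add: add_nonneg_pos)
    show "AE t in lebesgue. t \<in> {s..t0} \<longrightarrow> (\<exists>D\<le>0. (?\<phi> has_real_derivative D) (at t within {s..t0}))"
      using ae
    proof eventually_elim
      case (elim t)
      show ?case
      proof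
        assume t: "t \<in> {s..t0}"
        then obtain v where v: "(y has_vector_derivative v) (at t within {a..b})" "v \<bullet> w \<le> m" using elim by blast
        have "{s..t0} \<subseteq> {a..b}" using st by auto
        then have v': "(y has_vector_derivative v) (at t within {s..t0})"
          using v(1) has_vector_derivative_within_subset by blast
        have "((\<lambda>t. y t \<bullet> w) has_vector_derivative v \<bullet> w) (at t within {s..t0})"
          by (rule bounded_linear.has_vector_derivative[OF bounded_linear_inner_left v'])
        then have "((\<lambda>t. y t \<bullet> w) has_real_derivative v \<bullet> w) (at t within {s..t0})"
          by (simp add: has_real_derivative_iff_has_vector_derivative)
        then have "(?\<phi> has_real_derivative v \<bullet> w - m * 1) (at t within {s..t0})"
          by (intro DERIV_diff DERIV_cmult DERIV_ident)
        then show "\<exists>D\<le>0. (?\<phi> has_real_derivative D) (at t within {s..t0})"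
          using v(2) by (intro exI[of _ "v \<bullet> w - m"]) auto
      qed
    qed
  qed
  then show ?thesis by (simp add: algebra_simps inner_diff_left)
qed

text \<open>The displacement is tested against itself, and one factor of its norm is
  cancelled.\<close>

lemma trajectory_lipschitz:
  assumes traj: "subgradient_trajectory f c T y" and "0 < c" "0 \<le> L"
    and L: "\<And>t s. 0 \<le> t \<Longrightarrow> t \<le> T \<Longrightarrow> s \<in> clarke_subdiff f (y t) \<Longrightarrow> norm s \<le> L"
    and st: "0 \<le> s" "s \<le> t" "t \<le> T"
  shows "norm (y t - y s) \<le> c * L * (t - s)"
proof -
  let ?w = "y t - y s"
  have "?w \<bullet> ?w \<le> (c * L * norm ?w) * (t - s)"
  proof (rule absolutely_continuous_on_inner_bound[OF _ _ st])
    show "absolutely_continuous_on 0 T y" using traj by (simp add: subgradient_trajectory_def)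
    show "AE \<tau> in lebesgue. \<tau> \<in> {s..t} \<longrightarrow>
        (\<exists>v. (y has_vector_derivative v) (at \<tau> within {0..T}) \<and> v \<bullet> ?w \<le> c * L * norm ?w)"
      using traj[unfolded subgradient_trajectory_def, THEN conjunct2]
    proof eventually_elim
      case (elim \<tau>)
      show ?case
      proof
        assume "\<tau> \<in> {s..t}"
        then have \<tau>: "\<tau> \<in> {0..T}" using st by auto
        then obtain v where v: "v \<in> clarke_subdiff f (y \<tau>)" "(y has_vector_derivative - c *\<^sub>R v) (at \<tau> within {0..T})"
          using elim by blast
        have "(- c *\<^sub>R v) \<bullet> ?w \<le> norm (- c *\<^sub>R v) * norm ?w" by (rule norm_cauchy_schwarz)
        also have "\<dots> \<le> c * L * norm ?w"
          using L[OF _ _ v(1)] \<tau> \<open>0 < c\<close> by (intro mult_right_mono) auto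
        finally show "\<exists>v. (y has_vector_derivative v) (at \<tau> within {0..T}) \<and> v \<bullet> ?w \<le> c * L * norm ?w"
          using v(2) by blast
      qed
    qed
  qed
  then have "norm ?w * norm ?w \<le> (c * L * (t - s)) * norm ?w"
    by (simp add: power2_norm_eq_inner[symmetric] power2_eq_square mult_ac)
  moreover have "0 \<le> c * L * (t - s)" using \<open>0 < c\<close> \<open>0 \<le> L\<close> st by simp
  ultimately show ?thesis by (cases "?w = 0") (auto simp: mult_le_cancel_right)
qed

(* Integrating the semismoothness inequality along the trajectory, where s = - y' / c, turns
   the scalar product into the exact derivative of |y(tau) - y(t)|^2. *)

lemma trajectory_mean_decrease:
  assumes traj: "subgradient_trajectory f c T y" and "0 < c"
    and semi: "semismooth_above f" and cont: "continuous_on {0..T} (\<lambda>t. f (y t))"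
    and lip: "\<And>s t. 0 \<le> s \<Longrightarrow> s \<le> t \<Longrightarrow> t \<le> T \<Longrightarrow> norm (y t - y s) \<le> M * (t - s)" and "0 < M"
    and t: "0 \<le> t" "t < T" and "0 < \<eta>"
  shows "\<exists>h0>0. \<forall>h. 0 < h \<and> h \<le> h0 \<longrightarrow> t + h \<le> T \<and>
    integral {t..t + h} (\<lambda>\<tau>. f (y \<tau>) - f (y t)) \<le> \<eta> * h^2 - (norm (y (t + h) - y t))^2 / (2 * c)"
proof -
  let ?g = "\<lambda>\<tau>. f (y \<tau>) - f (y t)"
  \<comment> \<open>Scaled so that \<open>\<eta>1 * M / 2\<close>, the constant left by integration,
    equals \<open>\<eta>\<close>.\<close>
  define \<eta>1 where "\<eta>1 = 2 * \<eta> / M"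
  have "0 < \<eta>1" using \<open>0 < \<eta>\<close> \<open>0 < M\<close> by (simp add: \<eta>1_def)
  then obtain r where r: "0 < r" "\<And>z s. norm (z - y t) < r \<Longrightarrow> s \<in> clarke_subdiff f z \<Longrightarrow>
      f z - f (y t) \<le> s \<bullet> (z - y t) + \<eta>1 * norm (z - y t)"
    using semi unfolding semismooth_above_def by metis
  have contg: "continuous_on {0..T} ?g" by (intro continuous_intros cont)
  have "bounded (?g ` {0..T})" by (intro compact_imp_bounded compact_continuous_image contg) auto
  then obtain G where G: "0 < G" "\<And>\<tau>. 0 \<le> \<tau> \<Longrightarrow> \<tau> \<le> T \<Longrightarrow> \<bar>?g \<tau>\<bar> \<le> G"
    unfolding bounded_pos by auto
  show ?thesis
  proof (intro exI[of _ "min (T - t) (r / (2 * M))"] conjI allI impI)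
    show "0 < min (T - t) (r / (2 * M))" using t r(1) \<open>0 < M\<close> by simp
    fix h assume h: "0 < h \<and> h \<le> min (T - t) (r / (2 * M))"
    then show tT: "t + h \<le> T" by simp
    have hr: "M * h < r"
    proof -
      have "h \<le> r / (2 * M)" using h by simp
      then have "M * h \<le> r / 2" using \<open>0 < M\<close> by (simp add: field_simps)
      then show ?thesis using r(1) by simp
    qed
    \<comment> \<open>Almost everywhere its derivative is \<open>f (y \<tau>) - f (y t) - s
      \<bullet> (y \<tau> - y t) - \<eta>1 * M * (\<tau> - t)\<close>, nonpositive by semismoothness
      and the Lipschitz bound on \<open>y\<close>.\<close>
    let ?\<phi> = "\<lambda>\<tau>. integral {t..\<tau>} ?g + (y \<tau> - y t) \<bullet> (y \<tau> - y t) / (2 * c) - \<eta>1 * M / 2 * (\<tau> - t)^2"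
    have contg': "continuous_on {t..t + h} ?g"
      by (rule continuous_on_subset[OF contg]) (use t tT in auto)
    have "?\<phi> (t + h) \<le> ?\<phi> t"
    proof (rule absolutely_continuous_on_nonincreasing[where \<phi> = ?\<phi> and a = t and b = "t + h"])
      show "t \<le> t + h" using h by simp
      define C where "C = G + M * T / c + \<bar>\<eta>1 * M\<bar> * T + 1"
      have parts: "0 \<le> M * T / c" "0 \<le> \<bar>\<eta>1 * M\<bar> * T" using t \<open>0 < M\<close> \<open>0 < c\<close> by auto
      show "absolutely_continuous_on t (t + h) ?\<phi>"
      proof (rule absolutely_continuous_on_dominated)
        show "absolutely_continuous_on 0 T y" using traj by (simp add: subgradient_trajectory_def)
        show "0 \<le> t" "t + h \<le> T" by (use t tT in auto)
        show "0 < C" using parts G(1) by (simp add: C_def)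
        fix u v assume uv: "t \<le> u" "u \<le> v" "v \<le> t + h"
        have "?g integrable_on {t..v}"
          by (intro integrable_continuous_interval continuous_on_subset[OF contg']) (use uv in auto)
        then have "integral {t..v} ?g - integral {t..u} ?g = integral {u..v} ?g"
          using Henstock_Kurzweil_Integration.integral_combine[of t u v ?g] uv by simp
        moreover have "norm (integral {u..v} ?g) \<le> G * (v - u)"
        proof (rule integral_bound)
          show "continuous_on {u..v} ?g" by (rule continuous_on_subset[OF contg']) (use uv in auto)
          show "norm (?g \<tau>) \<le> G" if "\<tau> \<in> {u..v}" for \<tau> using G(2)[of \<tau>] that uv t tT by auto
        qed (use uv in auto)
        ultimately have 1: "\<bar>integral {t..v} ?g - integral {t..u} ?g\<bar> \<le> G * (v - u)" by simp
        have "(y v - y t) \<bullet> (y v - y t) - (y u - y t) \<bullet> (y u - y t) = (y v - y u) \<bullet> ((y v - y t) + (y u - y t))"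
          by (simp add: inner_diff_left inner_diff_right inner_add_right inner_commute)
        then have "\<bar>(y v - y t) \<bullet> (y v - y t) - (y u - y t) \<bullet> (y u - y t)\<bar> \<le> norm (y v - y u) * norm ((y v - y t) + (y u - y t))"
          using Cauchy_Schwarz_ineq2 by metis
        also have "\<dots> \<le> norm (y v - y u) * (2 * (M * T))"
        proof (intro mult_left_mono)
          have "M * (v - t) \<le> M * T" "M * (u - t) \<le> M * T" using uv t tT \<open>0 < M\<close> by auto
          then have "norm (y v - y t) \<le> M * T" "norm (y u - y t) \<le> M * T"
            using lip[of t v] lip[of t u] uv t tT by auto
          then show "norm ((y v - y t) + (y u - y t)) \<le> 2 * (M * T)"
            using norm_triangle_ineq[of "y v - y t" "y u - y t"] by linarith
        qed simp
        finally have "\<bar>(y v - y t) \<bullet> (y v - y t) - (y u - y t) \<bullet> (y u - y t)\<bar> / (2 * c) \<le> norm (y v - y u) * (2 * (M * T)) / (2 * c)"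
          using \<open>0 < c\<close> by (intro divide_right_mono) auto
        then have 2: "\<bar>(y v - y t) \<bullet> (y v - y t) / (2 * c) - (y u - y t) \<bullet> (y u - y t) / (2 * c)\<bar> \<le> M * T / c * norm (y v - y u)"
          using \<open>0 < c\<close> by (simp add: diff_divide_distrib[symmetric] mult_ac)
        have "(v - t)^2 - (u - t)^2 = (v - u) * ((v - t) + (u - t))" by (simp add: power2_eq_square algebra_simps)
        moreover have "0 \<le> (v - t) + (u - t)" "(v - t) + (u - t) \<le> 2 * T" using uv t tT by auto
        ultimately have "\<bar>(v - t)^2 - (u - t)^2\<bar> \<le> (v - u) * (2 * T)"
          using uv by (simp add: abs_mult mult_left_mono)
        then have "\<bar>\<eta>1 * M / 2\<bar> * \<bar>(v - t)^2 - (u - t)^2\<bar> \<le> \<bar>\<eta>1 * M / 2\<bar> * ((v - u) * (2 * T))"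
          by (rule mult_left_mono) simp
        then have 3: "\<bar>\<eta>1 * M / 2 * (v - t)^2 - \<eta>1 * M / 2 * (u - t)^2\<bar> \<le> \<bar>\<eta>1 * M\<bar> * T * (v - u)"
        proof -
          have "\<eta>1 * M / 2 * (v - t)^2 - \<eta>1 * M / 2 * (u - t)^2 = \<eta>1 * M / 2 * ((v - t)^2 - (u - t)^2)"
            by (rule right_diff_distrib[symmetric])
          moreover have "\<bar>\<eta>1 * M / 2\<bar> * ((v - u) * (2 * T)) = \<bar>\<eta>1 * M\<bar> * T * (v - u)" by simp
          ultimately show ?thesis
            using \<open>\<bar>\<eta>1 * M / 2\<bar> * \<bar>(v - t)^2 - (u - t)^2\<bar> \<le> \<bar>\<eta>1 * M / 2\<bar> * ((v - u) * (2 * T))\<close>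
            by (simp only: abs_mult)
        qed
        have "norm (?\<phi> v - ?\<phi> u) \<le> G * (v - u) + M * T / c * norm (y v - y u) + \<bar>\<eta>1 * M\<bar> * T * (v - u)"
          using 1 2 3 unfolding real_norm_def by linarith
        also have "\<dots> \<le> C * (norm (y v - y u) + (v - u))"
        proof -
          have "C * (norm (y v - y u) + (v - u)) - (G * (v - u) + M * T / c * norm (y v - y u) + \<bar>\<eta>1 * M\<bar> * T * (v - u))
              = (G + \<bar>\<eta>1 * M\<bar> * T + 1) * norm (y v - y u) + (M * T / c + 1) * (v - u)"
            unfolding C_def by (simp add: algebra_simps diff_divide_distrib)
          moreover have "0 \<le> (G + \<bar>\<eta>1 * M\<bar> * T + 1) * norm (y v - y u)" "0 \<le> (M * T / c + 1) * (v - u)"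
            using parts G(1) uv by (auto intro!: mult_nonneg_nonneg add_nonneg_nonneg)
          ultimately show ?thesis by linarith
        qed
        finally show "norm (?\<phi> v - ?\<phi> u) \<le> C * (norm (y v - y u) + (v - u))" .
      qed
      show "AE \<tau> in lebesgue. \<tau> \<in> {t..t + h} \<longrightarrow> (\<exists>D\<le>0. (?\<phi> has_real_derivative D) (at \<tau> within {t..t + h}))"
        using traj[unfolded subgradient_trajectory_def, THEN conjunct2]
      proof eventually_elim
        case (elim \<tau>)
        show ?case
        proof
          assume \<tau>: "\<tau> \<in> {t..t + h}"
          then obtain s where s: "s \<in> clarke_subdiff f (y \<tau>)"
            "(y has_vector_derivative - c *\<^sub>R s) (at \<tau> within {0..T})" using elim t tT by auto
          have "{t..t + h} \<subseteq> {0..T}" using t tT by auto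
          then have y': "(y has_vector_derivative - c *\<^sub>R s) (at \<tau> within {t..t + h})"
            using s(2) has_vector_derivative_within_subset by blast
          then have yd: "((\<lambda>\<tau>. y \<tau> - y t) has_derivative (\<lambda>k. k *\<^sub>R (- c *\<^sub>R s))) (at \<tau> within {t..t + h})"
            unfolding has_vector_derivative_def by (auto intro!: derivative_eq_intros)
          have "((\<lambda>\<tau>. (y \<tau> - y t) \<bullet> (y \<tau> - y t)) has_real_derivative 2 * ((y \<tau> - y t) \<bullet> (- c *\<^sub>R s))) (at \<tau> within {t..t + h})"
            unfolding has_field_derivative_def
            by (rule has_derivative_eq_rhs[OF has_derivative_inner[OF yd yd]])
              (auto simp: inner_commute algebra_simps)
          then have "(?\<phi> has_real_derivative ?g \<tau> + 2 * ((y \<tau> - y t) \<bullet> (- c *\<^sub>R s)) / (2 * c) - \<eta>1 * M / 2 * (2 * (\<tau> - t))) (at \<tau> within {t..t + h})"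
            by (intro DERIV_diff DERIV_add DERIV_cdivide DERIV_cmult integral_has_real_derivative contg' \<tau>)
              (auto intro!: derivative_eq_intros)
          moreover have "?g \<tau> + 2 * ((y \<tau> - y t) \<bullet> (- c *\<^sub>R s)) / (2 * c) - \<eta>1 * M / 2 * (2 * (\<tau> - t)) \<le> 0"
          proof -
            have ly: "norm (y \<tau> - y t) \<le> M * (\<tau> - t)" using lip \<tau> t tT by auto
            also have "\<dots> \<le> M * h" using \<tau> \<open>0 < M\<close> by auto
            finally have "norm (y \<tau> - y t) < r" using hr by simp
            then have "?g \<tau> \<le> s \<bullet> (y \<tau> - y t) + \<eta>1 * norm (y \<tau> - y t)" using r(2) s(1) by blast
            also have "\<eta>1 * norm (y \<tau> - y t) \<le> \<eta>1 * (M * (\<tau> - t))" using ly \<open>0 < \<eta>1\<close> by simp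
            finally have "?g \<tau> \<le> s \<bullet> (y \<tau> - y t) + \<eta>1 * (M * (\<tau> - t))" by simp
            moreover have "2 * ((y \<tau> - y t) \<bullet> (- c *\<^sub>R s)) / (2 * c) = - (s \<bullet> (y \<tau> - y t))"
              using \<open>0 < c\<close> by (simp add: inner_commute)
            moreover have "\<eta>1 * M / 2 * (2 * (\<tau> - t)) = \<eta>1 * (M * (\<tau> - t))" by simp
            ultimately show ?thesis by linarith
          qed
          ultimately show "\<exists>D\<le>0. (?\<phi> has_real_derivative D) (at \<tau> within {t..t + h})" by blast
        qed
      qed
    qed
    moreover have "\<eta>1 * M / 2 = \<eta>" using \<open>0 < M\<close> by (simp add: \<eta>1_def)
    ultimately show "integral {t..t + h} ?g \<le> \<eta> * h^2 - (norm (y (t + h) - y t))^2 / (2 * c)"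
      by (simp add: power2_norm_eq_inner)
  qed
qed

text \<open>Over a short interval the mean of f lies below \<open>f (y t)\<close> by about
  \<open>\<kappa> * h\<close>, so f must meet or cross a line of slope nearly
  \<open>- 2 * \<kappa>\<close> somewhere after \<open>t\<close>, and creeping extends this to the
  whole of \<open>[t1, t2]\<close>. For \<open>\<kappa> = 0\<close> the displacement bound
  \<open>speed\<close> is trivial, which gives monotonicity.\<close>

lemma trajectory_decrease:
  assumes traj: "subgradient_trajectory f c T y" and "0 < c"
    and semi: "semismooth_above f" and cont: "continuous_on {0..T} (\<lambda>t. f (y t))"
    and lip: "\<And>s t. 0 \<le> s \<Longrightarrow> s \<le> t \<Longrightarrow> t \<le> T \<Longrightarrow> norm (y t - y s) \<le> M * (t - s)" and "0 < M"
    and t12: "0 \<le> t1" "t1 \<le> t2" "t2 \<le> T"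
    and speed: "\<And>t. t1 \<le> t \<Longrightarrow> t < t2 \<Longrightarrow> \<exists>h1>0. \<forall>h. 0 < h \<and> h < h1 \<and> t + h \<le> T \<longrightarrow>
      \<kappa> * h^2 \<le> (norm (y (t + h) - y t))^2 / (2 * c)"
  shows "f (y t2) \<le> f (y t1) - 2 * \<kappa> * (t2 - t1)"
proof -
  let ?g = "\<lambda>\<tau>. f (y \<tau>)"
  have main: "?g t2 \<le> ?g t1 - 2 * \<kappa> * (t2 - t1) + 3 * e * (t2 - t1)" if "0 < e" for e
  proof -
    \<comment> \<open>With the loss \<open>3 * e\<close> the line integrates to
      \<open>3 / 2 * (e * h^2) - \<kappa> * h^2\<close>, strictly above the bound
      \<open>e * h^2 - \<kappa> * h^2\<close> on the integral of f.\<close>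
    let ?k = "2 * \<kappa> - 3 * e"
    let ?\<phi> = "\<lambda>\<tau>. - ?g \<tau> - ?k * \<tau>"
    have "?\<phi> t1 \<le> ?\<phi> t2"
    proof (rule creeping[where \<phi> = ?\<phi> and a = t1 and b = t2])
      show "continuous_on {t1..t2} ?\<phi>"
        by (intro continuous_intros continuous_on_subset[OF cont]) (use t12 in auto)
      fix t assume t: "t1 \<le> t" "t < t2"
      have "0 \<le> t" "t < T" using t t12 by auto
      from trajectory_mean_decrease[OF traj \<open>0 < c\<close> semi cont lip \<open>0 < M\<close> this \<open>0 < e\<close>]
      obtain h0 where h0: "0 < h0" "\<And>h. 0 < h \<Longrightarrow> h \<le> h0 \<Longrightarrow> t + h \<le> T \<and>
          integral {t..t + h} (\<lambda>\<tau>. ?g \<tau> - ?g t) \<le> e * h^2 - (norm (y (t + h) - y t))^2 / (2 * c)"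
        by auto
      obtain h1 where h1: "0 < h1" "\<And>h. 0 < h \<Longrightarrow> h < h1 \<Longrightarrow> t + h \<le> T \<Longrightarrow>
          \<kappa> * h^2 \<le> (norm (y (t + h) - y t))^2 / (2 * c)" using speed[OF t] by auto
      define h where "h = min h0 (min (h1 / 2) (t2 - t))"
      have h: "0 < h" "h \<le> h0" "h < h1" "t + h \<le> t2" using h0(1) h1(1) t by (auto simp: h_def)
      show "\<exists>t'. t < t' \<and> t' \<le> t2 \<and> ?\<phi> t \<le> ?\<phi> t'"
      proof (rule ccontr)
        assume "\<not> ?thesis"
        then have *: "?\<phi> t' < ?\<phi> t" if "t < t'" "t' \<le> t2" for t' using that by (meson not_le)
        let ?p = "\<lambda>\<tau>. - ?k * (\<tau> - t)"
        have hint: "(?p has_integral (- ?k * (t + h - t)^2 / 2 - - ?k * (t - t)^2 / 2)) {t..t + h}"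
          using h by (intro fundamental_theorem_of_calculus)
            (auto intro!: derivative_eq_intros simp: has_real_derivative_iff_has_vector_derivative[symmetric])
        have "integral {t..t + h} ?p \<le> integral {t..t + h} (\<lambda>\<tau>. ?g \<tau> - ?g t)"
        proof (rule integral_le)
          show "?p integrable_on {t..t + h}" using hint by blast
          show "(\<lambda>\<tau>. ?g \<tau> - ?g t) integrable_on {t..t + h}"
            by (intro integrable_continuous_interval continuous_intros continuous_on_subset[OF cont])
              (use h t t12 in auto)
          fix \<tau> assume "\<tau> \<in> {t..t + h}"
          then show "?p \<tau> \<le> ?g \<tau> - ?g t"
            using *[of \<tau>] h by (cases "\<tau> = t") (auto simp: algebra_simps)
        qed
        moreover have "integral {t..t + h} ?p = - ?k * h^2 / 2" using integral_unique[OF hint] by simp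
        moreover have "integral {t..t + h} (\<lambda>\<tau>. ?g \<tau> - ?g t) \<le> e * h^2 - \<kappa> * h^2"
          using h0(2)[OF h(1,2)] h1(2)[OF h(1,3)] by auto
        ultimately have "- ?k * h^2 / 2 \<le> e * h^2 - \<kappa> * h^2" by linarith
        moreover have "- ?k * h^2 / 2 = 3 / 2 * (e * h^2) - \<kappa> * h^2" by (simp add: field_simps)
        moreover have "0 < e * h^2" using \<open>0 < e\<close> h by simp
        ultimately show False by linarith
      qed
    qed (use t12 in auto)
    then show ?thesis by (simp add: algebra_simps)
  qed
  show ?thesis
  proof (rule field_le_epsilon)
    fix e :: real assume "0 < e"
    define e' where "e' = e / (3 * (t2 - t1 + 1))"
    have "0 < e'" using \<open>0 < e\<close> t12 by (simp add: e'_def)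
    have "3 * e' * (t2 - t1) \<le> e"
    proof -
      have "3 * e' * (t2 - t1) \<le> 3 * e' * (t2 - t1 + 1)" using \<open>0 < e'\<close> by (intro mult_left_mono) auto
      also have "\<dots> = e"
      proof -
        define w where "w = t2 - t1 + 1"
        have "w \<noteq> 0" using t12 by (simp add: w_def)
        then show ?thesis unfolding e'_def w_def[symmetric] by simp
      qed
      finally show ?thesis .
    qed
    then show "?g t2 \<le> ?g t1 - 2 * \<kappa> * (t2 - t1) + e" using main[OF \<open>0 < e'\<close>] by linarith
  qed
qed

text \<open>A Lipschitz constant of the single trajectory, from compactness of its range, suffices
  to make f nonincreasing along it. It therefore stays in the sublevel set, where the subgradient
  bound, and with it \<open>M\<close>, no longer depends on the trajectory.\<close>

lemma trajectory_in_sublevel: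
  fixes f :: "'a::euclidean_space \<Rightarrow> real"
  assumes lipf: "locally_lipschitz f" and semi: "semismooth_above f" and "0 < c"
    and compact: "compact {x. f x \<le> b}"
  shows "\<exists>M>0. \<forall>T y. 0 < T \<and> subgradient_trajectory f c T y \<and> f (y 0) \<le> b \<longrightarrow>
    (\<forall>s t. 0 \<le> s \<and> s \<le> t \<and> t \<le> T \<longrightarrow> f (y t) \<le> f (y s) \<and> norm (y t - y s) \<le> M * (t - s))"
proof -
  obtain L where L: "0 < L" "\<And>x s. f x \<le> b \<Longrightarrow> s \<in> clarke_subdiff f x \<Longrightarrow> norm s \<le> L"
    using clarke_subdiff_bounded_on_compact[OF compact lipf] by auto
  show ?thesis
  proof (intro exI[of _ "c * L"] conjI allI impI)
    show "0 < c * L" using \<open>0 < c\<close> L(1) by simp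
    fix T y s t
    assume "0 < T \<and> subgradient_trajectory f c T y \<and> f (y 0) \<le> b"
    then have T: "0 < T" and traj: "subgradient_trajectory f c T y" and y0: "f (y 0) \<le> b" by auto
    have conty: "continuous_on {0..T} y"
      using traj absolutely_continuous_on_imp_continuous_on unfolding subgradient_trajectory_def by blast
    then have "compact (y ` {0..T})" by (intro compact_continuous_image) auto
    from clarke_subdiff_bounded_on_compact[OF this lipf]
    obtain L' where L': "0 < L'" "\<And>t s. 0 \<le> t \<Longrightarrow> t \<le> T \<Longrightarrow> s \<in> clarke_subdiff f (y t) \<Longrightarrow> norm s \<le> L'"
      by fastforce
    have "continuous_on {0..T} (\<lambda>t. f (y t))"
      using continuous_on_compose2[OF locally_lipschitz_continuous[OF lipf] conty] by auto
    note decr = trajectory_decrease[OF traj \<open>0 < c\<close> semi this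
        trajectory_lipschitz[OF traj \<open>0 < c\<close> less_imp_le[OF L'(1)] L'(2)], where \<kappa> = 0]
    have mono: "f (y t) \<le> f (y s)" if st: "0 \<le> s" "s \<le> t" "t \<le> T" for s t
    proof -
      have "f (y t) \<le> f (y s) - 2 * 0 * (t - s)"
        by (rule decr) (use st L' \<open>0 < c\<close> zero_less_one in auto)
      then show ?thesis by simp
    qed
    assume st: "0 \<le> s \<and> s \<le> t \<and> t \<le> T"
    then show "f (y t) \<le> f (y s)" by (intro mono) auto
    show "norm (y t - y s) \<le> c * L * (t - s)"
    proof (rule trajectory_lipschitz[OF traj \<open>0 < c\<close>])
      fix \<tau> v assume "0 \<le> \<tau>" "\<tau> \<le> T" "v \<in> clarke_subdiff f (y \<tau>)"
      then show "norm v \<le> L" using mono[of 0 \<tau>] y0 by (intro L(2)) auto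
    qed (use st L(1) in auto)
  qed
qed

text \<open>A common direction \<open>d\<close> near \<open>y t\<close> makes every velocity
  \<open>- c v\<close> advance along \<open>d\<close> at rate at least \<open>c * \<nu>\<close>.
  This bounds the displacement from below and supplies \<open>speed\<close> in
  \<open>trajectory_decrease\<close>.\<close>

lemma trajectory_decrease_off_critical:
  fixes f :: "'a::euclidean_space \<Rightarrow> real"
  assumes lipf: "locally_lipschitz f" and semi: "semismooth_above f" and "0 < c"
    and compact: "compact {x. f x \<le> b}" and A: "compact A" "A \<inter> critical_points f = {}"
  shows "\<exists>\<kappa>>0. \<forall>T y t1 t2. 0 < T \<and> subgradient_trajectory f c T y \<and> f (y 0) \<le> b \<and>
    0 \<le> t1 \<and> t1 \<le> t2 \<and> t2 \<le> T \<and> (\<forall>t\<in>{t1..t2}. y t \<in> A) \<longrightarrow>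
    f (y t2) \<le> f (y t1) - \<kappa> * (t2 - t1)"
proof -
  obtain \<nu> where \<nu>: "0 < \<nu>" "\<And>x. x \<in> A \<Longrightarrow> \<exists>d \<delta>. 0 < \<delta> \<and> norm d \<le> 1 \<and>
           (\<forall>y s. norm (y - x) < \<delta> \<and> s \<in> clarke_subdiff f y \<longrightarrow> s \<bullet> d \<le> - \<nu>)"
    using uniform_descent[OF A] by blast
  obtain M where M: "0 < M" "\<And>T y s t. 0 < T \<Longrightarrow> subgradient_trajectory f c T y \<Longrightarrow> f (y 0) \<le> b \<Longrightarrow>
      0 \<le> s \<Longrightarrow> s \<le> t \<Longrightarrow> t \<le> T \<Longrightarrow> norm (y t - y s) \<le> M * (t - s)"
    using trajectory_in_sublevel[OF lipf semi \<open>0 < c\<close> compact] by blast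
  show ?thesis
  \<comment> \<open>A displacement of \<open>c * \<nu> * h\<close> corresponds to
    \<open>\<kappa> = c * \<nu>^2 / 2\<close>, and the rate of decrease is twice that.\<close>
  proof (intro exI[of _ "c * \<nu>^2"] conjI allI impI)
    show "0 < c * \<nu>^2" using \<open>0 < c\<close> \<nu>(1) by simp
    fix T y t1 t2
    assume H: "0 < T \<and> subgradient_trajectory f c T y \<and> f (y 0) \<le> b \<and>
      0 \<le> t1 \<and> t1 \<le> t2 \<and> t2 \<le> T \<and> (\<forall>t\<in>{t1..t2}. y t \<in> A)"
    then have traj: "subgradient_trajectory f c T y" by blast
    then have conty: "continuous_on {0..T} y" and acy: "absolutely_continuous_on 0 T y"
      using absolutely_continuous_on_imp_continuous_on unfolding subgradient_trajectory_def by blast+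
    have cont: "continuous_on {0..T} (\<lambda>t. f (y t))"
      using continuous_on_compose2[OF locally_lipschitz_continuous[OF lipf] conty] by auto
    have "f (y t2) \<le> f (y t1) - 2 * (c * \<nu>^2 / 2) * (t2 - t1)"
    proof (rule trajectory_decrease[OF traj \<open>0 < c\<close> semi cont _ M(1)])
      show "norm (y t - y s) \<le> M * (t - s)" if "0 \<le> s" "s \<le> t" "t \<le> T" for s t
        using M(2) H that by blast
      fix t assume t: "t1 \<le> t" "t < t2"
      then have "y t \<in> A" using H by auto
      then obtain d \<delta> where d: "0 < \<delta>" "norm d \<le> 1"
        "\<And>z s. norm (z - y t) < \<delta> \<Longrightarrow> s \<in> clarke_subdiff f z \<Longrightarrow> s \<bullet> d \<le> - \<nu>"
        using \<nu>(2) by blast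
      show "\<exists>h1>0. \<forall>h. 0 < h \<and> h < h1 \<and> t + h \<le> T \<longrightarrow>
          c * \<nu>^2 / 2 * h^2 \<le> (norm (y (t + h) - y t))^2 / (2 * c)"
      proof (intro exI[of _ "\<delta> / M"] conjI allI impI)
        show "0 < \<delta> / M" using d(1) M(1) by simp
        fix h assume h: "0 < h \<and> h < \<delta> / M \<and> t + h \<le> T"
        then have "M * h < \<delta>" using M(1) by (simp add: field_simps)
        have "(y (t + h) - y t) \<bullet> (- d) \<le> - (c * \<nu>) * (t + h - t)"
        proof (rule absolutely_continuous_on_inner_bound[OF acy])
          show "AE \<tau> in lebesgue. \<tau> \<in> {t..t + h} \<longrightarrow>
              (\<exists>v. (y has_vector_derivative v) (at \<tau> within {0..T}) \<and> v \<bullet> - d \<le> - (c * \<nu>))"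
            using traj[unfolded subgradient_trajectory_def, THEN conjunct2]
          proof eventually_elim
            case (elim \<tau>)
            show ?case
            proof
              assume \<tau>: "\<tau> \<in> {t..t + h}"
              then obtain v where v: "v \<in> clarke_subdiff f (y \<tau>)"
                "(y has_vector_derivative - c *\<^sub>R v) (at \<tau> within {0..T})" using elim t H h by auto
              have "norm (y \<tau> - y t) \<le> M * (\<tau> - t)" using \<tau> t H h by (intro M(2)[of T]) auto
              also have "\<dots> \<le> M * h" using \<tau> M(1) by auto
              finally have "norm (y \<tau> - y t) < \<delta>" using \<open>M * h < \<delta>\<close> by simp
              then have "v \<bullet> d \<le> - \<nu>" using d(3) v(1) by blast
              then have "c * (v \<bullet> d) \<le> c * - \<nu>" using \<open>0 < c\<close> by (intro mult_left_mono) auto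
              then have "(- c *\<^sub>R v) \<bullet> - d \<le> - (c * \<nu>)" by simp
              then show "\<exists>v. (y has_vector_derivative v) (at \<tau> within {0..T}) \<and> v \<bullet> - d \<le> - (c * \<nu>)"
                using v(2) by blast
            qed
          qed
        qed (use t H h in auto)
        then have "c * \<nu> * h \<le> (y (t + h) - y t) \<bullet> d" by simp
        also have "\<dots> \<le> norm (y (t + h) - y t) * norm d" by (rule norm_cauchy_schwarz)
        also have "\<dots> \<le> norm (y (t + h) - y t)" using d(2) by (simp add: mult_left_le)
        finally have "(c * \<nu> * h)^2 \<le> (norm (y (t + h) - y t))^2"
          using h \<open>0 < c\<close> \<nu>(1) by (intro power_mono) auto
        then have "(c * \<nu> * h)^2 / (2 * c) \<le> (norm (y (t + h) - y t))^2 / (2 * c)"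
          using \<open>0 < c\<close> by (intro divide_right_mono) auto
        moreover have "(c * \<nu> * h)^2 / (2 * c) = c * \<nu>^2 / 2 * h^2"
          using \<open>0 < c\<close> by (simp add: power2_eq_square)
        ultimately show "c * \<nu>^2 / 2 * h^2 \<le> (norm (y (t + h) - y t))^2 / (2 * c)" by simp
      qed
    qed (use H in auto)
    then show "f (y t2) \<le> f (y t1) - c * \<nu>^2 * (t2 - t1)" by simp
  qed
qed

subsection \<open>Shadowed sequences\<close>

text \<open>The approximation property for one sequence, with both compact sets equal to the
  sublevel set of \<open>b\<close>; \<open>j\<close> counts from the start \<open>k\<close> of a
  window.\<close>

definition shadowed :: "('a::euclidean_space \<Rightarrow> real) \<Rightarrow> real \<Rightarrow> real \<Rightarrow> real \<Rightarrow> real \<Rightarrow> real \<Rightarrow> (nat \<Rightarrow> 'a) \<Rightarrow> bool" where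
  "shadowed f c b T \<epsilon> \<alpha> x \<longleftrightarrow> (\<forall>k. (\<forall>i\<le>k. f (x i) \<le> b) \<longrightarrow>
     (\<exists>y. subgradient_trajectory f c T y \<and> f (y 0) \<le> b \<and>
        (\<forall>j \<le> nat \<lfloor>T / \<alpha>\<rfloor>. norm (x (k + j) - y (real j * \<alpha>)) \<le> \<epsilon>)))"

text \<open>What shadowing retains of the dynamics. A run that avoids the critical points is charged
  for elapsed time and for displacement, with one error \<open>\<omega>\<close> however long it is.
  The range \<open>i < k + j\<close> leaves the level of the last iterate open.\<close>

definition controlled :: "('a::euclidean_space \<Rightarrow> real) \<Rightarrow> real \<Rightarrow> real \<Rightarrow> real \<Rightarrow> real \<Rightarrow> real \<Rightarrow> (nat \<Rightarrow> 'a) \<Rightarrow> bool" where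
  "controlled f b \<rho> \<kappa> \<omega> \<alpha> x \<longleftrightarrow>
    (\<forall>k j. (\<forall>i<k + j. f (x i) \<le> b) \<and>
       (\<forall>i. k \<le> i \<and> i \<le> k + j \<longrightarrow> (\<forall>q\<in>critical_points f. f q \<le> b \<longrightarrow> \<rho> \<le> dist (x i) q)) \<longrightarrow>
       f (x (k + j)) + \<kappa> * (real j * \<alpha> + norm (x (k + j) - x k)) \<le> f (x k) + \<omega>) \<and>
    (\<forall>k. (\<forall>i\<le>k. f (x i) \<le> b) \<longrightarrow> norm (x (Suc k) - x k) \<le> \<omega> \<and> f (x (Suc k)) \<le> f (x k) + \<omega>)"

text \<open>Within one window the iterates follow a trajectory that decreases at a positive rate, up
  to \<open>\<omega>2\<close>. When windows are joined, half of the decrease over a full window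
  outweighs its error, so only the error of the last one remains; this halves the rate. The rate
  depends on \<open>\<rho>\<close> but is fixed before \<open>\<omega>\<close>.\<close>

lemma run_estimate:
  fixes f :: "'a::euclidean_space \<Rightarrow> real"
  assumes lipf: "locally_lipschitz f" and semi: "semismooth_above f" and "0 < c"
    and compact: "compact {x. f x \<le> b}" and "0 < T" "0 < \<rho>"
  shows "\<exists>\<kappa>>0. \<forall>\<omega>>0. \<exists>\<epsilon>>0. \<exists>\<alpha>0>0. \<forall>\<alpha> x. 0 < \<alpha> \<and> \<alpha> \<le> \<alpha>0 \<and> shadowed f c b T \<epsilon> \<alpha> x \<longrightarrow>
    controlled f b \<rho> \<kappa> \<omega> \<alpha> x"
proof -
  let ?Lev = "{x. f x \<le> b}"
  define Q where "Q = critical_points f \<inter> ?Lev"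
  have "compact Q" unfolding Q_def by (rule closed_Int_compact[OF closed_critical_points compact])
  \<comment> \<open>If the iterates keep distance \<open>\<rho>\<close>, the trajectory keeps
    \<open>\<rho> / 4\<close>: shadowing costs \<open>\<rho> / 2\<close>, the time between iterates
    \<open>\<rho> / 4\<close>.\<close>
  define A where "A = ?Lev \<inter> (\<Inter>q\<in>Q. - ball q (\<rho> / 4))"
  have "compact A"
    unfolding A_def by (intro compact_Int_closed compact closed_INT ballI closed_Compl open_ball)
  have A: "z \<in> A" if "f z \<le> b" "\<And>q. q \<in> Q \<Longrightarrow> \<rho> / 4 \<le> dist z q" for z
    using that by (fastforce simp: A_def dist_commute)
  have "A \<inter> critical_points f = {}"
  proof (intro equals0I)
    fix z assume z: "z \<in> A \<inter> critical_points f"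
    then have "z \<in> Q" by (auto simp: A_def Q_def)
    then have "z \<notin> ball z (\<rho> / 4)" using z unfolding A_def by blast
    then show False using \<open>0 < \<rho>\<close> by simp
  qed
  from trajectory_decrease_off_critical[OF lipf semi \<open>0 < c\<close> compact \<open>compact A\<close> this]
  obtain \<kappa>0 where \<kappa>0: "0 < \<kappa>0" "\<And>T y t1 t2. 0 < T \<Longrightarrow> subgradient_trajectory f c T y \<Longrightarrow> f (y 0) \<le> b \<Longrightarrow>
      0 \<le> t1 \<Longrightarrow> t1 \<le> t2 \<Longrightarrow> t2 \<le> T \<Longrightarrow> (\<forall>t\<in>{t1..t2}. y t \<in> A) \<Longrightarrow> f (y t2) \<le> f (y t1) - \<kappa>0 * (t2 - t1)"
    by blast
  obtain M where M: "0 < M" "\<And>T y s t. 0 < T \<Longrightarrow> subgradient_trajectory f c T y \<Longrightarrow> f (y 0) \<le> b \<Longrightarrow>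
      0 \<le> s \<Longrightarrow> s \<le> t \<Longrightarrow> t \<le> T \<Longrightarrow> f (y t) \<le> f (y s) \<and> norm (y t - y s) \<le> M * (t - s)"
    using trajectory_in_sublevel[OF lipf semi \<open>0 < c\<close> compact] by blast
  \<comment> \<open>Time plus displacement is at most \<open>1 + M\<close> times the time, so this
    rate can charge for both.\<close>
  define \<kappa>1 where "\<kappa>1 = \<kappa>0 / (1 + M)"
  have \<kappa>1: "0 < \<kappa>1" "\<kappa>1 * (1 + M) = \<kappa>0" using \<kappa>0(1) M(1) by (auto simp: \<kappa>1_def)
  \<comment> \<open>Iterates may lie slightly outside the sublevel set, so uniform continuity of f
    is arranged on its unit neighbourhood.\<close>
  define N where "N = {u + v | u v. u \<in> ?Lev \<and> v \<in> cball (0::'a) 1}"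
  have "compact N" unfolding N_def by (intro compact_sums compact compact_cball)
  then have unif: "uniformly_continuous_on N f"
    by (intro compact_uniformly_continuous continuous_on_subset[OF locally_lipschitz_continuous[OF lipf]]) auto
  have NI: "z \<in> N" if "f u \<le> b" "norm (z - u) \<le> 1" for z u
  proof -
    have "z = u + (z - u) \<and> u \<in> ?Lev \<and> z - u \<in> cball 0 1" using that by (simp add: dist_norm norm_minus_commute)
    then show ?thesis unfolding N_def by blast
  qed
  have tri3: "norm (u + v - w) \<le> norm u + norm v + norm w" for u v w :: 'a
    using norm_triangle_ineq4[of "u + v" w] norm_triangle_ineq[of u v] by linarith
  show ?thesis
  proof (rule exI[of _ "\<kappa>1 / 2"], rule conjI, use \<kappa>1 in simp, intro allI impI)
    fix \<omega> :: real assume "0 < \<omega>"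
    \<comment> \<open>A full window lasts at least \<open>T / 2\<close>, so
      \<open>\<kappa>1 * T / 4\<close> is what it can pay from half of its decrease.\<close>
    define \<omega>2 where "\<omega>2 = min \<omega> (\<kappa>1 * T / 4)"
    have \<omega>2: "0 < \<omega>2" "\<omega>2 \<le> \<omega>" "\<omega>2 \<le> \<kappa>1 * T / 4" using \<open>0 < \<omega>\<close> \<kappa>1(1) \<open>0 < T\<close> by (auto simp: \<omega>2_def)
    obtain e1 where e1: "0 < e1" "\<And>u v. u \<in> N \<Longrightarrow> v \<in> N \<Longrightarrow> dist u v < e1 \<Longrightarrow> dist (f u) (f v) < \<omega>2 / 4"
    proof -
      have "0 < \<omega>2 / 4" using \<omega>2(1) by simp
      then show thesis
        using unif[unfolded uniformly_continuous_on_def, rule_format, of "\<omega>2 / 4"] that by (metis dist_commute)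
    qed
    \<comment> \<open>The change of f at each end of a window costs a quarter of
      \<open>\<omega>2\<close>, the displacement error \<open>2 * \<epsilon>\<close> the remaining
      half.\<close>
    define \<epsilon> where "\<epsilon> = Min {\<rho> / 2, 1, e1 / 2, \<omega>2 / (4 * \<kappa>1), \<omega> / 4}"
    have \<epsilon>: "0 < \<epsilon>" "\<epsilon> \<le> \<rho> / 2" "\<epsilon> \<le> 1" "\<epsilon> \<le> e1 / 2" "\<epsilon> \<le> \<omega>2 / (4 * \<kappa>1)" "\<epsilon> \<le> \<omega> / 4"
      using \<open>0 < \<rho>\<close> e1(1) \<omega>2(1) \<kappa>1(1) \<open>0 < \<omega>\<close> by (simp_all add: \<epsilon>_def)
    define \<alpha>0 where "\<alpha>0 = Min {T / 2, \<rho> / (4 * M), \<omega> / (2 * M)}"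
    have \<alpha>0: "0 < \<alpha>0" "\<alpha>0 \<le> T / 2" "\<alpha>0 \<le> \<rho> / (4 * M)" "\<alpha>0 \<le> \<omega> / (2 * M)"
      using \<open>0 < T\<close> \<open>0 < \<rho>\<close> M(1) \<open>0 < \<omega>\<close> by (simp_all add: \<alpha>0_def)
    show "\<exists>\<epsilon>>0. \<exists>\<alpha>0>0. \<forall>\<alpha> x. 0 < \<alpha> \<and> \<alpha> \<le> \<alpha>0 \<and> shadowed f c b T \<epsilon> \<alpha> x \<longrightarrow>
      controlled f b \<rho> (\<kappa>1 / 2) \<omega> \<alpha> x"
    proof (rule exI[of _ \<epsilon>], rule conjI[OF \<epsilon>(1)], rule exI[of _ \<alpha>0], rule conjI[OF \<alpha>0(1)], intro allI impI)
      fix \<alpha> :: real and x :: "nat \<Rightarrow> 'a"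
      assume H: "0 < \<alpha> \<and> \<alpha> \<le> \<alpha>0 \<and> shadowed f c b T \<epsilon> \<alpha> x"
      define J where "J = nat \<lfloor>T / \<alpha>\<rfloor>"
      have \<alpha>: "0 < \<alpha>" "\<alpha> \<le> T / 2" "M * \<alpha> \<le> \<rho> / 4" "M * \<alpha> \<le> \<omega> / 2"
      proof -
        have "M * \<alpha> \<le> M * \<alpha>0" using H M(1) by (intro mult_left_mono) auto
        moreover have "M * \<alpha>0 \<le> \<rho> / 4" "M * \<alpha>0 \<le> \<omega> / 2" using \<alpha>0(3,4) M(1) by (auto simp: field_simps)
        ultimately show "M * \<alpha> \<le> \<rho> / 4" "M * \<alpha> \<le> \<omega> / 2" by linarith+
      qed (use H \<alpha>0(2) in auto)
      have "2 \<le> T / \<alpha>" using \<alpha>(1,2) by (simp add: field_simps)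
      then have J: "real J \<le> T / \<alpha>" "T / \<alpha> - 1 \<le> real J" "1 \<le> J"
        unfolding J_def by linarith+
      then have J\<alpha>: "real J * \<alpha> \<le> T" "T / 2 \<le> real J * \<alpha>"
        using \<alpha>(1,2) by (auto simp: field_simps)
      have window: "\<exists>y. subgradient_trajectory f c T y \<and> f (y 0) \<le> b \<and>
          (\<forall>j\<le>J. norm (x (k + j) - y (real j * \<alpha>)) \<le> \<epsilon>)" if "\<forall>i\<le>k. f (x i) \<le> b" for k
        using H that unfolding shadowed_def J_def by blast
      have jT: "real j * \<alpha> \<le> T" if "j \<le> J" for j
        by (rule order_trans[OF mult_right_mono J\<alpha>(1)]) (use that \<alpha>(1) in auto)
      have close: "\<bar>f (x (k + j)) - f (y (real j * \<alpha>))\<bar> \<le> \<omega>2 / 4"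
        if y: "subgradient_trajectory f c T y" "f (y 0) \<le> b" "\<forall>j\<le>J. norm (x (k + j) - y (real j * \<alpha>)) \<le> \<epsilon>" "j \<le> J" for k j y
      proof -
        have "f (y (real j * \<alpha>)) \<le> f (y 0)" using M(2)[OF \<open>0 < T\<close> y(1,2), of 0] jT[OF y(4)] \<alpha>(1) by simp
        then have "f (y (real j * \<alpha>)) \<le> b" using y(2) by simp
        moreover have nn: "norm (x (k + j) - y (real j * \<alpha>)) \<le> \<epsilon>" using y(3,4) by blast
        ultimately have "x (k + j) \<in> N" "y (real j * \<alpha>) \<in> N" using \<epsilon>(3) by (auto intro!: NI[of "y (real j * \<alpha>)"])
        moreover have "dist (x (k + j)) (y (real j * \<alpha>)) < e1" using nn \<epsilon>(4) e1(1) by (simp add: dist_norm)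
        ultimately show ?thesis using e1(2) by (fastforce simp: dist_real_def)
      qed
      have chunk: "f (x (k + j)) + \<kappa>1 * (real j * \<alpha> + norm (x (k + j) - x k)) \<le> f (x k) + \<omega>2"
        if j: "j \<le> J" and lev: "\<forall>i\<le>k. f (x i) \<le> b"
          and far: "\<And>i q. k \<le> i \<Longrightarrow> i \<le> k + j \<Longrightarrow> q \<in> Q \<Longrightarrow> \<rho> \<le> dist (x i) q" for k j
      proof -
        obtain y where y: "subgradient_trajectory f c T y" "f (y 0) \<le> b"
          "\<forall>j\<le>J. norm (x (k + j) - y (real j * \<alpha>)) \<le> \<epsilon>" using window[OF lev] by blast
        have inA: "y t \<in> A" if t: "t \<in> {0..real j * \<alpha>}" for t
        proof (rule A)
          define i where "i = nat \<lfloor>t / \<alpha>\<rfloor>"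
          have t0: "0 \<le> t / \<alpha>" using t \<alpha>(1) by simp
          then have "real i \<le> t / \<alpha>" "t / \<alpha> \<le> real i + 1" unfolding i_def by linarith+
          then have i: "real i * \<alpha> \<le> t" "t - real i * \<alpha> \<le> \<alpha>" using \<alpha>(1) by (auto simp: field_simps)
          have "t / \<alpha> \<le> real j" using t \<alpha>(1) by (simp add: field_simps)
          then have "i \<le> j" using \<open>real i \<le> t / \<alpha>\<close> by linarith
          have tT: "0 \<le> t" "t \<le> T" using t jT[OF j] by auto
          show "f (y t) \<le> b" using M(2)[OF \<open>0 < T\<close> y(1,2) order_refl tT] y(2) by linarith
          fix q assume q: "q \<in> Q"
          have "\<rho> \<le> dist (x (k + i)) q" using far[of "k + i" q] \<open>i \<le> j\<close> q by simp
          also have "\<dots> \<le> norm (x (k + i) - y (real i * \<alpha>)) + norm (y t - y (real i * \<alpha>)) + dist (y t) q"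
            by (metis (no_types) add.commute add_left_mono dist_commute dist_norm dist_triangle dist_triangle_le add.assoc)
          also have "norm (x (k + i) - y (real i * \<alpha>)) \<le> \<epsilon>" using y(3) \<open>i \<le> j\<close> j by simp
          also have "norm (y t - y (real i * \<alpha>)) \<le> M * \<alpha>"
          proof -
            have "norm (y t - y (real i * \<alpha>)) \<le> M * (t - real i * \<alpha>)"
              using M(2)[OF \<open>0 < T\<close> y(1,2) _ i(1) tT(2)] \<alpha>(1) by simp
            also have "\<dots> \<le> M * \<alpha>" using i(2) M(1) by (intro mult_left_mono) auto
            finally show ?thesis .
          qed
          finally show "\<rho> / 4 \<le> dist (y t) q" using \<epsilon>(2) \<alpha>(3) by linarith
        qed
        have "0 \<le> real j * \<alpha>" using \<alpha>(1) by simp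
        have d: "f (y (real j * \<alpha>)) \<le> f (y 0) - \<kappa>0 * (real j * \<alpha> - 0)"
          by (rule \<kappa>0(2)[OF \<open>0 < T\<close> y(1,2) order_refl \<open>0 \<le> real j * \<alpha>\<close> jT[OF j]]) (use inA in blast)
        have "norm (y (real j * \<alpha>) - y 0) \<le> M * (real j * \<alpha> - 0)"
          using M(2)[OF \<open>0 < T\<close> y(1,2) order_refl \<open>0 \<le> real j * \<alpha>\<close> jT[OF j]] by blast
        then have "\<kappa>1 * (real j * \<alpha> + norm (y (real j * \<alpha>) - y 0)) \<le> \<kappa>1 * ((1 + M) * (real j * \<alpha>))"
          using \<kappa>1(1) by (intro mult_left_mono) (auto simp: algebra_simps)
        also have "\<dots> = \<kappa>0 * (real j * \<alpha>)" using \<kappa>1(2) by (metis mult.assoc)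
        finally have 1: "f (y (real j * \<alpha>)) + \<kappa>1 * (real j * \<alpha> + norm (y (real j * \<alpha>) - y 0)) \<le> f (y 0)"
          using d by simp
        have e: "norm (x (k + j) - y (real j * \<alpha>)) \<le> \<epsilon>" "norm (x k - y 0) \<le> \<epsilon>"
          using y(3) j by (auto dest: spec[of _ 0])
        have "x (k + j) - x k = (x (k + j) - y (real j * \<alpha>)) + (y (real j * \<alpha>) - y 0) - (x k - y 0)" by simp
        then have "norm (x (k + j) - x k) \<le> norm (x (k + j) - y (real j * \<alpha>)) + norm (y (real j * \<alpha>) - y 0) + norm (x k - y 0)"
          using tri3 by metis
        then have "\<kappa>1 * norm (x (k + j) - x k) \<le> \<kappa>1 * (norm (y (real j * \<alpha>) - y 0) + 2 * \<epsilon>)"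
          using e \<kappa>1(1) by (intro mult_left_mono) auto
        moreover have "\<kappa>1 * \<epsilon> \<le> \<omega>2 / 4" using \<epsilon>(5) \<kappa>1(1) by (simp add: field_simps)
        moreover have "\<bar>f (x (k + j)) - f (y (real j * \<alpha>))\<bar> \<le> \<omega>2 / 4" by (rule close[OF y j])
        moreover have "\<bar>f (x k) - f (y 0)\<bar> \<le> \<omega>2 / 4" using close[OF y, of 0] by simp
        ultimately show ?thesis using 1 unfolding distrib_left by linarith
      qed
      \<comment> \<open>Full windows are peeled off from the front; \<open>1 \<le> J\<close> makes
        the rest shorter.\<close>
      have run: "f (x (k + j)) + \<kappa>1 / 2 * (real j * \<alpha> + norm (x (k + j) - x k)) \<le> f (x k) + \<omega>2"
        if "\<forall>i<k + j. f (x i) \<le> b"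
          and "\<And>i q. k \<le> i \<Longrightarrow> i \<le> k + j \<Longrightarrow> q \<in> Q \<Longrightarrow> \<rho> \<le> dist (x i) q" for k j
        using that
      proof (induction j arbitrary: k rule: less_induct)
        case (less j)
        show ?case
        proof (cases "j = 0")
          case True
          then show ?thesis using \<omega>2(1) by simp
        next
          case False
          then have lev: "\<forall>i\<le>k. f (x i) \<le> b" using less.prems(1) by simp
          show ?thesis
          proof (cases "j \<le> J")
            case True
            have "f (x (k + j)) + \<kappa>1 * (real j * \<alpha> + norm (x (k + j) - x k)) \<le> f (x k) + \<omega>2"
              by (rule chunk[OF True lev less.prems(2)])
            moreover have "0 \<le> \<kappa>1 / 2 * (real j * \<alpha> + norm (x (k + j) - x k))"
              using \<kappa>1(1) \<alpha>(1) by simp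
            ultimately show ?thesis by (simp add: algebra_simps)
          next
            case False
            have 1: "f (x (k + J)) + \<kappa>1 * (real J * \<alpha> + norm (x (k + J) - x k)) \<le> f (x k) + \<omega>2"
              by (rule chunk[OF order_refl lev]) (use less.prems(2) False in auto)
            have "f (x (k + J + (j - J))) + \<kappa>1 / 2 * (real (j - J) * \<alpha> + norm (x (k + J + (j - J)) - x (k + J)))
                \<le> f (x (k + J)) + \<omega>2"
              by (rule less.IH) (use less.prems False J(3) in auto)
            moreover have "k + J + (j - J) = k + j" "real (j - J) = real j - real J" using False by auto
            ultimately have 2: "f (x (k + j)) + \<kappa>1 / 2 * ((real j - real J) * \<alpha> + norm (x (k + j) - x (k + J)))
                \<le> f (x (k + J)) + \<omega>2" by simp
            have "\<omega>2 \<le> \<kappa>1 / 2 * (T / 2)" using \<omega>2(3) by simp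
            also have "\<dots> \<le> \<kappa>1 / 2 * (real J * \<alpha>)" using J\<alpha>(2) \<kappa>1(1) by (intro mult_left_mono) auto
            finally have 3: "\<omega>2 \<le> \<kappa>1 / 2 * (real J * \<alpha>)" .
            have "norm (x (k + j) - x k) \<le> norm (x (k + j) - x (k + J)) + norm (x (k + J) - x k)"
              by (metis norm_triangle_ineq diff_add_cancel add_diff_eq)
            then have 4: "\<kappa>1 / 2 * norm (x (k + j) - x k) \<le> \<kappa>1 / 2 * norm (x (k + j) - x (k + J)) + \<kappa>1 / 2 * norm (x (k + J) - x k)"
              using \<kappa>1(1) by (simp flip: distrib_left)
            have 5: "0 \<le> \<kappa>1 / 2 * norm (x (k + J) - x k)" using \<kappa>1(1) by simp
            have "\<kappa>1 * (real J * \<alpha> + norm (x (k + J) - x k)) = 2 * (\<kappa>1 / 2 * (real J * \<alpha>)) + 2 * (\<kappa>1 / 2 * norm (x (k + J) - x k))"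
              by (simp add: algebra_simps)
            moreover have "\<kappa>1 / 2 * ((real j - real J) * \<alpha> + norm (x (k + j) - x (k + J))) =
                \<kappa>1 / 2 * (real j * \<alpha>) - \<kappa>1 / 2 * (real J * \<alpha>) + \<kappa>1 / 2 * norm (x (k + j) - x (k + J))"
              by (simp add: algebra_simps)
            moreover have "\<kappa>1 / 2 * (real j * \<alpha> + norm (x (k + j) - x k)) = \<kappa>1 / 2 * (real j * \<alpha>) + \<kappa>1 / 2 * norm (x (k + j) - x k)"
              by (simp add: algebra_simps)
            ultimately show ?thesis using 1 2 3 4 5 by linarith
          qed
        qed
      qed
      show "controlled f b \<rho> (\<kappa>1 / 2) \<omega> \<alpha> x"
        unfolding controlled_def
      proof (intro conjI allI impI)
        fix k j
        assume "(\<forall>i<k + j. f (x i) \<le> b) \<and>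
         (\<forall>i. k \<le> i \<and> i \<le> k + j \<longrightarrow> (\<forall>q\<in>critical_points f. f q \<le> b \<longrightarrow> \<rho> \<le> dist (x i) q))"
        then have "f (x (k + j)) + \<kappa>1 / 2 * (real j * \<alpha> + norm (x (k + j) - x k)) \<le> f (x k) + \<omega>2"
          by (intro run) (auto simp: Q_def)
        then show "f (x (k + j)) + \<kappa>1 / 2 * (real j * \<alpha> + norm (x (k + j) - x k)) \<le> f (x k) + \<omega>"
          using \<omega>2(2) by linarith
      next
        fix k assume lev: "\<forall>i\<le>k. f (x i) \<le> b"
        obtain y where y: "subgradient_trajectory f c T y" "f (y 0) \<le> b"
          "\<forall>j\<le>J. norm (x (k + j) - y (real j * \<alpha>)) \<le> \<epsilon>" using window[OF lev] by blast
        have "norm (x (k + 0) - y (real 0 * \<alpha>)) \<le> \<epsilon>" "norm (x (k + 1) - y (real 1 * \<alpha>)) \<le> \<epsilon>"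
          using y(3) J(3) by blast+
        then have e: "norm (x k - y 0) \<le> \<epsilon>" "norm (x (Suc k) - y \<alpha>) \<le> \<epsilon>" by auto
        have \<alpha>T: "0 \<le> \<alpha>" "\<alpha> \<le> T" using jT[OF J(3)] \<alpha>(1) by auto
        have m: "f (y \<alpha>) \<le> f (y 0)" "norm (y \<alpha> - y 0) \<le> M * (\<alpha> - 0)"
          using M(2)[OF \<open>0 < T\<close> y(1,2) order_refl \<alpha>T] by auto
        have "x (Suc k) - x k = (x (Suc k) - y \<alpha>) + (y \<alpha> - y 0) - (x k - y 0)" by simp
        then have "norm (x (Suc k) - x k) \<le> norm (x (Suc k) - y \<alpha>) + norm (y \<alpha> - y 0) + norm (x k - y 0)"
          using tri3 by metis
        then show "norm (x (Suc k) - x k) \<le> \<omega>" using e m(2) \<epsilon>(6) \<alpha>(4) by simp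
        have "\<bar>f (x (Suc k)) - f (y \<alpha>)\<bar> \<le> \<omega>2 / 4" "\<bar>f (x k) - f (y 0)\<bar> \<le> \<omega>2 / 4"
          using close[OF y, of 1] close[OF y, of 0] J(3) by auto
        then show "f (x (Suc k)) \<le> f (x k) + \<omega>" using m(1) \<omega>2(1,2) by linarith
      qed
    qed
  qed
qed

section \<open>Sequences that decrease up to small errors\<close>

text \<open>After the last index \<open>m \<le> n\<close> with value at most \<open>a\<close>, the
  iterates lie in the band above \<open>a\<close> and hence away from \<open>Q\<close>. One step to
  \<open>m + 1\<close>, one run to \<open>n\<close> and one step to \<open>n + 1\<close> raise f by
  at most \<open>3 * \<omega>\<close>.\<close>

lemma sublevel_invariant:
  fixes x :: "nat \<Rightarrow> 'a::metric_space" and f :: "'a \<Rightarrow> real"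
  assumes start: "f (x 0) \<le> a" and "a \<le> b" "0 \<le> \<omega>" "3 * \<omega> \<le> b - a"
    and step: "\<And>k. (\<forall>i\<le>k. f (x i) \<le> b) \<Longrightarrow> f (x (Suc k)) \<le> f (x k) + \<omega>"
    and run: "\<And>k j. (\<forall>i<k + j. f (x i) \<le> b) \<Longrightarrow> (\<forall>i. k \<le> i \<and> i \<le> k + j \<longrightarrow> (\<forall>q\<in>Q. \<rho> \<le> dist (x i) q)) \<Longrightarrow>
       f (x (k + j)) \<le> f (x k) + \<omega>"
    and far: "\<And>i q. a < f (x i) \<Longrightarrow> f (x i) \<le> b \<Longrightarrow> q \<in> Q \<Longrightarrow> \<rho> \<le> dist (x i) q"
  shows "f (x k) \<le> b"
proof (induction k rule: less_induct)
  case (less k)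
  show ?case
  proof (cases k)
    case 0
    then show ?thesis using start \<open>a \<le> b\<close> by simp
  next
    case (Suc n)
    then have lev: "\<forall>i\<le>n. f (x i) \<le> b" using less by auto
    let ?I = "{i. i \<le> n \<and> f (x i) \<le> a}"
    have "finite ?I" by simp
    moreover have "0 \<in> ?I" using start by simp
    ultimately have m: "Max ?I \<in> ?I" "\<And>i. i \<in> ?I \<Longrightarrow> i \<le> Max ?I"
      using Max_in[of ?I] Max_ge[of ?I] by blast+
    define m where "m = Max ?I"
    have m: "m \<le> n" "f (x m) \<le> a" "\<And>i. m < i \<Longrightarrow> i \<le> n \<Longrightarrow> a < f (x i)"
      using m unfolding m_def[symmetric] by force+
    have last: "f (x k) \<le> f (x n) + \<omega>" using step[OF lev] Suc by simp
    show ?thesis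
    proof (cases "m = n")
      case True
      then show ?thesis using last m(2) assms(2-4) by simp
    next
      case False
      then have mn: "Suc m \<le> n" using m(1) by simp
      have "f (x (Suc m + (n - Suc m))) \<le> f (x (Suc m)) + \<omega>"
      proof (rule run)
        show "\<forall>i<Suc m + (n - Suc m). f (x i) \<le> b" using lev mn by auto
        show "\<forall>i. Suc m \<le> i \<and> i \<le> Suc m + (n - Suc m) \<longrightarrow> (\<forall>q\<in>Q. \<rho> \<le> dist (x i) q)"
          using far m(3) lev mn by auto
      qed
      then have "f (x n) \<le> f (x (Suc m)) + \<omega>" using mn by simp
      moreover have "f (x (Suc m)) \<le> f (x m) + \<omega>" using lev m(1) by (intro step) auto
      ultimately show ?thesis using last m(2) assms(4) by linarith
    qed
  qed
qed

text \<open>The radius \<open>\<rho>\<close> defines visits to \<open>Q\<close>, at which f is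
  within \<open>\<delta>\<close> of a critical value; the radius \<open>\<epsilon>\<close> is the
  one to be kept. Values at consecutive visits cannot rise across the gaps. If they agree, the label
  persists: to get away, the iterates would travel \<open>\<epsilon> / 2\<close> while at least
  \<open>\<epsilon> / 4\<close> from \<open>Q\<close>, at a cost of \<open>8 * \<delta>\<close>. As
  there are finitely many values, the visits settle on a least one.\<close>

lemma eventually_near_one_class:
  fixes x :: "nat \<Rightarrow> 'a::real_normed_vector" and f :: "'a \<Rightarrow> real" and lab :: "'a \<Rightarrow> 'b"
  assumes fin: "finite (f ` Q)"
    and D: "\<And>p q. p \<in> Q \<Longrightarrow> q \<in> Q \<Longrightarrow> dist p q < D \<Longrightarrow> lab p = lab q \<and> f p = f q"
    and \<epsilon>: "0 < \<epsilon>" "4 * \<epsilon> \<le> D"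
    and \<delta>: "0 < \<delta>" "\<And>p q. p \<in> Q \<Longrightarrow> q \<in> Q \<Longrightarrow> f p < f q + 4 * \<delta> \<Longrightarrow> f p \<le> f q"
    and \<rho>: "0 < \<rho>" "\<rho> \<le> \<epsilon> / 8"
    and near: "\<And>i q. q \<in> Q \<Longrightarrow> dist (x i) q < \<rho> \<Longrightarrow> \<bar>f (x i) - f q\<bar> < \<delta>"
    and \<omega>: "0 < \<omega>" "\<omega> \<le> \<delta> / 8" "\<omega> \<le> \<epsilon> / 8"
    and step: "\<And>k. norm (x (Suc k) - x k) \<le> \<omega>" "\<And>k. f (x (Suc k)) \<le> f (x k) + \<omega>"
    and \<kappa>: "0 < \<kappa>1" "16 * \<delta> \<le> \<kappa>1 * \<epsilon>" "0 < \<kappa>2"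
    and run1: "\<And>k j. (\<forall>i. k \<le> i \<and> i \<le> k + j \<longrightarrow> (\<forall>q\<in>Q. \<epsilon> / 4 \<le> dist (x i) q)) \<Longrightarrow>
      f (x (k + j)) + \<kappa>1 * norm (x (k + j) - x k) \<le> f (x k) + \<omega>"
    and run2: "\<And>k j. (\<forall>i. k \<le> i \<and> i \<le> k + j \<longrightarrow> (\<forall>q\<in>Q. \<rho> \<le> dist (x i) q)) \<Longrightarrow>
      f (x (k + j)) + \<kappa>2 * real j \<le> f (x k) + \<omega>"
    and below: "\<And>k. m \<le> f (x k)"
  shows "\<exists>p\<in>Q. \<exists>k0. \<forall>k\<ge>k0. \<exists>q\<in>Q. lab q = lab p \<and> dist (x k) q < \<epsilon>"
proof -
  define V where "V k \<longleftrightarrow> (\<exists>q\<in>Q. dist (x k) q < \<rho>)" for k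
  \<comment> \<open>Without another visit f would decrease linearly in the index, against the lower
    bound.\<close>
  have infV: "\<exists>k'\<ge>k. V k'" for k
  proof (rule ccontr)
    assume neg: "\<not> ?thesis"
    obtain j :: nat where j: "(f (x k) + \<omega> - m) / \<kappa>2 < real j" using reals_Archimedean2 by blast
    have "f (x (k + j)) + \<kappa>2 * real j \<le> f (x k) + \<omega>"
      by (rule run2) (use neg in \<open>auto simp: V_def not_less\<close>)
    moreover have "f (x k) + \<omega> - m < \<kappa>2 * real j" using j \<kappa>(3) by (simp add: field_simps)
    ultimately show False using below[of "k + j"] by linarith
  qed
  define nr where "nr k = (SOME q. q \<in> Q \<and> dist (x k) q < \<rho>)" for k
  have nr: "nr k \<in> Q" "dist (x k) (nr k) < \<rho>" "\<bar>f (x k) - f (nr k)\<bar> < \<delta>" if "V k" for k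
  proof -
    have "\<exists>q. q \<in> Q \<and> dist (x k) q < \<rho>" using that unfolding V_def by blast
    from someI_ex[OF this] have "nr k \<in> Q \<and> dist (x k) (nr k) < \<rho>" unfolding nr_def .
    then show "nr k \<in> Q" "dist (x k) (nr k) < \<rho>" "\<bar>f (x k) - f (nr k)\<bar> < \<delta>" using near by auto
  qed
  have visit: "f (nr k') \<le> f (nr k) \<and> (f (nr k') = f (nr k) \<longrightarrow> lab (nr k') = lab (nr k) \<and>
      (\<forall>m. k \<le> m \<and> m \<le> k' \<longrightarrow> (\<exists>q\<in>Q. lab q = lab (nr k) \<and> dist (x m) q < \<epsilon>)))"
    if V: "V k" "V k'" "k < k'" and between: "\<And>i. k < i \<Longrightarrow> i < k' \<Longrightarrow> \<not> V i" for k k'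
  proof -
    have runB: "f (x j) \<le> f (x i) + \<omega>" if "k < i" "i \<le> j" "j < k'" for i j
    proof -
      have "f (x (i + (j - i))) + \<kappa>2 * real (j - i) \<le> f (x i) + \<omega>"
        by (rule run2) (use that between in \<open>auto simp: V_def not_less\<close>)
      moreover have "0 \<le> \<kappa>2 * real (j - i)" using \<kappa>(3) by simp
      ultimately show ?thesis using that by simp
    qed
    have down: "f (x k') \<le> f (x i) + 2 * \<omega>" if i: "k < i" "i \<le> k'" for i
    proof (cases "i = k'")
      case False
      then have "f (x (k' - 1)) \<le> f (x i) + \<omega>" using i by (intro runB) auto
      moreover have "f (x k') \<le> f (x (k' - 1)) + \<omega>" using step(2)[of "k' - 1"] i by simp
      ultimately show ?thesis by simp
    qed (use \<omega> in simp)
    \<comment> \<open>A step out of the visit, a run without visits and a step into the next one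
      cost \<open>\<omega>\<close> each.\<close>
    have up: "f (x i) \<le> f (x k) + 3 * \<omega>" if i: "k < i" "i \<le> k'" for i
    proof (cases "i < k'")
      case True
      have "f (x i) \<le> f (x (Suc k)) + \<omega>" using i True by (intro runB) auto
      then show ?thesis using step(2)[of k] \<omega>(1) by simp
    next
      case False
      then have "i = k'" using i by simp
      then have "f (x i) \<le> f (x (Suc k)) + 2 * \<omega>" using i by (simp add: down)
      then show ?thesis using step(2)[of k] by simp
    qed
    note nk = nr[OF V(1)] and nk' = nr[OF V(2)]
    \<comment> \<open>A rise of \<open>3 * \<omega>\<close> and two deviations
      \<open>\<delta>\<close> stay below the gap \<open>4 * \<delta>\<close>.\<close>
    have "f (nr k') < f (nr k) + 4 * \<delta>" using up[of k'] V(3) nk(3) nk'(3) \<omega> by simp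
    then have mono: "f (nr k') \<le> f (nr k)" using \<delta>(2) nk(1) nk'(1) by blast
    moreover have "lab (nr k') = lab (nr k) \<and>
      (\<forall>m. k \<le> m \<and> m \<le> k' \<longrightarrow> (\<exists>q\<in>Q. lab q = lab (nr k) \<and> dist (x m) q < \<epsilon>))"
      if eq: "f (nr k') = f (nr k)"
    proof -
      \<comment> \<open>\<open>P\<close> fixes the value as well as the label; the rest of
        \<open>Q\<close> is then at distance at least \<open>D\<close> from it.\<close>
      define P where "P = {q \<in> Q. lab q = lab (nr k) \<and> f q = f (nr k)}"
      have nkP: "nr k \<in> P" using nk(1) by (simp add: P_def)
      have sep: "D \<le> dist p q" if "p \<in> P" "q \<in> Q - P" for p q
        using D[of p q] that by (force simp: P_def)
      have close: "\<exists>q\<in>P. dist (x m) q < \<epsilon>" if "k \<le> m" "m \<le> k'" for m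
      proof (rule ccontr)
        let ?bad = "\<lambda>m. k \<le> m \<and> m \<le> k' \<and> \<not> (\<exists>q\<in>P. dist (x m) q < \<epsilon>)"
        assume "\<not> (\<exists>q\<in>P. dist (x m) q < \<epsilon>)"
        then have "?bad m" using that by blast
        \<comment> \<open>The first index far from \<open>P\<close>. With \<open>n\<close> below,
          the last index before it within \<open>\<epsilon> / 4\<close> of \<open>P\<close>, it
          encloses a run that stays away from all of \<open>Q\<close>.\<close>
        define l where "l = (LEAST m. ?bad m)"
        have l: "?bad l" unfolding l_def by (rule LeastI[of ?bad, OF \<open>?bad m\<close>])
        have l': "\<not> ?bad i" if "i < l" for i using not_less_Least[of i ?bad] that unfolding l_def by blast
        have "k \<noteq> l" using l nkP nk(2) \<rho> \<epsilon>(1) by force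
        then have "k < l" using l by simp
        let ?I = "{i. k \<le> i \<and> i < l \<and> (\<exists>q\<in>P. dist (x i) q < \<epsilon> / 4)}"
        have "finite ?I" by simp
        moreover have "k \<in> ?I" using \<open>k < l\<close> nkP nk(2) \<rho> \<epsilon>(1) by force
        ultimately have "Max ?I \<in> ?I" "\<And>i. i \<in> ?I \<Longrightarrow> i \<le> Max ?I"
          using Max_in[of ?I] Max_ge[of ?I] by blast+
        moreover define n where "n = Max ?I"
        ultimately have nI: "n \<in> ?I" "\<And>i. i \<in> ?I \<Longrightarrow> i \<le> n" by simp_all
        have n: "k \<le> n" "n < l" "\<exists>q\<in>P. dist (x n) q < \<epsilon> / 4"
          "\<And>i q. n < i \<Longrightarrow> i < l \<Longrightarrow> q \<in> P \<Longrightarrow> \<epsilon> / 4 \<le> dist (x i) q"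
        proof -
          show "k \<le> n" "n < l" "\<exists>q\<in>P. dist (x n) q < \<epsilon> / 4" using nI(1) by auto
          fix i q assume i: "n < i" "i < l" "q \<in> P"
          show "\<epsilon> / 4 \<le> dist (x i) q"
          proof (rule ccontr)
            assume "\<not> \<epsilon> / 4 \<le> dist (x i) q"
            then have "dist (x i) q < \<epsilon> / 4" by simp
            then have "\<exists>q\<in>P. dist (x i) q < \<epsilon> / 4" using i(3) by blast
            then have "i \<in> ?I" using i \<open>k \<le> n\<close> by simp
            then show False using nI(2) i(1) by fastforce
          qed
        qed
        obtain p where p: "p \<in> P" "dist (x n) p < \<epsilon> / 4" using n(3) by blast
        have sn: "dist (x (Suc i)) (x i) \<le> \<epsilon> / 8" for i using step(1)[of i] \<omega>(3) by (simp add: dist_norm)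
        have lp: "\<epsilon> \<le> dist (x l) q" if "q \<in> P" for q using l that by force
        have far: "\<epsilon> / 4 \<le> dist (x i) q" if i: "Suc n \<le> i" "i \<le> l" and q: "q \<in> Q" for i q
        proof (cases "q \<in> P")
          case True
          then show ?thesis using n(4)[of i q] lp[of q] i \<epsilon>(1) by (cases "i = l") auto
        next
          case False
          \<comment> \<open>The predecessor is within \<open>\<epsilon>\<close> of \<open>P\<close>
            and a step is at most \<open>\<epsilon> / 8\<close>, so points of \<open>Q\<close>
            outside \<open>P\<close> are still remote.\<close>
          have "\<not> ?bad (i - 1)" using l' i by simp
          then obtain p' where p': "p' \<in> P" "dist (x (i - 1)) p' < \<epsilon>" using i n(1) l by force
          have "D \<le> dist p' q" using sep p' q False by blast
          also have "\<dots> \<le> dist p' (x (i - 1)) + dist (x (i - 1)) (x i) + dist (x i) q"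
            using dist_triangle[of p' q "x i"] dist_triangle[of p' "x i" "x (i - 1)"] by linarith
          also have "dist (x (i - 1)) (x i) \<le> \<epsilon> / 8" using sn[of "i - 1"] i by (simp add: dist_commute)
          finally show ?thesis using p'(2) \<epsilon> by (simp add: dist_commute)
        qed
        have "f (x (Suc n + (l - Suc n))) + \<kappa>1 * norm (x (Suc n + (l - Suc n)) - x (Suc n)) \<le> f (x (Suc n)) + \<omega>"
          by (rule run1) (use far n(2) in auto)
        then have r: "f (x l) + \<kappa>1 * norm (x l - x (Suc n)) \<le> f (x (Suc n)) + \<omega>" using n(2) by simp
        have "\<epsilon> \<le> dist (x l) p" by (rule lp[OF p(1)])
        also have "\<dots> \<le> dist (x l) (x (Suc n)) + dist (x (Suc n)) (x n) + dist (x n) p"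
          using dist_triangle[of "x l" p "x (Suc n)"] dist_triangle[of "x (Suc n)" p "x n"] by linarith
        finally have "\<epsilon> / 2 \<le> norm (x l - x (Suc n))" using sn[of n] p(2) \<epsilon>(1) by (simp add: dist_norm)
        then have "\<kappa>1 * (\<epsilon> / 2) \<le> \<kappa>1 * norm (x l - x (Suc n))" using \<kappa>(1) by (intro mult_left_mono) auto
        then have "8 * \<delta> \<le> \<kappa>1 * norm (x l - x (Suc n))" using \<kappa>(2) by simp
        moreover have "f (x (Suc n)) \<le> f (x k) + 3 * \<omega>" using n l by (intro up) auto
        moreover have "f (x k') \<le> f (x l) + 2 * \<omega>" using \<open>k < l\<close> l by (intro down) auto
        \<comment> \<open>Six errors \<open>\<omega>\<close>: three up to \<open>n + 1\<close>, one
          for the run to \<open>l\<close>, two from there to \<open>k'\<close>.\<close>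
        ultimately have "f (x k') + 8 * \<delta> \<le> f (x k) + 6 * \<omega>" using r by linarith
        then show False using eq nk(3) nk'(3) \<omega> \<delta>(1) by linarith
      qed
      obtain q where q: "q \<in> P" "dist (x k') q < \<epsilon>" using close[of k'] V(3) by auto
      have "dist q (nr k') \<le> dist (x k') q + dist (x k') (nr k')"
        using dist_triangle[of q "nr k'" "x k'"] by (simp add: dist_commute)
      also have "\<dots> < D" using q(2) nk'(2) \<rho> \<epsilon> by linarith
      finally have "lab q = lab (nr k')" using D[of q "nr k'"] q(1) nk'(1) by (simp add: P_def)
      then show ?thesis using close q(1) by (force simp: P_def)
    qed
    ultimately show ?thesis by blast
  qed
  have finV: "finite ((\<lambda>k. f (nr k)) ` {k. V k})"
    by (rule finite_subset[OF _ fin]) (use nr(1) in auto)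
  have "(\<lambda>k. f (nr k)) ` {k. V k} \<noteq> {}" using infV[of 0] by blast
  \<comment> \<open>At a visit of least value the descent stops: all later visits share its value
    and, by \<open>visit\<close>, its label.\<close>
  from Min_in[OF finV this] obtain k0 where k0: "V k0" "f (nr k0) = Min ((\<lambda>k. f (nr k)) ` {k. V k})" by auto
  have k0_min: "f (nr k0) \<le> f (nr k)" if "V k" for k
    unfolding k0(2) using that by (intro Min_le[OF finV]) blast
  have prev: "\<exists>i. k0 \<le> i \<and> i \<le> n \<and> V i \<and> (\<forall>j. i < j \<longrightarrow> j \<le> n \<longrightarrow> \<not> V j)" if "k0 \<le> n" for n
  proof -
    let ?I = "{i. k0 \<le> i \<and> i \<le> n \<and> V i}"
    have "finite ?I" by simp
    moreover have "k0 \<in> ?I" using k0(1) that by simp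
    ultimately have "Max ?I \<in> ?I" "\<And>i. i \<in> ?I \<Longrightarrow> i \<le> Max ?I"
      using Max_in[of ?I] Max_ge[of ?I] by blast+
    moreover define i where "i = Max ?I"
    ultimately have i: "i \<in> ?I" "\<And>j. j \<in> ?I \<Longrightarrow> j \<le> i" by simp_all
    have "\<not> V j" if "i < j" "j \<le> n" for j
    proof
      assume "V j"
      then have "j \<in> ?I" using that i(1) by simp
      then show False using i(2) \<open>i < j\<close> by fastforce
    qed
    then show ?thesis using i(1) by blast
  qed
  have const: "f (nr k) = f (nr k0) \<and> lab (nr k) = lab (nr k0)" if "k0 \<le> k" "V k" for k
    using that
  proof (induction k rule: less_induct)
    case (less k)
    show ?case
    proof (cases "k = k0")
      case False
      then have "k0 \<le> k - 1" using less.prems(1) by linarith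
      from prev[OF this] obtain i where i: "k0 \<le> i" "i \<le> k - 1" "V i" "\<And>j. i < j \<Longrightarrow> j \<le> k - 1 \<Longrightarrow> \<not> V j"
        by blast
      have "i < k" using i False less.prems(1) by linarith
      then have IH: "f (nr i) = f (nr k0)" "lab (nr i) = lab (nr k0)" using less.IH[of i] i by auto
      have "f (nr k) \<le> f (nr i) \<and> (f (nr k) = f (nr i) \<longrightarrow> lab (nr k) = lab (nr i) \<and>
          (\<forall>m. i \<le> m \<and> m \<le> k \<longrightarrow> (\<exists>q\<in>Q. lab q = lab (nr i) \<and> dist (x m) q < \<epsilon>)))"
        by (rule visit) (use i \<open>i < k\<close> less.prems in auto)
      then show ?thesis using k0_min[OF less.prems(2)] IH by auto
    qed simp
  qed
  show ?thesis
  proof (rule bexI[of _ "nr k0"], rule exI[of _ k0], intro allI impI)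
    fix m assume "k0 \<le> m"
    then obtain i where i: "k0 \<le> i" "i \<le> m" "V i" "\<And>j. i < j \<Longrightarrow> j \<le> m \<Longrightarrow> \<not> V j"
      using prev by blast
    \<comment> \<open>The first visit after \<open>m\<close>; with \<open>i\<close>, the last visit
      up to \<open>m\<close>, it encloses \<open>m\<close> between consecutive visits.\<close>
    define k' where "k' = (LEAST k. m < k \<and> V k)"
    obtain k1 where "m < k1 \<and> V k1" using infV[of "Suc m"] Suc_le_lessD by blast
    then have k': "m < k' \<and> V k'" unfolding k'_def by (rule LeastI)
    have "\<not> V j" if "m < j" "j < k'" for j using not_less_Least[of j "\<lambda>k. m < k \<and> V k"] that unfolding k'_def by blast
    then have between: "\<not> V j" if "i < j" "j < k'" for j using i(4) that by (cases "j \<le> m") auto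
    have "f (nr k') \<le> f (nr i) \<and> (f (nr k') = f (nr i) \<longrightarrow> lab (nr k') = lab (nr i) \<and>
          (\<forall>m. i \<le> m \<and> m \<le> k' \<longrightarrow> (\<exists>q\<in>Q. lab q = lab (nr i) \<and> dist (x m) q < \<epsilon>)))"
      by (rule visit) (use i k' between in auto)
    moreover have "f (nr i) = f (nr k0)" "lab (nr i) = lab (nr k0)" "f (nr k') = f (nr k0)"
      using const[of i] const[of k'] i k' by auto
    ultimately have "\<forall>m. i \<le> m \<and> m \<le> k' \<longrightarrow> (\<exists>q\<in>Q. lab q = lab (nr k0) \<and> dist (x m) q < \<epsilon>)" by simp
    then show "\<exists>q\<in>Q. lab q = lab (nr k0) \<and> dist (x m) q < \<epsilon>" using i(2) k' by auto
  qed (use nr(1)[OF k0(1)] in simp)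
qed

section \<open>Clopen pieces of the critical set\<close>

text \<open>Components of a compact set need not be at positive distance from each other, so labels
  are given to relatively clopen pieces, each close to one component of \<open>K\<close>. Finitely
  many pieces cover \<open>Q\<close>; the least index of a piece containing a point is locally
  constant, and compactness makes this uniform.\<close>

lemma component_labelling:
  fixes K Q :: "'a::euclidean_space set"
  assumes "compact Q" "Q \<subseteq> K" "0 < \<epsilon>"
  obtains lab :: "'a \<Rightarrow> nat" and C :: "nat \<Rightarrow> 'a set" and D :: real where "0 < D"
    "\<And>p. p \<in> Q \<Longrightarrow> C (lab p) \<in> components K \<and> infdist p (C (lab p)) < \<epsilon>"
    "\<And>p q. p \<in> Q \<Longrightarrow> q \<in> Q \<Longrightarrow> dist p q < D \<Longrightarrow> lab p = lab q"
proof -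
  define nb where "nb p W C \<longleftrightarrow> open W \<and> compact (Q \<inter> W) \<and> p \<in> W \<and> C \<in> components K \<and>
      (\<forall>z\<in>Q \<inter> W. infdist z C < \<epsilon>)" for p W C
  have "\<exists>W C. nb p W C" if "p \<in> Q" for p
  proof -
    obtain B where B: "B \<in> components Q" "p \<in> B" using \<open>p \<in> Q\<close> Union_components[of Q] by blast
    have "B \<subseteq> K" "connected B" "B \<noteq> {}"
      using B assms(2) in_components_subset in_components_connected in_components_nonempty by blast+
    moreover from this have "K \<noteq> {}" by blast
    ultimately obtain C where C: "C \<in> components K" "B \<subseteq> C"
      using exists_component_superset[of B K] by blast
    let ?U = "{z. infdist z B < \<epsilon>}"
    have "open ?U" by (intro open_Collect_less continuous_intros)
    moreover have "B \<subseteq> ?U" using \<open>0 < \<epsilon>\<close> by auto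
    moreover have "compact B" using compact_components[OF assms(1) B(1)] .
    moreover have "locally compact Q"
      using assms(1) by (simp add: compact_imp_closed closed_imp_locally_compact)
    ultimately obtain T where T: "openin (top_of_set Q) T" "compact T" "B \<subseteq> T" "T \<subseteq> ?U"
      using Sura_Bura_clopen_subset[of Q B ?U] B(1) by blast
    obtain W where "open W" "T = Q \<inter> W" using T(1) by (auto simp: openin_open)
    moreover have "infdist z C < \<epsilon>" if "z \<in> T" for z
      using infdist_mono[OF C(2) \<open>B \<noteq> {}\<close>, of z] T(4) that by force
    ultimately have "nb p W C" using T(2,3) B(2) C(1) unfolding nb_def by blast
    then show ?thesis by blast
  qed
  then obtain W C where "\<And>p. p \<in> Q \<Longrightarrow> nb p (W p) (C p)" by metis
  then have WT: "open (W p) \<and> compact (Q \<inter> W p) \<and> p \<in> W p \<and> C p \<in> components K \<and>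
      (\<forall>z\<in>Q \<inter> W p. infdist z (C p) < \<epsilon>)" if "p \<in> Q" for p
    using that unfolding nb_def by blast
  have "Q \<subseteq> (\<Union>p\<in>Q. W p)" using WT by blast
  then obtain P where P: "P \<subseteq> Q" "finite P" "Q \<subseteq> (\<Union>p\<in>P. W p)"
    using compactE_image[OF assms(1), of Q W] WT by metis
  obtain h where h: "bij_betw h {..<card P} P"
    using ex_bij_betw_nat_finite[OF P(2)] by (metis lessThan_atLeast0)
  have hP: "h i \<in> P" "h i \<in> Q" if "i < card P" for i using h that P(1) by (auto simp: bij_betw_def)
  define lab where "lab p = (LEAST i. i < card P \<and> p \<in> W (h i))" for p
  have lab: "lab p < card P \<and> p \<in> W (h (lab p))" if "p \<in> Q" for p
  proof -
    obtain r where "r \<in> P" "p \<in> W r" using P(3) \<open>p \<in> Q\<close> by blast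
    moreover from this have "r \<in> h ` {..<card P}" using bij_betw_imp_surj_on[OF h] by simp
    then obtain j where "j < card P" "r = h j" by blast
    ultimately have "j < card P \<and> p \<in> W (h j)" by simp
    then show ?thesis unfolding lab_def by (rule LeastI)
  qed
  have lab_min: "p \<notin> W (h j)" if "j < lab p" "p \<in> Q" for j p
    using not_less_Least[of j "\<lambda>i. i < card P \<and> p \<in> W (h i)"] that lab[OF that(2)] unfolding lab_def by auto
  have loc: "\<exists>e>0. \<forall>q\<in>Q. dist q p < e \<longrightarrow> lab q = lab p" if p: "p \<in> Q" for p
  proof -
    \<comment> \<open>Earlier pieces are closed, so removing them leaves an open neighbourhood of
      \<open>p\<close> on which the least index is the same.\<close>
    let ?O = "W (h (lab p)) - (\<Union>j<lab p. Q \<inter> W (h j))"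
    have "closed (\<Union>j<lab p. Q \<inter> W (h j))"
    proof (intro closed_UN ballI)
      fix j assume "j \<in> {..<lab p}"
      then have "h j \<in> Q" using lab[OF p] hP(2)[of j] by simp
      then show "closed (Q \<inter> W (h j))" using WT compact_imp_closed by blast
    qed simp
    moreover have "open (W (h (lab p)))" using lab[OF p] WT hP(2) by blast
    ultimately have "open ?O" by (intro open_Diff)
    moreover have "p \<in> ?O"
    proof -
      have "p \<notin> Q \<inter> W (h j)" if "j < lab p" for j
        using lab_min[OF that p] WT[of "h j"] hP(2)[of j] lab[OF p] that by auto
      then show ?thesis using lab[OF p] by blast
    qed
    ultimately obtain e where e: "0 < e" "ball p e \<subseteq> ?O" by (meson open_contains_ball)
    have "lab q = lab p" if q: "q \<in> Q" "dist q p < e" for q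
    proof -
      have qO: "q \<in> ?O" using e(2) q(2) by (auto simp: dist_commute)
      have "lab q \<le> lab p" using lab[OF p] qO unfolding lab_def[of q] by (intro Least_le) auto
      moreover have "\<not> lab q < lab p"
      proof
        assume less: "lab q < lab p"
        then have "q \<in> Q \<inter> W (h (lab q))"
          using lab[OF q(1)] WT[of "h (lab q)"] hP(2)[of "lab q"] q(1) by auto
        then show False using qO less by blast
      qed
      ultimately show ?thesis by simp
    qed
    then show ?thesis using e(1) by blast
  qed
  \<comment> \<open>Uniform continuity of the integer-valued label with tolerance 1 yields
    \<open>D\<close>.\<close>
  have "continuous_on Q (\<lambda>p. real (lab p))"
    unfolding continuous_on_iff
  proof (intro ballI allI impI)
    fix p and e :: real assume "p \<in> Q" "0 < e"
    then obtain d where "0 < d" "\<forall>q\<in>Q. dist q p < d \<longrightarrow> lab q = lab p" using loc by blast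
    then show "\<exists>d>0. \<forall>q\<in>Q. dist q p < d \<longrightarrow> dist (real (lab q)) (real (lab p)) < e"
      using \<open>0 < e\<close> by (intro exI[of _ d]) auto
  qed
  then have "uniformly_continuous_on Q (\<lambda>p. real (lab p))"
    using assms(1) by (rule compact_uniformly_continuous)
  then obtain D where D: "0 < D" "\<And>p q. p \<in> Q \<Longrightarrow> q \<in> Q \<Longrightarrow> dist q p < D \<Longrightarrow> dist (real (lab q)) (real (lab p)) < 1"
    unfolding uniformly_continuous_on_def by (meson zero_less_one)
  show ?thesis
  proof (rule that[of D "\<lambda>i. C (h i)" lab])
    show "C (h (lab p)) \<in> components K \<and> infdist p (C (h (lab p))) < \<epsilon>" if "p \<in> Q" for p
      using lab[OF that] WT[of "h (lab p)"] hP(2)[of "lab p"] that by auto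
    show "lab p = lab q" if "p \<in> Q" "q \<in> Q" "dist p q < D" for p q
      using D(2)[OF that(2,1,3)] by (simp add: dist_real_def)
  qed (rule D(1))
qed

section \<open>Value gaps, sublevel sets and the choice of constants\<close>

lemma finite_set_gap:
  fixes F :: "real set"
  assumes "finite F"
  obtains \<gamma> where "0 < \<gamma>" "\<And>u v. u \<in> F \<Longrightarrow> v \<in> F \<Longrightarrow> u < v + \<gamma> \<Longrightarrow> u \<le> v"
proof -
  \<comment> \<open>The element 1 keeps the set nonempty when \<open>F\<close> has at most one
    element.\<close>
  let ?S = "insert 1 ((\<lambda>(u, v). u - v) ` {(u, v). u \<in> F \<and> v \<in> F \<and> v < u})"
  have "{(u, v). u \<in> F \<and> v \<in> F \<and> v < u} \<subseteq> F \<times> F" by auto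
  then have "finite {(u, v). u \<in> F \<and> v \<in> F \<and> v < u}" using assms finite_subset by blast
  then have fin: "finite ?S" by simp
  have "0 < Min ?S" using fin by (subst Min_gr_iff) auto
  moreover have "u \<le> v" if "u \<in> F" "v \<in> F" "u < v + Min ?S" for u v
  proof (rule ccontr)
    assume "\<not> u \<le> v"
    then have "u - v \<in> ?S" using that by force
    then have "Min ?S \<le> u - v" using fin by (rule Min_le[rotated])
    then show False using that(3) by simp
  qed
  ultimately show ?thesis using that by blast
qed

lemma coercive_sublevel_compact:
  fixes f :: "'a::euclidean_space \<Rightarrow> real"
  assumes "continuous_on UNIV f" "coercive f"
  shows "compact {x. f x \<le> b}"
proof -
  have "eventually (\<lambda>x. b < f x) at_infinity"
    using assms(2) unfolding coercive_def filterlim_at_top_dense by blast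
  then obtain R where R: "\<And>x. R \<le> norm x \<Longrightarrow> b < f x" unfolding eventually_at_infinity by blast
  have "norm x \<le> R" if "f x \<le> b" for x using R[of x] that by force
  then have "bounded {x. f x \<le> b}" unfolding bounded_iff by blast
  moreover have "closed {x. f x \<le> b}"
    using assms(1) by (intro closed_Collect_le) auto
  ultimately show ?thesis by (simp add: compact_eq_bounded_closed)
qed

lemma shadowed_mono: "shadowed f c b T \<epsilon> \<alpha> x \<Longrightarrow> \<epsilon> \<le> \<epsilon>' \<Longrightarrow> shadowed f c b T \<epsilon>' \<alpha> x"
  unfolding shadowed_def by (meson order_trans)

lemma approximated_iff:
  "approximated_by_subgradient_trajectories M f \<longleftrightarrow>
     (\<exists>c>0. \<forall>X\<^sub>0 X\<^sub>1. compact X\<^sub>0 \<and> compact X\<^sub>1 \<longrightarrow>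
       (\<exists>T>0. \<forall>\<epsilon>>0. \<exists>\<alpha>\<^sub>m>0. \<forall>\<alpha> \<in> {0<..\<alpha>\<^sub>m}. \<forall>k\<^sub>m. \<forall>x \<in> M f \<alpha> X\<^sub>0 k\<^sub>m.
         (\<forall>k \<le> k\<^sub>m. x k \<in> X\<^sub>1) \<longrightarrow>
         (\<exists>y. subgradient_trajectory f c T y \<and> y 0 \<in> X\<^sub>0 \<and>
              (\<forall>k \<in> {k\<^sub>m..k\<^sub>m + nat \<lfloor>T / \<alpha>\<rfloor>}.
                 norm (x k - y ((real k - real k\<^sub>m) * \<alpha>)) \<le> \<epsilon>))))"
  unfolding approximated_by_subgradient_trajectories_def subgradient_trajectory_def
  by (simp only: conj_assoc)

theorem corollary1:
  fixes S :: "nat \<Rightarrow> real list set set"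
    and bs :: "'a::euclidean_space list"
    and f :: "'a \<Rightarrow> real"
    and M :: "'a iter_method"
    and X\<^sub>0 :: "'a set"
    and \<epsilon> :: real
  assumes "o_minimal S"
    and "ordered_basis bs"
    and "locally_lipschitz f"
    and "coercive f"
    and "tame_function S bs f"
    and "iterative_method M"
    and "approximated_by_subgradient_trajectories M f"
    and "bounded X\<^sub>0"
    and "\<epsilon> > 0"
  shows "\<exists>\<alpha>\<^sub>m>0. \<forall>\<alpha> \<in> {0<..\<alpha>\<^sub>m}. \<forall>x \<in> M f \<alpha> X\<^sub>0 0.
           \<exists>C \<in> components (critical_points f). \<exists>k\<^sub>0. \<forall>k \<ge> k\<^sub>0. infdist (x k) C \<le> \<epsilon>"
proof -
  interpret o_min S by unfold_locales (rule assms(1))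
  note lip = assms(3)
  have contf: "continuous_on UNIV f" by (rule locally_lipschitz_continuous[OF lip])
  have def: "loc_definable f" by (rule tame_loc_definable[OF assms(2,5) contf])
  have semi: "semismooth_above f"
    unfolding semismooth_above_def using upper_semismooth[OF lip def] by blast
  note cpt = coercive_sublevel_compact[OF contf assms(4)]
  obtain a0 where a0: "\<And>x. x \<in> X\<^sub>0 \<Longrightarrow> f x \<le> a0"
  proof -
    have "compact (f ` closure X\<^sub>0)"
      using assms(8) by (intro compact_continuous_image continuous_on_subset[OF contf]) auto
    then have "bounded (f ` closure X\<^sub>0)" by (rule compact_imp_bounded)
    then obtain B where "\<And>x. x \<in> closure X\<^sub>0 \<Longrightarrow> norm (f x) \<le> B" unfolding bounded_iff by blast
    then have "f x \<le> B" if "x \<in> X\<^sub>0" for x using closure_subset that by fastforce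
    then show thesis by (rule that)
  qed
  \<comment> \<open>One unit above \<open>a0\<close> leaves room for the level \<open>b\<close>, so
    critical values are counted in a single ball.\<close>
  obtain R where R: "\<And>x. f x \<le> a0 + 1 \<Longrightarrow> norm x < R"
    using compact_imp_bounded[OF cpt[of "a0 + 1"]] unfolding bounded_pos_less by blast
  define F where "F = f ` (critical_points f \<inter> ball 0 R)"
  have "finite F" unfolding F_def by (rule finite_critical_values[OF lip def])
  obtain d where d: "a0 < d" "\<And>v. a0 < v \<Longrightarrow> v < d \<Longrightarrow> v \<notin> F"
    using eventually_at_right_notin_finite[OF \<open>finite F\<close>, of a0] unfolding eventually_at_right_field by blast
  define d' where "d' = min d (a0 + 1)"
  have d': "a0 < d'" "d' \<le> d" "d' \<le> a0 + 1" using d(1) by (auto simp: d'_def)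
  \<comment> \<open>The levels \<open>a\<close> and \<open>b\<close> divide a gap without critical
    values above \<open>a0\<close> into thirds: critical points below level \<open>b\<close> have
    values at most \<open>a0\<close>, which keeps iterates above \<open>a\<close> away from
    them.\<close>
  define w where "w = (d' - a0) / 3"
  define a where "a = a0 + w"
  define b where "b = a0 + 2 * w"
  have "0 < w" "b < d'" using d'(1) by (auto simp: b_def w_def field_simps)
  then have w: "0 < w" "b < d" "b < a0 + 1" using d'(2,3) by auto
  define Q where "Q = critical_points f \<inter> {x. f x \<le> b}"
  have Q_compact: "compact Q" unfolding Q_def by (rule closed_Int_compact[OF closed_critical_points cpt])
  have "f ` Q \<subseteq> F"
  proof
    fix v assume "v \<in> f ` Q"
    then obtain q where q: "q \<in> critical_points f" "f q \<le> b" "v = f q" by (auto simp: Q_def)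
    then have "norm q < R" using w by (intro R) simp
    then show "v \<in> F" using q by (auto simp: F_def)
  qed
  then have finQ: "finite (f ` Q)" using \<open>finite F\<close> by (rule finite_subset)
  have Q_low: "f q \<le> a0" if "q \<in> Q" for q
  proof (rule ccontr)
    assume "\<not> f q \<le> a0"
    moreover have "f q \<in> F" "f q \<le> b" using that \<open>f ` Q \<subseteq> F\<close> by (auto simp: Q_def)
    ultimately show False using d(2)[of "f q"] w by simp
  qed
  obtain \<gamma> where \<gamma>: "0 < \<gamma>" "\<And>u v. u \<in> f ` Q \<Longrightarrow> v \<in> f ` Q \<Longrightarrow> u < v + \<gamma> \<Longrightarrow> u \<le> v"
    by (rule finite_set_gap[OF finQ]) blast
  have "0 < \<epsilon> / 2" using assms(9) by simp
  have QK: "Q \<subseteq> critical_points f" by (auto simp: Q_def)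
  obtain lab :: "'a \<Rightarrow> nat" and C and D1 where D1: "0 < D1"
    "\<And>p. p \<in> Q \<Longrightarrow> C (lab p) \<in> components (critical_points f) \<and> infdist p (C (lab p)) < \<epsilon> / 2"
    "\<And>p q. p \<in> Q \<Longrightarrow> q \<in> Q \<Longrightarrow> dist p q < D1 \<Longrightarrow> lab p = lab q"
    by (rule component_labelling[OF Q_compact QK \<open>0 < \<epsilon> / 2\<close>]) (rule that)
  have "uniformly_continuous_on {x. f x \<le> b} f"
    by (intro compact_uniformly_continuous continuous_on_subset[OF contf] cpt) auto
  then have unif: "\<exists>r>0. \<forall>u v. f u \<le> b \<and> f v \<le> b \<and> dist u v < r \<longrightarrow> \<bar>f u - f v\<bar> < e" if "0 < e" for e
  proof -
    obtain r where "0 < r" "\<And>u v. f u \<le> b \<Longrightarrow> f v \<le> b \<Longrightarrow> dist v u < r \<Longrightarrow> dist (f v) (f u) < e"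
      using \<open>uniformly_continuous_on {x. f x \<le> b} f\<close> \<open>0 < e\<close> unfolding uniformly_continuous_on_def by blast
    then show ?thesis by (intro exI[of _ r]) (auto simp: dist_real_def)
  qed
  obtain D2 where D2: "0 < D2" "\<And>u v. f u \<le> b \<Longrightarrow> f v \<le> b \<Longrightarrow> dist u v < D2 \<Longrightarrow> \<bar>f u - f v\<bar> < \<gamma>"
    using unif[OF \<gamma>(1)] by blast
  \<comment> \<open>Values closer than the gap \<open>\<gamma>\<close> coincide, so below this
    distance critical points share the value as well as the label.\<close>
  define D where "D = min D1 D2"
  have D: "lab p = lab q \<and> f p = f q" if pq: "p \<in> Q" "q \<in> Q" "dist p q < D" for p q
  proof
    show "lab p = lab q" using D1(3) pq by (simp add: D_def)
    have "\<bar>f p - f q\<bar> < \<gamma>" using D2(2)[of p q] pq by (simp add: D_def Q_def)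
    then have "f p \<le> f q" "f q \<le> f p" using pq by (auto intro!: \<gamma>(2))
    then show "f p = f q" by simp
  qed
  define \<epsilon>1 where "\<epsilon>1 = min (\<epsilon> / 2) (D / 4)"
  have \<epsilon>1: "0 < \<epsilon>1" "4 * \<epsilon>1 \<le> D" "\<epsilon>1 \<le> \<epsilon> / 2" using assms(9) D1(1) D2(1) by (auto simp: \<epsilon>1_def D_def)
  from assms(7)[unfolded approximated_iff] obtain c where "0 < c" and approx: "\<forall>X\<^sub>0 X\<^sub>1. compact X\<^sub>0 \<and> compact X\<^sub>1 \<longrightarrow>
       (\<exists>T>0. \<forall>\<epsilon>>0. \<exists>\<alpha>\<^sub>m>0. \<forall>\<alpha> \<in> {0<..\<alpha>\<^sub>m}. \<forall>k\<^sub>m. \<forall>x \<in> M f \<alpha> X\<^sub>0 k\<^sub>m.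
         (\<forall>k \<le> k\<^sub>m. x k \<in> X\<^sub>1) \<longrightarrow>
         (\<exists>y. subgradient_trajectory f c T y \<and> y 0 \<in> X\<^sub>0 \<and>
              (\<forall>k \<in> {k\<^sub>m..k\<^sub>m + nat \<lfloor>T / \<alpha>\<rfloor>}.
                 norm (x k - y ((real k - real k\<^sub>m) * \<alpha>)) \<le> \<epsilon>)))"
    by (elim exE conjE) (rule that)
  \<comment> \<open>Both compact sets are the sublevel set: a window may start at any iterate up to
    which the sequence has stayed in it.\<close>
  from approx[rule_format, OF conjI[OF cpt[of b] cpt[of b]]]
  obtain T where "0 < T" and T: "\<forall>\<epsilon>>0. \<exists>\<alpha>\<^sub>m>0. \<forall>\<alpha> \<in> {0<..\<alpha>\<^sub>m}. \<forall>k\<^sub>m. \<forall>x \<in> M f \<alpha> {x. f x \<le> b} k\<^sub>m.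
         (\<forall>k \<le> k\<^sub>m. x k \<in> {x. f x \<le> b}) \<longrightarrow>
         (\<exists>y. subgradient_trajectory f c T y \<and> y 0 \<in> {x. f x \<le> b} \<and>
              (\<forall>k \<in> {k\<^sub>m..k\<^sub>m + nat \<lfloor>T / \<alpha>\<rfloor>}.
                 norm (x k - y ((real k - real k\<^sub>m) * \<alpha>)) \<le> \<epsilon>))"
    by (elim exE conjE) (rule that)
  \<comment> \<open>The common \<open>G\<close> lets a sequence started in \<open>X\<^sub>0\<close>
    count as one that lies in the sublevel set at index \<open>k\<close>.\<close>
  obtain G where G: "\<And>\<alpha> X\<^sub>0 k. 0 < \<alpha> \<Longrightarrow> M f \<alpha> X\<^sub>0 k = {x \<in> G f \<alpha>. x k \<in> X\<^sub>0}"
    using assms(6) unfolding iterative_method_def by blast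
  note run = run_estimate[OF lip semi \<open>0 < c\<close> cpt[of b] \<open>0 < T\<close>]
  have "0 < \<epsilon>1 / 4" using \<epsilon>1 by simp
  from run[OF this] obtain \<kappa>1 where "0 < \<kappa>1" and run1: "\<forall>\<omega>>0. \<exists>\<epsilon>>0. \<exists>\<alpha>0>0. \<forall>\<alpha> x.
      0 < \<alpha> \<and> \<alpha> \<le> \<alpha>0 \<and> shadowed f c b T \<epsilon> \<alpha> x \<longrightarrow> controlled f b (\<epsilon>1 / 4) \<kappa>1 \<omega> \<alpha> x"
    by blast
  \<comment> \<open>Small against the price \<open>\<kappa>1 * \<epsilon>1\<close> of an escape and
    against the value gaps; the bound by \<open>w\<close> ensures that an iterate above
    \<open>a\<close> and within level \<open>b\<close> is not within \<open>\<rho>\<close> of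
    \<open>Q\<close>.\<close>
  define \<delta> where "\<delta> = Min {\<kappa>1 * \<epsilon>1 / 16, \<gamma> / 4, w}"
  have \<delta>: "0 < \<delta>" "16 * \<delta> \<le> \<kappa>1 * \<epsilon>1" "4 * \<delta> \<le> \<gamma>" "\<delta> \<le> w"
    using \<open>0 < \<kappa>1\<close> \<epsilon>1(1) \<gamma>(1) w(1) by (auto simp: \<delta>_def)
  obtain r where r: "0 < r" "\<And>u v. f u \<le> b \<Longrightarrow> f v \<le> b \<Longrightarrow> dist u v < r \<Longrightarrow> \<bar>f u - f v\<bar> < \<delta>"
    using unif[OF \<delta>(1)] by blast
  define \<rho> where "\<rho> = min r (\<epsilon>1 / 8)"
  have \<rho>: "0 < \<rho>" "\<rho> \<le> \<epsilon>1 / 8" "\<rho> \<le> r" using r(1) \<epsilon>1(1) by (auto simp: \<rho>_def)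
  from run[OF \<rho>(1)] obtain \<kappa>2 where "0 < \<kappa>2" and run2: "\<forall>\<omega>>0. \<exists>\<epsilon>>0. \<exists>\<alpha>0>0. \<forall>\<alpha> x.
      0 < \<alpha> \<and> \<alpha> \<le> \<alpha>0 \<and> shadowed f c b T \<epsilon> \<alpha> x \<longrightarrow> controlled f b \<rho> \<kappa>2 \<omega> \<alpha> x"
    by blast
  define \<omega> where "\<omega> = Min {\<delta> / 8, \<epsilon>1 / 8, w / 3}"
  have \<omega>: "0 < \<omega>" "\<omega> \<le> \<delta> / 8" "\<omega> \<le> \<epsilon>1 / 8" "3 * \<omega> \<le> b - a"
    using \<delta>(1) \<epsilon>1(1) w(1) by (auto simp: \<omega>_def a_def b_def)
  from run1[THEN spec, THEN mp, OF \<omega>(1)] obtain e1 \<alpha>1 where e1: "0 < e1" "0 < \<alpha>1" and run1: "\<forall>\<alpha> x.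
      0 < \<alpha> \<and> \<alpha> \<le> \<alpha>1 \<and> shadowed f c b T e1 \<alpha> x \<longrightarrow> controlled f b (\<epsilon>1 / 4) \<kappa>1 \<omega> \<alpha> x"
    by (elim exE conjE) (rule that)
  from run2[THEN spec, THEN mp, OF \<omega>(1)] obtain e2 \<alpha>2 where e2: "0 < e2" "0 < \<alpha>2" and run2: "\<forall>\<alpha> x.
      0 < \<alpha> \<and> \<alpha> \<le> \<alpha>2 \<and> shadowed f c b T e2 \<alpha> x \<longrightarrow> controlled f b \<rho> \<kappa>2 \<omega> \<alpha> x"
    by (elim exE conjE) (rule that)
  define e where "e = min e1 e2"
  have "0 < e" using e1 e2 by (simp add: e_def)
  from T[THEN spec, THEN mp, OF this] obtain \<alpha>3 where "0 < \<alpha>3" and \<alpha>3: "\<forall>\<alpha> \<in> {0<..\<alpha>3}. \<forall>k\<^sub>m. \<forall>x \<in> M f \<alpha> {x. f x \<le> b} k\<^sub>m.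
         (\<forall>k \<le> k\<^sub>m. x k \<in> {x. f x \<le> b}) \<longrightarrow>
         (\<exists>y. subgradient_trajectory f c T y \<and> y 0 \<in> {x. f x \<le> b} \<and>
              (\<forall>k \<in> {k\<^sub>m..k\<^sub>m + nat \<lfloor>T / \<alpha>\<rfloor>}.
                 norm (x k - y ((real k - real k\<^sub>m) * \<alpha>)) \<le> e))"
    by (elim exE conjE) (rule that)
  show ?thesis
  proof (intro exI[of _ "Min {\<alpha>1, \<alpha>2, \<alpha>3}"] conjI ballI)
    show "0 < Min {\<alpha>1, \<alpha>2, \<alpha>3}" using e1 e2 \<open>0 < \<alpha>3\<close> by simp
    fix \<alpha> x assume "\<alpha> \<in> {0<..Min {\<alpha>1, \<alpha>2, \<alpha>3}}" and x: "x \<in> M f \<alpha> X\<^sub>0 0"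
    then have \<alpha>: "0 < \<alpha>" "\<alpha> \<le> \<alpha>1" "\<alpha> \<le> \<alpha>2" "\<alpha> \<le> \<alpha>3" by auto
    have xG: "x \<in> G f \<alpha>" "x 0 \<in> X\<^sub>0" using x G[OF \<alpha>(1)] by auto
    have "shadowed f c b T e \<alpha> x"
      unfolding shadowed_def
    proof (intro allI impI)
      fix k assume lev: "\<forall>i\<le>k. f (x i) \<le> b"
      then have "x \<in> M f \<alpha> {x. f x \<le> b} k" using G[OF \<alpha>(1)] xG(1) by simp
      moreover have "\<alpha> \<in> {0<..\<alpha>3}" using \<alpha>(1,4) by simp
      moreover have "\<forall>i\<le>k. x i \<in> {x. f x \<le> b}" using lev by simp
      ultimately obtain y where y: "subgradient_trajectory f c T y" "f (y 0) \<le> b"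
        "\<And>i. i \<in> {k..k + nat \<lfloor>T / \<alpha>\<rfloor>} \<Longrightarrow> norm (x i - y ((real i - real k) * \<alpha>)) \<le> e"
        using \<alpha>3 by blast
      have "norm (x (k + j) - y (real j * \<alpha>)) \<le> e" if "j \<le> nat \<lfloor>T / \<alpha>\<rfloor>" for j
        using y(3)[of "k + j"] that by simp
      then show "\<exists>y. subgradient_trajectory f c T y \<and> f (y 0) \<le> b \<and>
          (\<forall>j\<le>nat \<lfloor>T / \<alpha>\<rfloor>. norm (x (k + j) - y (real j * \<alpha>)) \<le> e)" using y(1,2) by blast
    qed
    then have "shadowed f c b T e1 \<alpha> x" "shadowed f c b T e2 \<alpha> x"
      by (auto simp: e_def elim!: shadowed_mono)
    note run1 = run1[rule_format, OF conjI[OF \<alpha>(1) conjI[OF \<alpha>(2) this(1)]], unfolded controlled_def]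
      and run2 = run2[rule_format, OF conjI[OF \<alpha>(1) conjI[OF \<alpha>(3) this(2)]], unfolded controlled_def]
    have near: "\<bar>f (x i) - f q\<bar> < \<delta>" if "q \<in> Q" "dist (x i) q < \<rho>" "f (x i) \<le> b" for i q
      using that \<rho>(3) by (intro r(2)) (auto simp: Q_def)
    have lev: "f (x k) \<le> b" for k
    proof (rule sublevel_invariant[where a = a and \<omega> = \<omega> and Q = Q and \<rho> = \<rho>])
      show "f (x 0) \<le> a" "a \<le> b" using a0[OF xG(2)] w(1) by (auto simp: a_def b_def)
      show "f (x (Suc k)) \<le> f (x k) + \<omega>" if "\<forall>i\<le>k. f (x i) \<le> b" for k using run1 that by blast
      show "f (x (k + j)) \<le> f (x k) + \<omega>" if "\<forall>i<k + j. f (x i) \<le> b"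
        "\<forall>i. k \<le> i \<and> i \<le> k + j \<longrightarrow> (\<forall>q\<in>Q. \<rho> \<le> dist (x i) q)" for k j
      proof -
        have "f (x (k + j)) + \<kappa>2 * (real j * \<alpha> + norm (x (k + j) - x k)) \<le> f (x k) + \<omega>"
          using that by (intro run2[THEN conjunct1, rule_format]) (auto simp: Q_def)
        moreover have "0 \<le> \<kappa>2 * (real j * \<alpha> + norm (x (k + j) - x k))" using \<open>0 < \<kappa>2\<close> \<alpha>(1) by simp
        ultimately show ?thesis by linarith
      qed
      show "\<rho> \<le> dist (x i) q" if "a < f (x i)" "f (x i) \<le> b" "q \<in> Q" for i q
      proof (rule ccontr)
        assume "\<not> \<rho> \<le> dist (x i) q"
        then have "\<bar>f (x i) - f q\<bar> < \<delta>" using near that by simp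
        then show False using Q_low[OF that(3)] that(1) \<delta>(4) by (simp add: a_def)
      qed
    qed (use \<omega> in auto)
    have "bounded (f ` {x. f x \<le> b})"
      by (intro compact_imp_bounded compact_continuous_image continuous_on_subset[OF contf] cpt) auto
    then obtain B where B: "\<And>z. f z \<le> b \<Longrightarrow> \<bar>f z\<bar> \<le> B" unfolding bounded_iff by auto
    have "\<exists>p\<in>Q. \<exists>k0. \<forall>k\<ge>k0. \<exists>q\<in>Q. lab q = lab p \<and> dist (x k) q < \<epsilon>1"
    proof (rule eventually_near_one_class[OF finQ D \<epsilon>1(1,2) \<delta>(1) _ \<rho>(1,2) near[OF _ _ lev] \<omega>(1-3) _ _ \<open>0 < \<kappa>1\<close> \<delta>(2)])
      show "f p \<le> f q" if "p \<in> Q" "q \<in> Q" "f p < f q + 4 * \<delta>" for p q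
        using \<gamma>(2)[of "f p" "f q"] that \<delta>(3) by simp
      show "norm (x (Suc k) - x k) \<le> \<omega>" "f (x (Suc k)) \<le> f (x k) + \<omega>" for k using run1 lev by blast+
      \<comment> \<open>The rate per unit of time becomes a rate per iteration.\<close>
      show "0 < \<kappa>2 * \<alpha>" using \<open>0 < \<kappa>2\<close> \<alpha>(1) by simp
      show "f (x (k + j)) + \<kappa>1 * norm (x (k + j) - x k) \<le> f (x k) + \<omega>"
        if "\<forall>i. k \<le> i \<and> i \<le> k + j \<longrightarrow> (\<forall>q\<in>Q. \<epsilon>1 / 4 \<le> dist (x i) q)" for k j
      proof -
        have "f (x (k + j)) + \<kappa>1 * (real j * \<alpha> + norm (x (k + j) - x k)) \<le> f (x k) + \<omega>"
          using that lev by (intro run1[THEN conjunct1, rule_format]) (auto simp: Q_def)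
        moreover have "0 \<le> \<kappa>1 * (real j * \<alpha>)" using \<open>0 < \<kappa>1\<close> \<alpha>(1) by simp
        ultimately show ?thesis unfolding distrib_left by linarith
      qed
      show "f (x (k + j)) + \<kappa>2 * \<alpha> * real j \<le> f (x k) + \<omega>"
        if "\<forall>i. k \<le> i \<and> i \<le> k + j \<longrightarrow> (\<forall>q\<in>Q. \<rho> \<le> dist (x i) q)" for k j
      proof -
        have "f (x (k + j)) + \<kappa>2 * (real j * \<alpha> + norm (x (k + j) - x k)) \<le> f (x k) + \<omega>"
          using that lev by (intro run2[THEN conjunct1, rule_format]) (auto simp: Q_def)
        moreover have "0 \<le> \<kappa>2 * norm (x (k + j) - x k)" using \<open>0 < \<kappa>2\<close> by simp
        moreover have "\<kappa>2 * (real j * \<alpha>) = \<kappa>2 * \<alpha> * real j" by simp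
        ultimately show ?thesis unfolding distrib_left by linarith
      qed
      show "- B \<le> f (x k)" for k using B[OF lev, of k] by linarith
    qed
    then obtain p k0 where p: "p \<in> Q" "\<And>k. k0 \<le> k \<Longrightarrow> \<exists>q\<in>Q. lab q = lab p \<and> dist (x k) q < \<epsilon>1" by blast
    show "\<exists>C\<in>components (critical_points f). \<exists>k\<^sub>0. \<forall>k\<ge>k\<^sub>0. infdist (x k) C \<le> \<epsilon>"
    proof (intro bexI[of _ "C (lab p)"] exI[of _ k0] allI impI)
      show "C (lab p) \<in> components (critical_points f)" using D1(2)[OF p(1)] by blast
      fix k assume "k0 \<le> k"
      then obtain q where q: "q \<in> Q" "lab q = lab p" "dist (x k) q < \<epsilon>1" using p(2) by blast
      have "infdist (x k) (C (lab p)) \<le> infdist q (C (lab p)) + dist (x k) q" by (rule infdist_triangle)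
      also have "\<dots> \<le> \<epsilon> / 2 + \<epsilon> / 2" using D1(2)[OF q(1)] q(2,3) \<epsilon>1(3) by (intro add_mono) auto
      finally show "infdist (x k) (C (lab p)) \<le> \<epsilon>" by simp
    qed
  qed
qed

end
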